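(* Let $a,b\in\mathbb{R}$ and let $(N,\bar g)=((a,b)\times\mathbb{S}^n,\ dr^2+\lambda^2(r)\sigma)$ with $\lambda>0$, $\lambda'>0$ and $\lambda''\ge 0$ on $(a,b)$. Let $\Sigma\subset N$ be a closed, star-shaped and mean-convex hypersurface, $$\Sigma=\{(r(y),y)\in N: y\in\mathbb{S}^n\}.$$ Then the area of $\Sigma$ satisfies $$|\Sigma|\le|\mathbb{S}^n|\,\lambda(r_{max})^n,$$ where $r_{max}=\max_{\mathbb{S}^n}r$.
   Context: $\sigma$ is the round metric on $\mathbb{S}^n$, $\lambda$ is smooth, and hypersurfaces are smooth. Mean-convex means that the mean curvature $H$ (sum of the principal curvatures) is positive, with respect to the outward unit normal (positive $\partial_r$-component) and with the sign for which slices $\{r=\mathrm{const}\}$ have $H=n\lambda'/\lambda$. Star-shaped means being a graph over $\mathbb{S}^n$ as displayed. $|\mathbb{S}^n|$ is the area of the round unit sphere. *)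

theory Defs
  imports "HOL-Analysis.Analysis"
begin

section \<open>Smooth maps\<close>

primrec iter_dir_deriv ::
  "'a::real_normed_vector list \<Rightarrow> ('a \<Rightarrow> 'b::real_normed_vector) \<Rightarrow> 'a \<Rightarrow> 'b" where
  "iter_dir_deriv [] f = f"
| "iter_dir_deriv (v # vs) f = (\<lambda>x. frechet_derivative (iter_dir_deriv vs f) (at x) v)"

definition smooth_open :: "'a::real_normed_vector set \<Rightarrow> ('a \<Rightarrow> 'b::real_normed_vector) \<Rightarrow> bool" where
  "smooth_open U f \<longleftrightarrow> open U \<and> (\<forall>vs. \<forall>x\<in>U. iter_dir_deriv vs f differentiable (at x))"

text \<open>Smoothness on an arbitrary subset of a Euclidean space (an open interval, the unit sphere):
  locally, the map is the restriction of a smooth map defined on an open set.\<close>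

definition smooth_map_on :: "'a::euclidean_space set \<Rightarrow> ('a \<Rightarrow> 'b::euclidean_space) \<Rightarrow> bool" where
  "smooth_map_on X f \<longleftrightarrow>
     (\<forall>x\<in>X. \<exists>U h. x \<in> U \<and> smooth_open U h \<and> (\<forall>z\<in>U \<inter> X. h z = f z))"


section \<open>Riemannian metrics on open subsets of a Euclidean space\<close>

text \<open>A metric \<open>g\<close> is given by the bilinear forms \<open>g x\<close> on the tangent spaces. The vector
  \<open>christoffel g x v w\<close> is \<open>\<Gamma>\<^sup>k\<^sub>i\<^sub>j v\<^sup>i w\<^sup>j\<close>, given by the Koszul formula for constant
  vector fields.\<close>

definition christoffel ::
  "('a::euclidean_space \<Rightarrow> 'a \<Rightarrow> 'a \<Rightarrow> real) \<Rightarrow> 'a \<Rightarrow> 'a \<Rightarrow> 'a \<Rightarrow> 'a" where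
  "christoffel g x v w = (THE z. \<forall>u. g x z u =
     (frechet_derivative (\<lambda>p. g p w u) (at x) v
      + frechet_derivative (\<lambda>p. g p v u) (at x) w
      - frechet_derivative (\<lambda>p. g p v w) (at x) u) / 2)"


section \<open>Hypersurfaces parametrised by the unit sphere\<close>

text \<open>The differential at \<open>y\<close> of a map \<open>f\<close> defined on the unit sphere, for tangent
  vectors \<open>u\<close> (that is, \<open>u \<bullet> y = 0\<close>). The map is extended to be constant along rays;
  only its values on the sphere matter.\<close>

definition sphere_diff :: "('a::euclidean_space \<Rightarrow> 'b::euclidean_space) \<Rightarrow> 'a \<Rightarrow> 'a \<Rightarrow> 'b" where
  "sphere_diff f y u = frechet_derivative (\<lambda>x. f (x /\<^sub>R norm x)) (at y) u"

text \<open>The Levi-Civita derivative, in direction \<open>u\<close>, of a vector field \<open>V\<close> along \<open>F\<close>.\<close>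

definition cov_deriv_along ::
  "('a::euclidean_space \<Rightarrow> 'a \<Rightarrow> 'a \<Rightarrow> real) \<Rightarrow> ('a \<Rightarrow> 'a) \<Rightarrow> ('a \<Rightarrow> 'a) \<Rightarrow> 'a \<Rightarrow> 'a \<Rightarrow> 'a" where
  "cov_deriv_along g F V y u = sphere_diff V y u + christoffel g (F y) (sphere_diff F y u) (V y)"

text \<open>The unit normal is outward for the radial direction: the position vector \<open>F y\<close> is the
  value of \<open>\<partial>\<^sub>r\<close> at the point \<open>F y\<close> in the coordinates used for warped products below.\<close>

definition outward_normal ::
  "('a::euclidean_space \<Rightarrow> 'a \<Rightarrow> 'a \<Rightarrow> real) \<Rightarrow> ('a \<Rightarrow> 'a) \<Rightarrow> 'a \<Rightarrow> 'a" where
  "outward_normal g F y = (THE \<nu>.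
     g (F y) \<nu> \<nu> = 1 \<and>
     (\<forall>u. u \<bullet> y = 0 \<longrightarrow> g (F y) \<nu> (sphere_diff F y u) = 0) \<and>
     g (F y) \<nu> (F y) > 0)"

text \<open>Principal directions for \<open>\<kappa>\<close>, pulled back to the tangent space of the sphere at \<open>y\<close>. The
  shape operator is \<open>X \<mapsto> \<nabla>\<^sub>X \<nu>\<close>, so that convex hypersurfaces have nonnegative principal
  curvatures.\<close>

definition principal_space ::
  "('a::euclidean_space \<Rightarrow> 'a \<Rightarrow> 'a \<Rightarrow> real) \<Rightarrow> ('a \<Rightarrow> 'a) \<Rightarrow> 'a \<Rightarrow> real \<Rightarrow> 'a set" where
  "principal_space g F y \<kappa> =
     {u. u \<bullet> y = 0 \<and>
         cov_deriv_along g F (outward_normal g F) y u = \<kappa> *\<^sub>R sphere_diff F y u}"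

definition principal_curvatures ::
  "('a::euclidean_space \<Rightarrow> 'a \<Rightarrow> 'a \<Rightarrow> real) \<Rightarrow> ('a \<Rightarrow> 'a) \<Rightarrow> 'a \<Rightarrow> real set" where
  "principal_curvatures g F y = {\<kappa>. \<exists>u\<in>principal_space g F y \<kappa>. u \<noteq> 0}"

definition mean_curvature ::
  "('a::euclidean_space \<Rightarrow> 'a \<Rightarrow> 'a \<Rightarrow> real) \<Rightarrow> ('a \<Rightarrow> 'a) \<Rightarrow> 'a \<Rightarrow> real" where
  "mean_curvature g F y =
     (\<Sum>\<kappa>\<in>principal_curvatures g F y. real (dim (principal_space g F y \<kappa>)) * \<kappa>)"


section \<open>Area\<close>

text \<open>The \<open>n\<close>-sphere is the unit sphere of \<open>\<real>\<^sup>n \<times> \<real>\<close>. Inverse stereographic projection from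
  \<open>(0, 1)\<close> parametrises it up to that single point.\<close>

definition inv_stereographic :: "real ^ 'n \<Rightarrow> (real ^ 'n) \<times> real" where
  "inv_stereographic x =
     ((2 / (1 + (norm x)\<^sup>2)) *\<^sub>R x, ((norm x)\<^sup>2 - 1) / (1 + (norm x)\<^sup>2))"

text \<open>The area of an embedded sphere is the integral of \<open>sqrt (det (g\<^sub>i\<^sub>j))\<close>, where \<open>g\<^sub>i\<^sub>j\<close> is
  the induced metric in stereographic coordinates. The point that these coordinates miss has
  area zero.\<close>

definition area ::
  "((real ^ 'n) \<times> real \<Rightarrow> (real ^ 'n) \<times> real \<Rightarrow> (real ^ 'n) \<times> real \<Rightarrow> real)
    \<Rightarrow> ((real ^ 'n) \<times> real \<Rightarrow> (real ^ 'n) \<times> real) \<Rightarrow> real" where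
  "area g F = (LINT x|lborel.
     (let \<psi> = (\<lambda>z. F (inv_stereographic z));
          d\<psi> = (\<lambda>i. frechet_derivative \<psi> (at x) (axis i 1))
      in sqrt (det (\<chi> i j. g (\<psi> x) (d\<psi> i) (d\<psi> j)))))"

definition unit_sphere_area :: "'n::finite itself \<Rightarrow> real" where
  "unit_sphere_area _ =
     area (\<lambda>_. inner) (\<lambda>y. y :: (real ^ 'n) \<times> real)"


section \<open>Warped products over the sphere\<close>

text \<open>The manifold \<open>(a, b) \<times> S\<^sup>n\<close> is identified with the annulus
  \<open>{x. a < ln (norm x) < b}\<close> through the diffeomorphism \<open>(r, y) \<mapsto> exp r \<cdot> y\<close>, whose
  inverse is \<open>x \<mapsto> (ln (norm x), x / norm x)\<close>. The metric is the pullback of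
  \<open>dr\<^sup>2 + lam(r)\<^sup>2 \<sigma>\<close> under this inverse.\<close>

definition warped_metric ::
  "(real \<Rightarrow> real) \<Rightarrow> 'a::euclidean_space \<Rightarrow> 'a \<Rightarrow> 'a \<Rightarrow> real" where
  "warped_metric lam x v w =
     (let \<rho> = (\<lambda>z::'a. ln (norm z));
          \<theta> = (\<lambda>z::'a. z /\<^sub>R norm z)
      in frechet_derivative \<rho> (at x) v * frechet_derivative \<rho> (at x) w
         + (lam (\<rho> x))\<^sup>2 * (frechet_derivative \<theta> (at x) v \<bullet> frechet_derivative \<theta> (at x) w))"

text \<open>The embedding \<open>y \<mapsto> (r(y), y)\<close> in these coordinates.\<close>

definition radial_graph :: "('a::euclidean_space \<Rightarrow> real) \<Rightarrow> 'a \<Rightarrow> 'a" where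
  "radial_graph r y = exp (r y) *\<^sub>R y"

end

theory Submission
  imports Defs "HOL-Probability.Sinc_Integral"
begin

text \<open>The hypersurface can be pushed outward without losing mean-convexity. Let \<open>\<phi>\<close> be a primitive of
  \<open>1 / lam\<close> and use \<open>\<phi>\<close> instead of \<open>r\<close> as radial coordinate: the metric becomes \<open>lam\<^sup>2\<close> times the product
  metric of a cylinder. For a graph put \<open>p = \<nabla>(\<phi> \<circ> r)\<close> on the sphere, \<open>c = (1 + \<bar>p\<bar>\<^sup>2)\<^sup>-\<^sup>1\<^sup>/\<^sup>2\<close> and
  \<open>W = c p\<close>; the unit normal is \<open>c \<partial>\<^sub>r - W / lam\<close> and the mean curvature satisfies
  \<open>lam H = n lam' c - div W\<close>. Translating the graph in the \<open>\<phi>\<close>-direction changes neither \<open>p\<close> nor \<open>c\<close> nor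
  \<open>W\<close>, and an outward translation does not decrease \<open>lam'\<close> because \<open>lam'' \<ge> 0\<close>. So the translates stay
  mean-convex, and in the region between the hypersurface and the slice through its highest point their unit normals form a field of
  nonnegative divergence. Its flux through the hypersurface is the area of the hypersurface, its flux
  through the slice is at most the area of the slice.

  Integrating out the radial variable turns this into an inequality on the sphere. Let \<open>S\<close> be the maximum
  of \<open>r\<close> and \<open>G(y)\<close> the integral of \<open>lam\<^sup>n\<^sup>-\<^sup>1\<close> from \<open>r(y)\<close> to \<open>S\<close>. Then
  \<open>div (G W) = G div W - lam\<^sup>n c \<bar>p\<bar>\<^sup>2\<close>. Mean-convexity gives \<open>G div W \<le> n lam' G c\<close>, and since
  \<open>lam'\<close> is nondecreasing, \<open>n lam'(r) G \<le> lam(S)\<^sup>n - lam(r)\<^sup>n\<close>. As \<open>c \<le> 1\<close> and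
  \<open>c (1 + \<bar>p\<bar>\<^sup>2) = (1 + \<bar>p\<bar>\<^sup>2)\<^sup>1\<^sup>/\<^sup>2\<close>, the area density relative to the round sphere obeys
  \<open>lam(r)\<^sup>n (1 + \<bar>p\<bar>\<^sup>2)\<^sup>1\<^sup>/\<^sup>2 \<le> lam(S)\<^sup>n - div (G W)\<close>, and the divergence
  integrates to zero.

  Three results carry this argument. The lemma \<open>mean_curvature_eq\<close> is the formula for \<open>H\<close>; its proof
  computes the shape operator, and the sum of the principal curvatures with multiplicity is its trace
  because the operator is self-adjoint for the induced metric. The lemma \<open>area_radial_graph\<close> computes the
  area density in stereographic coordinates. The theorem \<open>sphere_divergence_theorem\<close> is the divergence
  theorem in these coordinates; the chart misses one point, and what has to be shown is that no flux
  escapes there.\<close>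

section \<open>Trace of a self-adjoint operator\<close>

text \<open>The induced metric of a graph is not the Euclidean inner product of the parameter space, so
  self-adjointness is needed with respect to an arbitrary inner product \<open>h\<close>.\<close>

definition pos_def_form :: "('a::euclidean_space \<Rightarrow> 'a \<Rightarrow> real) \<Rightarrow> bool" where
  "pos_def_form h \<longleftrightarrow> bilinear h \<and> (\<forall>u w. h u w = h w u) \<and> (\<forall>u. u \<noteq> 0 \<longrightarrow> h u u > 0)"

text \<open>A semidefinite form vanishing at \<open>u\<close> attains its minimum there, so its derivative \<open>2 Q u w\<close> vanishes.\<close>

lemma psd_form_null_vector:
  fixes Q :: "'a::real_vector \<Rightarrow> 'a \<Rightarrow> real"
  assumes Q: "bilinear Q" and sym: "\<And>u w. u \<in> T \<Longrightarrow> w \<in> T \<Longrightarrow> Q u w = Q w u" and T: "subspace T"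
    and psd: "\<And>u. u \<in> T \<Longrightarrow> Q u u \<ge> 0" and u: "u \<in> T" "Q u u = 0" and w: "w \<in> T"
  shows "Q u w = 0"
proof (rule ccontr)
  assume ne: "Q u w \<noteq> 0"
  \<comment> \<open>The minimiser of the quadratic would be \<open>- Q u w / Q w w\<close>; adding one avoids a zero denominator.\<close>
  define t where "t = - Q u w / (Q w w + 1)"
  have pos: "Q w w + 1 > 0" using psd[OF w] by simp
  have "Q (u + t *\<^sub>R w) (u + t *\<^sub>R w) = 2 * t * Q u w + t\<^sup>2 * Q w w"
    using u sym[OF u(1) w]
    by (simp add: bilinear_ladd[OF Q] bilinear_radd[OF Q] bilinear_lmul[OF Q] bilinear_rmul[OF Q]
        power2_eq_square algebra_simps)
  also have "\<dots> = (Q u w)\<^sup>2 / (Q w w + 1)\<^sup>2 * (Q w w - 2 * (Q w w + 1))"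
    using pos by (simp add: t_def power2_eq_square divide_simps) (simp add: algebra_simps)
  also have "\<dots> < 0"
    using pos ne psd[OF w] by (intro mult_pos_neg) auto
  also have "0 \<le> Q (u + t *\<^sub>R w) (u + t *\<^sub>R w)"
    using psd T u w by (simp add: subspace_add subspace_mul)
  finally show False by simp
qed

text \<open>A maximum point of the Rayleigh quotient \<open>h (L u) u / h u u\<close> is an eigenvector: with the maximal value
  \<open>\<kappa>\<close>, the form \<open>\<kappa> h v w - h (L v) w\<close> is semidefinite and vanishes at \<open>u\<close>.\<close>

lemma self_adjoint_eigenvector_exists:
  fixes L :: "'a::euclidean_space \<Rightarrow> 'a"
  assumes h: "pos_def_form h" and L: "linear L" and sa: "\<And>u w. h (L u) w = h u (L w)"
    and T: "subspace T" and inv: "L ` T \<subseteq> T" and ne: "T \<noteq> {0}"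
  obtains u \<kappa> where "u \<in> T" "u \<noteq> 0" "L u = \<kappa> *\<^sub>R u"
proof -
  have bil: "bilinear h" and sym: "\<And>u w. h u w = h w u" and pos: "\<And>u. u \<noteq> 0 \<Longrightarrow> h u u > 0"
    using h by (auto simp: pos_def_form_def)
  obtain z where z: "z \<in> T" "z \<noteq> 0" using ne T subspace_0 by blast
  define K where "K = T \<inter> sphere 0 1"
  have K: "compact K" unfolding K_def using closed_subspace[OF T] by (simp add: closed_Int_compact)
  have "z /\<^sub>R norm z \<in> K" using z T by (simp add: K_def subspace_mul)
  then have Kne: "K \<noteq> {}" by auto
  have bb: "bounded_bilinear h" using bil by (rule bilinear_conv_bounded_bilinear[THEN iffD1])
  have contL: "continuous_on K L" by (simp add: L linear_continuous_on linear_conv_bounded_linear[symmetric])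
  have cont: "continuous_on K (\<lambda>u. h (L u) u / h u u)"
  proof (intro continuous_on_divide bounded_bilinear.continuous_on[OF bb] contL continuous_on_id ballI)
    fix u assume "u \<in> K"
    then have "u \<noteq> 0" by (auto simp: K_def)
    then show "h u u \<noteq> 0" using pos[of u] by simp
  qed
  obtain u where u: "u \<in> K" "\<And>w. w \<in> K \<Longrightarrow> h (L w) w / h w w \<le> h (L u) u / h u u"
    using continuous_attains_sup[OF K Kne cont] by auto
  have u0: "u \<noteq> 0" "u \<in> T" using u by (auto simp: K_def)
  define \<kappa> where "\<kappa> = h (L u) u / h u u"
  define Q where "Q = (\<lambda>v w. \<kappa> * h v w - h (L v) w)"
  have Qb: "bilinear Q"
    unfolding Q_def bilinear_def
    by (auto intro!: linearI simp: linear_add[OF L] linear_scale[OF L] bilinear_ladd[OF bil]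
        bilinear_radd[OF bil] bilinear_lmul[OF bil] bilinear_rmul[OF bil] algebra_simps)
  have "Q w w \<ge> 0" if w: "w \<in> T" for w
  proof (cases "w = 0")
    case True then show ?thesis by (simp add: bilinear_lzero[OF Qb])
  next
    case False
    have "w /\<^sub>R norm w \<in> K" using w False T by (simp add: K_def subspace_mul)
    from u(2)[OF this] have "h (L w) w / h w w \<le> \<kappa>"
      using False by (simp add: \<kappa>_def linear_scale[OF L] bilinear_lmul[OF bil] bilinear_rmul[OF bil])
    then show ?thesis using pos[OF False] by (simp add: Q_def field_simps)
  qed
  moreover have "Q u u = 0" using pos[OF u0(1)] by (simp add: Q_def \<kappa>_def)
  moreover have "Q v w = Q w v" for v w using sym[of v w] sa[of v w] sym[of v "L w"] by (simp add: Q_def)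
  ultimately have Q0: "Q u w = 0" if "w \<in> T" for w
    using psd_form_null_vector[OF Qb _ T] u0 that by blast
  \<comment> \<open>The form \<open>Q\<close> pairs \<open>u\<close> with any vector of \<open>T\<close> to zero, in particular with the defect of the eigenvalue equation.\<close>
  define w where "w = \<kappa> *\<^sub>R u - L u"
  have "w \<in> T" using inv u0 T by (auto simp: w_def intro!: subspace_diff subspace_mul)
  moreover have "h (\<kappa> *\<^sub>R u - L u) w = Q u w"
    by (simp add: Q_def bilinear_lmul[OF bil] bilinear_lsub[OF bil])
  ultimately have "h w w = 0" using Q0[of w] by (simp add: w_def)
  then have "w = 0" using pos by force
  then show ?thesis using that[of u \<kappa>] u0 by (simp add: w_def)
qed

text \<open>Split off one eigenvector at a time: its \<open>h\<close>-orthogonal complement is again invariant.\<close>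

lemma self_adjoint_eigenbasis_exists:
  fixes L :: "'a::euclidean_space \<Rightarrow> 'a"
  assumes h: "pos_def_form h" and L: "linear L" and sa: "\<And>u w. h (L u) w = h u (L w)"
    and T: "subspace T" and inv: "L ` T \<subseteq> T"
  shows "\<exists>B ev. finite B \<and> B \<subseteq> T \<and> (\<forall>e\<in>B. \<forall>f\<in>B. h e f = (if e = f then 1 else 0)) \<and>
           (\<forall>e\<in>B. L e = ev e *\<^sub>R e) \<and> (\<forall>w\<in>T. w = (\<Sum>e\<in>B. h w e *\<^sub>R e))"
  using T inv
proof (induction "dim T" arbitrary: T rule: less_induct)
  case less
  have bil: "bilinear h" and sym: "\<And>u w. h u w = h w u" and pos: "\<And>u. u \<noteq> 0 \<Longrightarrow> h u u > 0"
    using h by (auto simp: pos_def_form_def)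
  show ?case
  proof (cases "T = {0}")
    case True
    then show ?thesis by (intro exI[of _ "{}"]) auto
  next
    case False
    obtain u \<kappa> where u: "u \<in> T" "u \<noteq> 0" "L u = \<kappa> *\<^sub>R u"
      using self_adjoint_eigenvector_exists[OF h L sa less.prems False] .
    define e where "e = (1 / sqrt (h u u)) *\<^sub>R u"
    have e: "e \<in> T" "L e = \<kappa> *\<^sub>R e" "h e e = 1"
      using u pos[OF u(2)] less.prems(1)
      by (auto simp: e_def linear_scale[OF L] subspace_mul bilinear_lmul[OF bil] bilinear_rmul[OF bil])
    define T' where "T' = {w \<in> T. h w e = 0}"
    have T': "subspace T'" using less.prems(1)
      by (auto simp: T'_def subspace_def bilinear_ladd[OF bil] bilinear_lmul[OF bil] bilinear_lzero[OF bil])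
    have inv': "L ` T' \<subseteq> T'"
      using less.prems(2) e by (auto simp: T'_def sa bilinear_rmul[OF bil])
    have "e \<notin> T'" using e by (simp add: T'_def)
    then have "T' \<subset> T" using e(1) by (auto simp: T'_def)
    then have "dim T' < dim T"
      using dim_subset[of T' T] subspace_dim_equal[OF T' less.prems(1)] by fastforce
    from less.hyps[OF this T' inv'] obtain B ev where
      B: "finite B" "B \<subseteq> T'" "\<forall>e\<in>B. \<forall>f\<in>B. h e f = (if e = f then 1 else 0)"
         "\<forall>e\<in>B. L e = ev e *\<^sub>R e" "\<forall>w\<in>T'. w = (\<Sum>e\<in>B. h w e *\<^sub>R e)" by blast
    have B0: "h f e = 0" "h e f = 0" "f \<in> T" if "f \<in> B" for f
      using B(2) that sym[of e f] by (auto simp: T'_def)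
    have eB: "e \<notin> B" using B0(1)[of e] e(3) by auto
    show ?thesis
    proof (intro exI[of _ "insert e B"] exI[of _ "ev(e := \<kappa>)"] conjI)
      show "\<forall>w\<in>T. w = (\<Sum>f\<in>insert e B. h w f *\<^sub>R f)"
      proof
      fix w assume w: "w \<in> T"
      have "w - h w e *\<^sub>R e \<in> T'"
        using w e less.prems(1)
        by (auto simp: T'_def subspace_diff subspace_mul bilinear_lsub[OF bil] bilinear_lmul[OF bil])
      then have "w - h w e *\<^sub>R e = (\<Sum>f\<in>B. h (w - h w e *\<^sub>R e) f *\<^sub>R f)" using B(5) by blast
      also have "\<dots> = (\<Sum>f\<in>B. h w f *\<^sub>R f)"
        by (intro sum.cong refl) (simp add: B0 bilinear_lsub[OF bil] bilinear_lmul[OF bil])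
      finally show "w = (\<Sum>f\<in>insert e B. h w f *\<^sub>R f)"
        using B(1) eB by (simp add: algebra_simps)
      qed
      show "\<forall>f\<in>insert e B. \<forall>f'\<in>insert e B. h f f' = (if f = f' then 1 else 0)"
        using B(3) B0 eB e(3) by auto
      show "\<forall>f\<in>insert e B. L f = (ev(e := \<kappa>)) f *\<^sub>R f"
        using B(4) eB e(2) by auto
    qed (use B(1) B0(3) e(1) in auto)
  qed
qed

text \<open>This links the definition of mean curvature, a sum over eigenvalues weighted by the dimensions of the
  eigenspaces, to a trace, which is linear in the operator and hence computable.\<close>

lemma trace_self_adjoint_eq_sum_eigenvalues:
  fixes L :: "'a::euclidean_space \<Rightarrow> 'a"
  assumes h: "pos_def_form h" and L: "linear L" and sa: "\<And>u w. h (L u) w = h u (L w)"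
  defines "K \<equiv> {\<kappa>. \<exists>u. u \<noteq> 0 \<and> L u = \<kappa> *\<^sub>R u}"
  shows "finite K" "(\<Sum>b\<in>Basis. L b \<bullet> b) = (\<Sum>\<kappa>\<in>K. real (dim {u. L u = \<kappa> *\<^sub>R u}) * \<kappa>)"
proof -
  have bil: "bilinear h" and sym: "\<And>u w. h u w = h w u" and pos: "\<And>u. u \<noteq> 0 \<Longrightarrow> h u u > 0"
    using h by (auto simp: pos_def_form_def)
  obtain B ev where
    B: "finite B" "\<forall>e\<in>B. \<forall>f\<in>B. h e f = (if e = f then 1 else 0)"
       "\<forall>e\<in>B. L e = ev e *\<^sub>R e" "\<And>w. w = (\<Sum>e\<in>B. h w e *\<^sub>R e)"
    using self_adjoint_eigenbasis_exists[OF h L sa, of UNIV] by auto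
  have hsum: "h (\<Sum>i\<in>I. f i) w = (\<Sum>i\<in>I. h (f i) w)" for I and f :: "'b \<Rightarrow> 'a" and w
    using bil linear_sum[of "\<lambda>x. h x w"] by (simp add: bilinear_def)
  have nz: "e \<noteq> 0" if "e \<in> B" for e using B(2) that bilinear_lzero[OF bil] by force
  have coeff: "h (\<Sum>e\<in>A. c e *\<^sub>R e) f = (if f \<in> A then c f else 0)"
    if "A \<subseteq> B" "f \<in> B" for A c f
  proof -
    have "h (\<Sum>e\<in>A. c e *\<^sub>R e) f = (\<Sum>e\<in>A. if e = f then c e else 0)"
      unfolding hsum using B(2) that by (intro sum.cong) (auto simp: bilinear_lmul[OF bil])
    then show ?thesis using finite_subset[OF that(1) B(1)] by simp
  qed
  have Lw: "L w = (\<Sum>e\<in>B. (h w e * ev e) *\<^sub>R e)" for w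
  proof -
    have "L w = (\<Sum>e\<in>B. h w e *\<^sub>R L e)"
      by (subst B(4)[of w]) (simp add: linear_sum[OF L] linear_scale[OF L])
    then show ?thesis using B(3) by simp
  qed
  have ker: "{u. L u = \<kappa> *\<^sub>R u} = span {e\<in>B. ev e = \<kappa>}" for \<kappa>
  proof (intro equalityI subsetI)
    fix u assume "u \<in> {u. L u = \<kappa> *\<^sub>R u}"
    then have u: "L u = \<kappa> *\<^sub>R u" by simp
    have *: "h u e = 0" if "e \<in> B" "ev e \<noteq> \<kappa>" for e
    proof -
      have "h (L u) e = h u e * ev e" unfolding Lw using coeff[OF order_refl] that by simp
      then show ?thesis using that u by (simp add: bilinear_lmul[OF bil])
    qed
    have "u = (\<Sum>e\<in>B. h u e *\<^sub>R e)" by (rule B(4))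
    also have "\<dots> = (\<Sum>e\<in>{e\<in>B. ev e = \<kappa>}. h u e *\<^sub>R e)"
      using B(1) * by (intro sum.mono_neutral_right) auto
    also have "\<dots> \<in> span {e\<in>B. ev e = \<kappa>}" by (intro span_sum span_scale span_base)
    finally show "u \<in> span {e\<in>B. ev e = \<kappa>}" .
  next
    have "subspace {u. L u = \<kappa> *\<^sub>R u}"
      by (auto simp: subspace_def linear_0[OF L] linear_add[OF L] linear_scale[OF L] algebra_simps)
    then show "u \<in> {u. L u = \<kappa> *\<^sub>R u}" if "u \<in> span {e\<in>B. ev e = \<kappa>}" for u
      using span_minimal[of "{e\<in>B. ev e = \<kappa>}" "{u. L u = \<kappa> *\<^sub>R u}"] B(3) that by auto
  qed
  have indep: "independent A" if A: "A \<subseteq> B" for A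
  proof (rule independent_if_scalars_zero)
    show "finite A" using finite_subset[OF A B(1)] .
    fix f x assume "(\<Sum>x\<in>A. f x *\<^sub>R x) = 0" "x \<in> A"
    then show "f x = 0" using coeff[OF A, of x f] A bilinear_lzero[OF bil] by auto
  qed
  have dim: "dim {u. L u = \<kappa> *\<^sub>R u} = card {e\<in>B. ev e = \<kappa>}" for \<kappa>
    unfolding ker by (simp add: dim_eq_card_independent indep)
  have K: "K = ev ` B"
  proof (intro equalityI subsetI)
    fix \<kappa> assume "\<kappa> \<in> K"
    then obtain u where "u \<noteq> 0" "u \<in> span {e\<in>B. ev e = \<kappa>}" using ker by (auto simp: K_def)
    then have "{e\<in>B. ev e = \<kappa>} \<noteq> {}" by force
    then show "\<kappa> \<in> ev ` B" by auto
  qed (use B(3) nz in \<open>auto simp: K_def\<close>)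
  show "finite K" using B(1) K by simp
  have "(\<Sum>b\<in>Basis. L b \<bullet> b) = (\<Sum>b\<in>Basis. \<Sum>e\<in>B. h b e * ev e * (e \<bullet> b))"
    by (simp add: Lw inner_sum_left)
  also have "\<dots> = (\<Sum>e\<in>B. ev e * h (\<Sum>b\<in>Basis. (e \<bullet> b) *\<^sub>R b) e)"
    unfolding hsum by (subst sum.swap)
      (simp add: bilinear_lmul[OF bil] sum_distrib_left mult_ac)
  also have "\<dots> = (\<Sum>e\<in>B. ev e)" using B(2) by (simp add: euclidean_representation)
  also have "\<dots> = (\<Sum>\<kappa>\<in>ev ` B. \<Sum>e\<in>{e\<in>B. ev e = \<kappa>}. ev e)" by (rule sum.image_gen[OF B(1)])
  also have "\<dots> = (\<Sum>\<kappa>\<in>ev ` B. real (card {e\<in>B. ev e = \<kappa>}) * \<kappa>)" by simp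
  finally show "(\<Sum>b\<in>Basis. L b \<bullet> b) = (\<Sum>\<kappa>\<in>K. real (dim {u. L u = \<kappa> *\<^sub>R u}) * \<kappa>)"
    by (simp add: dim K)
qed

section \<open>Continuously differentiable maps\<close>

text \<open>Only the continuity of each directional derivative is required; in finite dimensions this is
  continuity of the derivative itself.\<close>

definition C1_on :: "'a::euclidean_space set \<Rightarrow> ('a \<Rightarrow> 'b::real_normed_vector) \<Rightarrow> bool" where
  "C1_on U f \<longleftrightarrow> open U \<and> (\<forall>x\<in>U. f differentiable (at x)) \<and>
     (\<forall>v. continuous_on U (\<lambda>x. frechet_derivative f (at x) v))"

lemma C1_onI:
  assumes "open U" "\<And>x. x \<in> U \<Longrightarrow> (f has_derivative f' x) (at x)"
    "\<And>v. continuous_on U (\<lambda>x. f' x v)"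
  shows "C1_on U f"
proof -
  have "frechet_derivative f (at x) = f' x" if "x \<in> U" for x
    using assms(2)[OF that] by (simp add: frechet_derivative_at[symmetric])
  then have "continuous_on U (\<lambda>x. frechet_derivative f (at x) v)" for v
    using assms(3)[of v] by (simp cong: continuous_on_cong)
  then show ?thesis using assms by (auto simp: C1_on_def differentiable_def)
qed

lemma C1_on_has_derivative:
  "C1_on U f \<Longrightarrow> x \<in> U \<Longrightarrow> (f has_derivative frechet_derivative f (at x)) (at x)"
  by (simp add: C1_on_def frechet_derivative_works)

lemma C1_on_open: "C1_on U f \<Longrightarrow> open U"
  by (simp add: C1_on_def)

lemma C1_on_continuous_derivative:
  "C1_on U f \<Longrightarrow> continuous_on U (\<lambda>x. frechet_derivative f (at x) v)"
  by (simp add: C1_on_def)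

lemma C1_on_continuous: "C1_on U f \<Longrightarrow> continuous_on U f"
  by (meson C1_on_has_derivative continuous_at_imp_continuous_on has_derivative_continuous)

lemma C1_on_linear_derivative: "C1_on U f \<Longrightarrow> x \<in> U \<Longrightarrow> linear (frechet_derivative f (at x))"
  using C1_on_has_derivative has_derivative_linear by blast

text \<open>Smooth maps on the sphere are only locally restrictions of smooth maps, so the property has to be
  glued from local representatives.\<close>

lemma C1_on_local:
  assumes "open U" "\<And>x. x \<in> U \<Longrightarrow> \<exists>V g. x \<in> V \<and> C1_on V g \<and> (\<forall>z\<in>V \<inter> U. f z = g z)"
  shows "C1_on U f"
  unfolding C1_on_def
proof (intro conjI ballI allI)
  have *: "\<exists>V g. x \<in> V \<and> open V \<and> C1_on V g \<and>
       (\<forall>z\<in>V. (f has_derivative frechet_derivative g (at z)) (at z))" if x: "x \<in> U" for x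
  proof -
    obtain V g where V: "x \<in> V" "C1_on V g" "\<forall>z\<in>V \<inter> U. f z = g z" using assms(2)[OF x] by blast
    have op: "open (V \<inter> U)" using V(2) assms(1) by (simp add: C1_on_def open_Int)
    have "C1_on (V \<inter> U) g" using V(2) op by (auto simp: C1_on_def intro: continuous_on_subset)
    moreover have "(f has_derivative frechet_derivative g (at z)) (at z)" if "z \<in> V \<inter> U" for z
      by (rule has_derivative_transform_within_open[OF C1_on_has_derivative[OF V(2)] op])
        (use that V(3) in auto)
    ultimately show ?thesis using V(1) x op by blast
  qed
  show "f differentiable (at x)" if "x \<in> U" for x
    using *[OF that] by (auto simp: differentiable_def)
  show "continuous_on U (\<lambda>x. frechet_derivative f (at x) v)" for v
  proof (rule continuous_at_imp_continuous_on, intro ballI)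
    fix x assume x: "x \<in> U"
    obtain V g where V: "x \<in> V" "open V" "C1_on V g"
      "\<And>z. z \<in> V \<Longrightarrow> (f has_derivative frechet_derivative g (at z)) (at z)"
      using *[OF x] by (elim exE conjE) (rule that, auto)
    have "continuous_on V (\<lambda>x. frechet_derivative f (at x) v)"
      using C1_on_continuous_derivative[OF V(3)]
      by (rule continuous_on_eq) (simp add: frechet_derivative_at[OF V(4)])
    then show "isCont (\<lambda>x. frechet_derivative f (at x) v) x"
      using V(1,2) by (simp add: continuous_on_eq_continuous_at)
  qed
  show "open U" by fact
qed

lemma C1_on_cong:
  assumes "C1_on U f" "\<And>x. x \<in> U \<Longrightarrow> f x = g x" shows "C1_on U g"
  by (rule C1_on_local[OF C1_on_open[OF assms(1)]]) (use assms in \<open>metis IntD1\<close>)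

lemma C1_on_subset: "C1_on U f \<Longrightarrow> open V \<Longrightarrow> V \<subseteq> U \<Longrightarrow> C1_on V f"
  by (auto simp: C1_on_def intro: continuous_on_subset)

lemma C1_on_bounded_linear: "bounded_linear f \<Longrightarrow> open U \<Longrightarrow> C1_on U f"
  by (rule C1_onI[where f' = "\<lambda>_. f"]) (auto intro: bounded_linear_imp_has_derivative)

lemma C1_on_const: "open U \<Longrightarrow> C1_on U (\<lambda>_. c)"
  by (rule C1_onI[where f' = "\<lambda>_ _. 0"]) auto

lemma C1_on_ident: "open U \<Longrightarrow> C1_on U (\<lambda>x. x)"
  by (rule C1_on_bounded_linear) (rule bounded_linear_ident)

lemma C1_on_add: "C1_on U f \<Longrightarrow> C1_on U g \<Longrightarrow> C1_on U (\<lambda>x. f x + g x)"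
  by (rule C1_onI[where f' = "\<lambda>x v. frechet_derivative f (at x) v + frechet_derivative g (at x) v"])
    (auto intro!: C1_on_open has_derivative_add C1_on_has_derivative continuous_on_add
      C1_on_continuous_derivative)

lemma C1_on_bilinear:
  assumes b: "bounded_bilinear b" and f: "C1_on U f" and g: "C1_on U g"
  shows "C1_on U (\<lambda>x. b (f x) (g x))"
  by (rule C1_onI[where f' = "\<lambda>x v. b (f x) (frechet_derivative g (at x) v) +
        b (frechet_derivative f (at x) v) (g x)"])
    (auto intro!: bounded_bilinear.FDERIV[OF b] C1_on_has_derivative[OF f] C1_on_has_derivative[OF g]
      continuous_on_add bounded_bilinear.continuous_on[OF b] C1_on_continuous_derivative[OF f]
      C1_on_continuous_derivative[OF g] C1_on_continuous[OF f] C1_on_continuous[OF g] C1_on_open[OF f])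

lemmas C1_on_mult = C1_on_bilinear[OF bounded_bilinear_mult]
lemmas C1_on_scaleR = C1_on_bilinear[OF bounded_bilinear_scaleR]
lemmas C1_on_inner = C1_on_bilinear[OF bounded_bilinear_inner]

lemma C1_on_sum:
  assumes "open U" "\<And>i. i \<in> I \<Longrightarrow> C1_on U (f i)" shows "C1_on U (\<lambda>x. \<Sum>i\<in>I. f i x)"
  using assms(2) by (induction I rule: infinite_finite_induct)
    (auto intro: C1_on_add C1_on_const assms(1))

text \<open>The direction of the inner derivative varies with the point; expanding it in a basis reduces its
  continuity to that of the partial derivatives.\<close>

lemma C1_on_compose:
  assumes f: "C1_on V f" and g: "C1_on U g" and gV: "g ` U \<subseteq> V"
  shows "C1_on U (\<lambda>x. f (g x))"
proof (rule C1_onI[where f' = "\<lambda>x v. frechet_derivative f (at (g x)) (frechet_derivative g (at x) v)"])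
  show "open U" by (rule C1_on_open[OF g])
  show "((\<lambda>x. f (g x)) has_derivative (\<lambda>v. frechet_derivative f (at (g x))
      (frechet_derivative g (at x) v))) (at x)" if "x \<in> U" for x
    by (rule has_derivative_compose[OF C1_on_has_derivative[OF g that]
          C1_on_has_derivative[OF f]]) (use gV that in auto)
  fix v
  have "continuous_on U (\<lambda>x. \<Sum>b\<in>Basis. (frechet_derivative g (at x) v \<bullet> b) *\<^sub>R
          frechet_derivative f (at (g x)) b)"
    by (intro continuous_intros C1_on_continuous_derivative[OF g]
        continuous_on_compose2[OF C1_on_continuous_derivative[OF f] C1_on_continuous[OF g] gV])
  moreover have "(\<Sum>b\<in>Basis. (frechet_derivative g (at x) v \<bullet> b) *\<^sub>R frechet_derivative f (at (g x)) b)
      = frechet_derivative f (at (g x)) (frechet_derivative g (at x) v)" if "x \<in> U" for x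
  proof -
    have "linear (frechet_derivative f (at (g x)))" using C1_on_linear_derivative[OF f] gV that by auto
    then show ?thesis
      by (subst (2) euclidean_representation[symmetric]) (simp add: linear_sum linear_scale)
  qed
  ultimately show "continuous_on U
      (\<lambda>x. frechet_derivative f (at (g x)) (frechet_derivative g (at x) v))"
    by (simp cong: continuous_on_cong)
qed

lemma C1_on_real:
  fixes f :: "real \<Rightarrow> real"
  assumes "open U" "\<And>x. x \<in> U \<Longrightarrow> (f has_field_derivative f' x) (at x)" "continuous_on U f'"
  shows "C1_on U f"
  using assms by (intro C1_onI[where f' = "\<lambda>x v. f' x * v"])
    (auto simp: has_field_derivative_def intro!: continuous_intros)

lemma C1_on_inverse: "C1_on U f \<Longrightarrow> (\<And>x. x \<in> U \<Longrightarrow> f x \<noteq> 0) \<Longrightarrow> C1_on U (\<lambda>x. inverse (f x :: real))"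
  by (rule C1_on_compose[where V = "-{0}", OF C1_on_real[where f' = "\<lambda>x. - (inverse x * inverse x)"]])
    (auto intro!: derivative_eq_intros continuous_intros)

lemma C1_on_sqrt: "C1_on U f \<Longrightarrow> (\<And>x. x \<in> U \<Longrightarrow> f x > 0) \<Longrightarrow> C1_on U (\<lambda>x. sqrt (f x))"
  by (rule C1_on_compose[where V = "{0<..}", OF C1_on_real[where f' = "\<lambda>x. inverse (sqrt x) / 2"]])
    (auto intro!: derivative_eq_intros continuous_intros)

lemma norm_has_derivative:
  fixes x :: "'a::euclidean_space"
  assumes "x \<noteq> 0"
  shows "(norm has_derivative (\<lambda>v. x \<bullet> v / norm x)) (at x)"
  using has_derivative_norm[OF assms]
  by (simp add: sgn_div_norm divide_inverse inner_commute mult.commute)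

lemma C1_on_norm: "C1_on (-{0}) (norm :: 'a::euclidean_space \<Rightarrow> real)"
  by (rule C1_onI[where f' = "\<lambda>x v. x \<bullet> v / norm x"])
    (auto intro!: continuous_intros norm_has_derivative)

lemma C1_on_direction: "C1_on (-{0}) (\<lambda>x::'a::euclidean_space. x /\<^sub>R norm x)"
  by (intro C1_on_scaleR C1_on_inverse C1_on_norm C1_on_ident) auto

lemma direction_has_derivative:
  fixes x :: "'a::euclidean_space"
  assumes "x \<noteq> 0"
  shows "((\<lambda>x. x /\<^sub>R norm x) has_derivative (\<lambda>v. v /\<^sub>R norm x - ((x \<bullet> v) / norm x ^ 3) *\<^sub>R x)) (at x)"
proof -
  have "((\<lambda>x. inverse (norm x)) has_derivative
      (\<lambda>v. - (inverse (norm x) * (x \<bullet> v / norm x) * inverse (norm x)))) (at x)"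
    using assms by (intro Deriv.has_derivative_inverse norm_has_derivative) auto
  from has_derivative_scaleR[OF this has_derivative_ident] show ?thesis
    by (rule has_derivative_eq_rhs) (use assms in \<open>auto simp: power3_eq_cube divide_inverse\<close>)
qed

lemma smooth_open_C1:
  assumes "smooth_open U h"
  shows "C1_on U h" "C1_on U (\<lambda>x. frechet_derivative h (at x) v)"
proof -
  have d: "iter_dir_deriv vs h differentiable (at x)" if "x \<in> U" for vs x
    using assms that by (auto simp: smooth_open_def)
  have *: "C1_on U (iter_dir_deriv vs h)" for vs
    unfolding C1_on_def
  proof (intro conjI ballI allI d)
    show "open U" using assms by (simp add: smooth_open_def)
    show "continuous_on U (\<lambda>x. frechet_derivative (iter_dir_deriv vs h) (at x) v)" for v
      using d[of _ "v # vs"] by (auto intro!: continuous_at_imp_continuous_on differentiable_imp_continuous_within)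
  qed
  show "C1_on U h" "C1_on U (\<lambda>x. frechet_derivative h (at x) v)"
    using *[of "[]"] *[of "[v]"] by simp_all
qed

section \<open>Symmetry of second derivatives\<close>

lemma C1_on_line_derivative:
  fixes k :: "'a::euclidean_space \<Rightarrow> real"
  assumes "C1_on U k" "w + s *\<^sub>R z \<in> U"
  shows "((\<lambda>s. k (w + s *\<^sub>R z)) has_real_derivative frechet_derivative k (at (w + s *\<^sub>R z)) z) (at s)"
proof -
  have "((\<lambda>s. w + s *\<^sub>R z) has_derivative (\<lambda>s. s *\<^sub>R z)) (at s)"
    by (auto intro!: derivative_eq_intros)
  from has_derivative_compose[OF this C1_on_has_derivative[OF assms]]
  show ?thesis
    using linear_scale[OF C1_on_linear_derivative[OF assms]]
    unfolding has_field_derivative_def by (elim has_derivative_eq_rhs) (simp add: fun_eq_iff)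
qed

text \<open>The second difference is symmetric in \<open>u\<close> and \<open>v\<close>, but two applications of the mean value theorem
  express it by the derivative taken first in direction \<open>u\<close> and then in direction \<open>v\<close>.\<close>

lemma mixed_difference_mean_value:
  fixes f :: "'a::euclidean_space \<Rightarrow> real"
  assumes f: "C1_on U f" and f2: "C1_on U (\<lambda>x. frechet_derivative f (at x) u)"
    and t: "t > 0" and U: "cball x (t * (norm u + norm v)) \<subseteq> U"
  shows "\<exists>p. dist x p \<le> t * (norm u + norm v) \<and>
    f (x + t *\<^sub>R u + t *\<^sub>R v) - f (x + t *\<^sub>R u) - f (x + t *\<^sub>R v) + f x =
    t\<^sup>2 * frechet_derivative (\<lambda>x. frechet_derivative f (at x) u) (at p) v"
proof -
  let ?F = "\<lambda>x. frechet_derivative f (at x) u"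
  have near: "dist x (x + a *\<^sub>R u + b *\<^sub>R v) \<le> t * (norm u + norm v)" if "0 \<le> a" "a \<le> t" "0 \<le> b" "b \<le> t" for a b
  proof -
    have "dist x (x + a *\<^sub>R u + b *\<^sub>R v) = norm (a *\<^sub>R u + b *\<^sub>R v)"
      by (subst dist_commute) (simp add: dist_norm add.assoc)
    also have "\<dots> \<le> a * norm u + b * norm v"
      using norm_triangle_ineq[of "a *\<^sub>R u" "b *\<^sub>R v"] that by simp
    also have "\<dots> \<le> t * norm u + t * norm v" using that by (intro add_mono mult_right_mono) auto
    finally show ?thesis by (simp add: algebra_simps)
  qed
  have inU: "x + a *\<^sub>R u + b *\<^sub>R v \<in> U" if "0 \<le> a" "a \<le> t" "0 \<le> b" "b \<le> t" for a b
    using near[OF that] U by auto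
  define g where "g s = f ((x + t *\<^sub>R v) + s *\<^sub>R u) - f (x + s *\<^sub>R u)" for s
  have "(g has_real_derivative ?F ((x + t *\<^sub>R v) + s *\<^sub>R u) - ?F (x + s *\<^sub>R u)) (at s)"
    if "0 \<le> s" "s \<le> t" for s
    unfolding g_def using inU[of s t] inU[of s 0] that t
    by (intro derivative_intros C1_on_line_derivative[OF f]) (auto simp: algebra_simps)
  from MVT2[OF t this] obtain s where s: "0 < s" "s < t"
    "g t - g 0 = t * (?F ((x + t *\<^sub>R v) + s *\<^sub>R u) - ?F (x + s *\<^sub>R u))" by auto
  have "((\<lambda>b. ?F ((x + s *\<^sub>R u) + b *\<^sub>R v)) has_real_derivative
      frechet_derivative ?F (at ((x + s *\<^sub>R u) + b *\<^sub>R v)) v) (at b)" if "0 \<le> b" "b \<le> t" for b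
    using inU[of s b] that s by (intro C1_on_line_derivative[OF f2]) auto
  from MVT2[OF t this] obtain b where b: "0 < b" "b < t"
    "?F (x + s *\<^sub>R u + t *\<^sub>R v) - ?F (x + s *\<^sub>R u) = t * frechet_derivative ?F (at (x + s *\<^sub>R u + b *\<^sub>R v)) v"
    by auto
  show ?thesis
  proof (intro exI conjI)
    show "dist x (x + s *\<^sub>R u + b *\<^sub>R v) \<le> t * (norm u + norm v)" using near s b by simp
    show "f (x + t *\<^sub>R u + t *\<^sub>R v) - f (x + t *\<^sub>R u) - f (x + t *\<^sub>R v) + f x =
        t\<^sup>2 * frechet_derivative ?F (at (x + s *\<^sub>R u + b *\<^sub>R v)) v"
      using s(3) b(3) by (simp add: g_def power2_eq_square algebra_simps)
  qed
qed

lemma second_derivative_symmetric: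
  fixes f :: "'a::euclidean_space \<Rightarrow> real"
  assumes f: "C1_on U f" and f2: "\<And>v. C1_on U (\<lambda>x. frechet_derivative f (at x) v)" and x: "x \<in> U"
  shows "frechet_derivative (\<lambda>x. frechet_derivative f (at x) u) (at x) v =
         frechet_derivative (\<lambda>x. frechet_derivative f (at x) v) (at x) u"
proof -
  let ?D = "\<lambda>u v p. frechet_derivative (\<lambda>x. frechet_derivative f (at x) u) (at p) v"
  obtain e where e: "e > 0" "cball x e \<subseteq> U"
    using C1_on_open[OF f] x open_contains_cball by blast
  \<comment> \<open>The additional one covers the case in which both directions are zero.\<close>
  define t where "t k = e / ((norm u + norm v + 1) * real (Suc k))" for k
  have t: "t k > 0" "t k * (norm u + norm v) \<le> e / real (Suc k)" for k
  proof -
    have n: "norm u + norm v + 1 > 0" using norm_ge_zero[of u] norm_ge_zero[of v] by linarith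
    show "t k > 0" using e(1) n by (simp add: t_def)
    have "t k * (norm u + norm v) \<le> t k * (norm u + norm v + 1)" using \<open>t k > 0\<close> by simp
    also have "\<dots> = e / real (Suc k)" using n by (simp add: t_def)
    finally show "t k * (norm u + norm v) \<le> e / real (Suc k)" .
  qed
  have small: "e / real (Suc k) \<le> e" for k using e(1) by (simp add: divide_le_eq)
  have sub: "cball x (t k * (norm u + norm v)) \<subseteq> U" "cball x (t k * (norm v + norm u)) \<subseteq> U" for k
    using e(2) t(2)[of k] small[of k] by (force simp: add.commute)+
  have ex: "\<exists>p q. dist x p \<le> e / real (Suc k) \<and> dist x q \<le> e / real (Suc k) \<and> ?D u v p = ?D v u q" for k
  proof -
    obtain p where p: "dist x p \<le> t k * (norm u + norm v)"
      "f (x + t k *\<^sub>R u + t k *\<^sub>R v) - f (x + t k *\<^sub>R u) - f (x + t k *\<^sub>R v) + f x = (t k)\<^sup>2 * ?D u v p"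
      using mixed_difference_mean_value[OF f f2 t(1) sub(1)] by blast
    obtain q where q: "dist x q \<le> t k * (norm v + norm u)"
      "f (x + t k *\<^sub>R v + t k *\<^sub>R u) - f (x + t k *\<^sub>R v) - f (x + t k *\<^sub>R u) + f x = (t k)\<^sup>2 * ?D v u q"
      using mixed_difference_mean_value[OF f f2 t(1) sub(2)] by blast
    have "(t k)\<^sup>2 * ?D u v p = (t k)\<^sup>2 * ?D v u q" using p(2) q(2) by (simp add: algebra_simps)
    then have "?D u v p = ?D v u q" using t(1)[of k] by simp
    then show ?thesis using p(1) q(1) t(2)[of k] by (intro exI[of _ p] exI[of _ q]) (simp add: add.commute)
  qed
  then obtain p q where pq: "\<And>k. dist x (p k) \<le> e / real (Suc k)" "\<And>k. dist x (q k) \<le> e / real (Suc k)"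
    "\<And>k. ?D u v (p k) = ?D v u (q k)" by metis
  have z: "(\<lambda>k. e / real (Suc k)) \<longlonglongrightarrow> 0" using LIMSEQ_Suc lim_const_over_n by blast
  have lim: "s \<longlonglongrightarrow> x" if "\<And>k. dist x (s k) \<le> e / real (Suc k)" for s
  proof -
    have "(\<lambda>k. dist (s k) x) \<longlonglongrightarrow> 0"
      using that by (intro tendsto_sandwich[OF _ _ tendsto_const z]) (auto simp: dist_commute)
    then show ?thesis by (rule tendsto_dist_iff[THEN iffD2])
  qed
  have cont: "isCont (?D u v) x" for u v
    using C1_on_continuous_derivative[OF f2, of u v] C1_on_open[OF f] x
    by (simp add: continuous_on_eq_continuous_at)
  have "(\<lambda>k. ?D u v (p k)) \<longlonglongrightarrow> ?D u v x" "(\<lambda>k. ?D v u (q k)) \<longlonglongrightarrow> ?D v u x"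
    using isCont_tendsto_compose[OF cont lim] pq by blast+
  then show ?thesis using pq(3) LIMSEQ_unique by auto
qed

section \<open>The geometry of warped products\<close>

lemma warped_metric_eq:
  fixes x :: "'a::euclidean_space"
  assumes "x \<noteq> 0"
  shows "warped_metric lam x v w =
    (lam (ln (norm x)))\<^sup>2 / (x \<bullet> x) * (v \<bullet> w)
      + (1 - (lam (ln (norm x)))\<^sup>2) / (x \<bullet> x)\<^sup>2 * ((x \<bullet> v) * (x \<bullet> w))"
proof -
  have n: "norm x > 0" using assms by simp
  have "((\<lambda>z. ln (norm z)) has_derivative (\<lambda>v. x \<bullet> v / (x \<bullet> x))) (at x)"
    by (rule has_derivative_eq_rhs[OF has_derivative_ln[OF n norm_has_derivative[OF assms]]])
      (simp add: fun_eq_iff norm_eq_sqrt_inner field_simps flip: real_sqrt_mult)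
  then have 1: "frechet_derivative (\<lambda>z. ln (norm z)) (at x) = (\<lambda>v. x \<bullet> v / (x \<bullet> x))"
    by (rule frechet_derivative_at[symmetric])
  have 2: "frechet_derivative (\<lambda>z. z /\<^sub>R norm z) (at x) =
      (\<lambda>v. v /\<^sub>R norm x - ((x \<bullet> v) / norm x ^ 3) *\<^sub>R x)"
    by (rule frechet_derivative_at[OF direction_has_derivative[OF assms], symmetric])
  define k where "k = inverse (norm x)"
  have s: "x \<bullet> x = (norm x)\<^sup>2" by (simp add: dot_square_norm)
  have k: "v /\<^sub>R norm x - ((x \<bullet> v) / norm x ^ 3) *\<^sub>R x = k *\<^sub>R v - (k ^ 3 * (x \<bullet> v)) *\<^sub>R x" for v
    by (simp add: k_def divide_inverse power_inverse mult.commute)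
  have kx: "k\<^sup>2 * (x \<bullet> x) = 1" using n by (simp add: k_def s power_inverse)
  have "(k *\<^sub>R v - (k ^ 3 * (x \<bullet> v)) *\<^sub>R x) \<bullet> (k *\<^sub>R w - (k ^ 3 * (x \<bullet> w)) *\<^sub>R x)
      = k\<^sup>2 * (v \<bullet> w) - k ^ 4 * (x \<bullet> v) * (x \<bullet> w) * (2 - k\<^sup>2 * (x \<bullet> x))"
    by (simp add: inner_diff_left inner_diff_right inner_commute[of v x] inner_commute[of w x]
        eval_nat_numeral algebra_simps)
  also have "\<dots> = (v \<bullet> w) / (x \<bullet> x) - (x \<bullet> v) * (x \<bullet> w) / (x \<bullet> x)\<^sup>2"
    unfolding kx using n by (simp add: k_def s power_inverse divide_inverse flip: power_mult)
  finally have hor: "(k *\<^sub>R v - (k ^ 3 * (x \<bullet> v)) *\<^sub>R x) \<bullet> (k *\<^sub>R w - (k ^ 3 * (x \<bullet> w)) *\<^sub>R x)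
      = (v \<bullet> w) / (x \<bullet> x) - (x \<bullet> v) * (x \<bullet> w) / (x \<bullet> x)\<^sup>2" .
  show ?thesis
    unfolding warped_metric_def Let_def 1 2 k hor
    by (simp add: divide_inverse power2_eq_square algebra_simps)
qed

lemma warped_metric_polar:
  fixes y :: "'a::euclidean_space"
  assumes "norm y = 1" "\<rho> > 0"
  shows "warped_metric lam (\<rho> *\<^sub>R y) (\<rho> *\<^sub>R v) (\<rho> *\<^sub>R w) =
    (y \<bullet> v) * (y \<bullet> w) + (lam (ln \<rho>))\<^sup>2 * (v \<bullet> w - (y \<bullet> v) * (y \<bullet> w))"
proof -
  have "\<rho> *\<^sub>R y \<noteq> 0" using assms by auto
  moreover have "y \<bullet> y = 1" using assms by (simp add: dot_square_norm)
  ultimately show ?thesis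
    using assms by (simp add: warped_metric_eq power2_eq_square divide_simps) (simp add: algebra_simps)
qed

lemma warped_metric_tangent_split:
  fixes y :: "'a::euclidean_space"
  assumes "norm y = 1" "\<rho> > 0" "u \<bullet> y = 0" "w \<bullet> y = 0"
  shows "warped_metric lam (\<rho> *\<^sub>R y) (\<rho> *\<^sub>R (\<alpha> *\<^sub>R y + u)) (\<rho> *\<^sub>R (\<beta> *\<^sub>R y + w)) =
    \<alpha> * \<beta> + (lam (ln \<rho>))\<^sup>2 * (u \<bullet> w)"
proof -
  have "y \<bullet> y = 1" using assms by (simp add: dot_square_norm)
  then show ?thesis
    using assms by (simp add: warped_metric_polar inner_add_left inner_add_right inner_commute)
qed

text \<open>The point and the vectors are scaled by the radius \<open>\<rho>\<close>: in these units the metric depends on \<open>\<rho>\<close>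
  through \<open>lam\<close> only, and the Koszul formula becomes polynomial.\<close>

lemma frechet_derivative_warped_metric:
  fixes y :: "'a::euclidean_space"
  assumes y: "norm y = 1" and \<rho>: "\<rho> > 0" and l: "(lam has_real_derivative l') (at (ln \<rho>))"
  defines "L \<equiv> lam (ln \<rho>)"
  shows "frechet_derivative (\<lambda>p. warped_metric lam p (\<rho> *\<^sub>R v) (\<rho> *\<^sub>R w)) (at (\<rho> *\<^sub>R y)) (\<rho> *\<^sub>R u) =
    2 * (L * l' - L\<^sup>2) * (y \<bullet> u) * (v \<bullet> w)
    - 2 * (L * l' + 2 * (1 - L\<^sup>2)) * (y \<bullet> u) * ((y \<bullet> v) * (y \<bullet> w))
    + (1 - L\<^sup>2) * ((u \<bullet> v) * (y \<bullet> w) + (y \<bullet> v) * (u \<bullet> w))"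
proof -
  let ?x = "\<rho> *\<^sub>R y"
  have x: "?x \<noteq> 0" and nx: "norm ?x = \<rho>" and yy: "y \<bullet> y = 1" using y \<rho> by (auto simp: dot_square_norm)
  define i where "i = inverse (\<rho>\<^sup>2)"
  have xx: "?x \<bullet> ?x = \<rho>\<^sup>2" using yy by (simp add: power2_eq_square)
  have dln: "((\<lambda>z. ln (norm z)) has_derivative (\<lambda>u. i * (?x \<bullet> u))) (at ?x)"
    by (rule has_derivative_eq_rhs[OF has_derivative_ln[OF _ norm_has_derivative[OF x]]])
      (use \<rho> y in \<open>auto simp: fun_eq_iff i_def power2_eq_square divide_inverse\<close>)
  have dl: "((\<lambda>z. lam (ln (norm z))) has_derivative (\<lambda>u. l' * (i * (?x \<bullet> u)))) (at ?x)"
    by (rule has_derivative_compose[OF dln]) (use l nx in \<open>simp add: has_field_derivative_def\<close>)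
  have di: "((\<lambda>z. inverse (z \<bullet> z)) has_derivative (\<lambda>u. - (i * (2 * (?x \<bullet> u)) * i))) (at ?x)"
  proof -
    have "((\<lambda>z. z \<bullet> z) has_derivative (\<lambda>u. 2 * (?x \<bullet> u))) (at ?x)"
      by (auto intro!: derivative_eq_intros simp: inner_commute)
    from Deriv.has_derivative_inverse[OF _ this] show ?thesis
      using x unfolding xx i_def by simp
  qed
  define v' where "v' = \<rho> *\<^sub>R v"
  define w' where "w' = \<rho> *\<^sub>R w"
  let ?D = "\<lambda>u. (2 * L * (l' * (i * (?x \<bullet> u))) * i - L\<^sup>2 * (2 * i\<^sup>2 * (?x \<bullet> u))) * (v' \<bullet> w')
    + (- 2 * L * (l' * (i * (?x \<bullet> u))) * i\<^sup>2 - 4 * (1 - L\<^sup>2) * i ^ 3 * (?x \<bullet> u)) * ((?x \<bullet> v') * (?x \<bullet> w'))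
    + (1 - L\<^sup>2) * i\<^sup>2 * ((u \<bullet> v') * (?x \<bullet> w') + (?x \<bullet> v') * (u \<bullet> w'))"
  have "((\<lambda>p. (lam (ln (norm p)))\<^sup>2 * inverse (p \<bullet> p) * (v' \<bullet> w')
      + (1 - (lam (ln (norm p)))\<^sup>2) * (inverse (p \<bullet> p))\<^sup>2 * ((p \<bullet> v') * (p \<bullet> w'))) has_derivative ?D) (at ?x)"
    by (rule dl di derivative_eq_intros refl)+
      (simp only: xx nx L_def[symmetric] i_def[symmetric], simp add: fun_eq_iff algebra_simps eval_nat_numeral)
  then have "((\<lambda>p. warped_metric lam p v' w') has_derivative ?D) (at ?x)"
    by (rule has_derivative_transform_within_open[where s = "-{0}"])
      (use x in \<open>auto simp: warped_metric_eq divide_inverse power_inverse\<close>)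
  then have "frechet_derivative (\<lambda>p. warped_metric lam p v' w') (at ?x) = ?D"
    by (rule frechet_derivative_at[symmetric])
  then have "frechet_derivative (\<lambda>p. warped_metric lam p v' w') (at ?x) (\<rho> *\<^sub>R u) = ?D (\<rho> *\<^sub>R u)"
    by (rule fun_cong)
  moreover have "?D (\<rho> *\<^sub>R u) = (2 * L * l' - 2 * L\<^sup>2) * (i * \<rho>\<^sup>2)\<^sup>2 * (y \<bullet> u) * (v \<bullet> w)
    - (2 * L * l' + 4 * (1 - L\<^sup>2)) * (i * \<rho>\<^sup>2) ^ 3 * (y \<bullet> u) * ((y \<bullet> v) * (y \<bullet> w))
    + (1 - L\<^sup>2) * (i * \<rho>\<^sup>2)\<^sup>2 * ((u \<bullet> v) * (y \<bullet> w) + (y \<bullet> v) * (u \<bullet> w))"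
    unfolding v'_def w'_def by (simp add: algebra_simps eval_nat_numeral)
  moreover have "i * \<rho>\<^sup>2 = 1" using \<rho> by (simp add: i_def)
  ultimately show ?thesis unfolding v'_def w'_def by (simp add: algebra_simps)
qed

lemma warped_metric_pos_def:
  fixes y :: "'a::euclidean_space"
  assumes "norm y = 1" "\<rho> > 0" "lam (ln \<rho>) > 0" "warped_metric lam (\<rho> *\<^sub>R y) z z = 0"
  shows "z = 0"
proof -
  define v where "v = z /\<^sub>R \<rho>"
  have z: "z = \<rho> *\<^sub>R v" using assms by (simp add: v_def)
  define t where "t = v - (y \<bullet> v) *\<^sub>R y"
  have yy: "y \<bullet> y = 1" using assms by (simp add: dot_square_norm)
  have v: "v = (y \<bullet> v) *\<^sub>R y + t" and ty: "t \<bullet> y = 0"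
    using yy by (simp_all add: t_def inner_diff_left inner_commute[of v y])
  have "(y \<bullet> v)\<^sup>2 + (lam (ln \<rho>))\<^sup>2 * (t \<bullet> t) = 0"
    using assms(4) warped_metric_tangent_split[OF assms(1,2) ty ty, of lam "y \<bullet> v" "y \<bullet> v"]
    unfolding z v[symmetric] by (simp add: power2_eq_square)
  then have "y \<bullet> v = 0 \<and> t = 0" using assms(3)
    by (simp add: add_nonneg_eq_0_iff)
  then show ?thesis using v z by simp
qed

text \<open>The metric is nondegenerate, so it suffices to test a candidate against all vectors. The terms
  \<open>- \<alpha> \<beta>\<close>, \<open>1\<close> and \<open>- 1\<close> come from the flat coordinates of the annulus; the rest is the usual
  connection \<open>\<nabla>\<^sub>X \<partial>\<^sub>r = (lam' / lam) X\<close> and \<open>\<nabla>\<^sub>X Y = - lam lam' \<langle>X, Y\<rangle> \<partial>\<^sub>r + \<dots>\<close> of a warped product.\<close>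

lemma christoffel_warped_metric:
  fixes y :: "'a::euclidean_space"
  assumes y: "norm y = 1" and \<rho>: "\<rho> > 0" and l: "(lam has_real_derivative l') (at (ln \<rho>))"
    and L: "lam (ln \<rho>) > 0" and u: "u \<bullet> y = 0" and w: "w \<bullet> y = 0"
  shows "christoffel (warped_metric lam) (\<rho> *\<^sub>R y) (\<rho> *\<^sub>R (\<alpha> *\<^sub>R y + u)) (\<rho> *\<^sub>R (\<beta> *\<^sub>R y + w)) =
    \<rho> *\<^sub>R ((- \<alpha> * \<beta> - (lam (ln \<rho>) * l' - 1) * (u \<bullet> w)) *\<^sub>R y
      + (l' / lam (ln \<rho>) - 1) *\<^sub>R (\<beta> *\<^sub>R u + \<alpha> *\<^sub>R w))" (is "_ = ?z")
  unfolding christoffel_def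
proof (rule the_equality)
  let ?x = "\<rho> *\<^sub>R y"
  have x: "?x \<noteq> 0" and nx: "norm ?x = \<rho>" and yy: "y \<bullet> y = 1" using y \<rho> by (auto simp: dot_square_norm)
  define s where "s = lam (ln \<rho>)"
  have s: "s > 0" using L by (simp add: s_def)
  let ?K = "\<lambda>t. (frechet_derivative (\<lambda>p. warped_metric lam p (\<rho> *\<^sub>R (\<beta> *\<^sub>R y + w)) t) (at ?x) (\<rho> *\<^sub>R (\<alpha> *\<^sub>R y + u))
      + frechet_derivative (\<lambda>p. warped_metric lam p (\<rho> *\<^sub>R (\<alpha> *\<^sub>R y + u)) t) (at ?x) (\<rho> *\<^sub>R (\<beta> *\<^sub>R y + w))
      - frechet_derivative (\<lambda>p. warped_metric lam p (\<rho> *\<^sub>R (\<alpha> *\<^sub>R y + u)) (\<rho> *\<^sub>R (\<beta> *\<^sub>R y + w))) (at ?x) t) / 2"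
  have K: "?K (\<rho> *\<^sub>R t) = - \<alpha> * \<beta> * (y \<bullet> t) + (s * l' - s\<^sup>2) * (\<beta> * (u \<bullet> t) + \<alpha> * (w \<bullet> t))
      - (s * l' - 1) * (u \<bullet> w) * (y \<bullet> t)" for t
    unfolding frechet_derivative_warped_metric[OF y \<rho> l] s_def[symmetric]
    using u w by (simp add: inner_add_left inner_add_right yy inner_commute[of y u] inner_commute[of y w] inner_commute[of w u]
        inner_commute[of t y] inner_commute[of t u] inner_commute[of t w] power2_eq_square) (simp add: field_simps)
  have Z: "warped_metric lam ?x ?z (\<rho> *\<^sub>R t) = - \<alpha> * \<beta> * (y \<bullet> t) + (s * l' - s\<^sup>2) * (\<beta> * (u \<bullet> t) + \<alpha> * (w \<bullet> t))
      - (s * l' - 1) * (u \<bullet> w) * (y \<bullet> t)" for t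
  proof -
    have "s\<^sup>2 * (l' / s - 1) = s * l' - s\<^sup>2" using s by (simp add: power2_eq_square field_simps)
    moreover have "warped_metric lam ?x ?z (\<rho> *\<^sub>R t) = (- \<alpha> * \<beta> - (s * l' - 1) * (u \<bullet> w)) * (y \<bullet> t)
        + (s\<^sup>2 * (l' / s - 1)) * (\<beta> * (u \<bullet> t) + \<alpha> * (w \<bullet> t))"
      unfolding warped_metric_polar[OF y \<rho>] s_def[symmetric]
      using u w inner_commute[of y u] inner_commute[of y w] by (simp add: inner_add_left inner_add_right yy algebra_simps)
    ultimately show ?thesis by (simp add: algebra_simps)
  qed
  have *: "warped_metric lam ?x ?z t = ?K t" for t
    using K[of "t /\<^sub>R \<rho>"] Z[of "t /\<^sub>R \<rho>"] \<rho> by simp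
  then show "\<forall>t. warped_metric lam ?x ?z t = ?K t" by blast
  fix z assume "\<forall>t. warped_metric lam ?x z t = ?K t"
  then have "warped_metric lam ?x z (z - ?z) = warped_metric lam ?x ?z (z - ?z)" using * by metis
  then have "warped_metric lam ?x (z - ?z) (z - ?z) = 0"
    unfolding warped_metric_eq[OF x] inner_diff_left[of z] inner_diff_right[of ?x z] by (simp only: algebra_simps)
  then have "z - ?z = 0" using warped_metric_pos_def[where lam = lam, OF y \<rho> L] by blast
  then show "z = ?z" by simp
qed

section \<open>Functions on the sphere\<close>

definition ray_ext :: "('a::euclidean_space \<Rightarrow> 'b) \<Rightarrow> 'a \<Rightarrow> 'b" where
  "ray_ext f = (\<lambda>x. f (x /\<^sub>R norm x))"

definition gradient :: "('a::euclidean_space \<Rightarrow> real) \<Rightarrow> 'a \<Rightarrow> 'a" where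
  "gradient f x = (\<Sum>b\<in>Basis. frechet_derivative f (at x) b *\<^sub>R b)"

lemma gradient_inner:
  assumes "C1_on U f" "x \<in> U"
  shows "gradient f x \<bullet> v = frechet_derivative f (at x) v"
proof -
  have l: "linear (frechet_derivative f (at x))" using assms by (rule C1_on_linear_derivative)
  have "frechet_derivative f (at x) v = frechet_derivative f (at x) (\<Sum>b\<in>Basis. (v \<bullet> b) *\<^sub>R b)"
    by (simp add: euclidean_representation)
  also have "\<dots> = gradient f x \<bullet> v"
    by (simp add: gradient_def linear_sum[OF l] linear_scale[OF l] inner_sum_left inner_commute[of v] mult.commute)
  finally show ?thesis by simp
qed

text \<open>Replaces the extension along rays by any differentiable extension: the retraction onto the
  sphere has the identity as derivative on tangent vectors.\<close>

lemma sphere_diff_eq: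
  assumes y: "norm y = 1" and u: "u \<bullet> y = 0" and f0: "(f0 has_derivative D) (at y)"
    and eq: "\<And>z. norm z = 1 \<Longrightarrow> f z = f0 z"
  shows "sphere_diff f y u = D u"
proof -
  have y0: "y \<noteq> 0" and Ny: "y /\<^sub>R norm y = y" using y by auto
  have "((\<lambda>x. f0 (x /\<^sub>R norm x)) has_derivative
      (\<lambda>v. D (v /\<^sub>R norm y - ((y \<bullet> v) / norm y ^ 3) *\<^sub>R y))) (at y)"
    using f0 by (intro has_derivative_compose[OF direction_has_derivative[OF y0]]) (simp add: Ny)
  then have "((\<lambda>x. f (x /\<^sub>R norm x)) has_derivative
      (\<lambda>v. D (v /\<^sub>R norm y - ((y \<bullet> v) / norm y ^ 3) *\<^sub>R y))) (at y)"
    by (rule has_derivative_transform_within_open[where s = "-{0}"]) (use y0 eq in auto)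
  then have "frechet_derivative (\<lambda>x. f (x /\<^sub>R norm x)) (at y) =
      (\<lambda>v. D (v /\<^sub>R norm y - ((y \<bullet> v) / norm y ^ 3) *\<^sub>R y))"
    by (rule frechet_derivative_at[symmetric])
  then show ?thesis using y u by (simp add: sphere_diff_def inner_commute)
qed

text \<open>Locally the extension along rays is \<open>h (x / \<bar>x\<bar>)\<close> for a smooth \<open>h\<close>, so its second derivatives are
  continuous away from the origin.\<close>

lemma smooth_on_sphere_C1:
  fixes r :: "'a::euclidean_space \<Rightarrow> real"
  assumes "smooth_map_on (sphere 0 1) r"
  shows "C1_on (-{0}) (ray_ext r)" "C1_on (-{0}) (\<lambda>x. frechet_derivative (ray_ext r) (at x) v)"
proof -
  let ?N = "\<lambda>x::'a. x /\<^sub>R norm x"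
  have loc: "\<exists>V U h. x \<in> V \<and> open V \<and> V \<subseteq> -{0} \<and> smooth_open U h \<and> ?N ` V \<subseteq> U \<and> (\<forall>z\<in>V. ray_ext r z = h (?N z))"
    if x: "x \<in> -{0}" for x
  proof -
    have "?N x \<in> sphere 0 1" using x by simp
    then obtain U h where U: "?N x \<in> U" "smooth_open U h" "\<forall>z\<in>U \<inter> sphere 0 1. h z = r z"
      using assms unfolding smooth_map_on_def by blast
    define V where "V = {z \<in> -{0}. ?N z \<in> U}"
    have "open V" unfolding V_def
      using continuous_open_preimage[OF C1_on_continuous[OF C1_on_direction], of U] U(2)
      by (auto simp: smooth_open_def vimage_def Int_def)
    then show ?thesis using U x
      by (intro exI[of _ V] exI[of _ U] exI[of _ h]) (auto simp: V_def ray_ext_def)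
  qed
  show "C1_on (-{0}) (ray_ext r)"
  proof (rule C1_on_local)
    fix x :: 'a assume "x \<in> -{0}"
    from loc[OF this] obtain V U h where V: "x \<in> V" "open V" "V \<subseteq> -{0}" "smooth_open U h" "?N ` V \<subseteq> U"
      "\<forall>z\<in>V. ray_ext r z = h (?N z)"
      by (elim exE conjE) (rule that)
    have "C1_on V (\<lambda>z. h (?N z))"
      by (rule C1_on_compose[OF smooth_open_C1(1)[OF V(4)] C1_on_subset[OF C1_on_direction V(2,3)] V(5)])
    then show "\<exists>V g. x \<in> V \<and> C1_on V g \<and> (\<forall>z\<in>V \<inter> -{0}. ray_ext r z = g z)"
      by (intro exI[of _ V] exI[of _ "\<lambda>z. h (?N z)"]) (use V(1,6) in auto)
  qed auto
  have dN: "C1_on (-{0}) (\<lambda>x::'a. v /\<^sub>R norm x - ((x \<bullet> v) / norm x ^ 3) *\<^sub>R x)"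
  proof -
    have "C1_on (-{0}) (\<lambda>x::'a. inverse (norm x) *\<^sub>R v +
        ((x \<bullet> (- v)) * (inverse (norm x) * (inverse (norm x) * inverse (norm x)))) *\<^sub>R x)"
      by (intro C1_on_add C1_on_scaleR C1_on_mult C1_on_inner C1_on_inverse C1_on_norm C1_on_ident C1_on_const) auto
    then show ?thesis by (rule C1_on_cong) (simp add: power3_eq_cube divide_inverse)
  qed
  show "C1_on (-{0}) (\<lambda>x. frechet_derivative (ray_ext r) (at x) v)"
  proof (rule C1_on_local)
    fix x :: 'a assume "x \<in> -{0}"
    from loc[OF this] obtain V U h where V: "x \<in> V" "open V" "V \<subseteq> -{0}" "smooth_open U h" "?N ` V \<subseteq> U"
      "\<forall>z\<in>V. ray_ext r z = h (?N z)"
      by (elim exE conjE) (rule that)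
    let ?g = "\<lambda>z. \<Sum>b\<in>Basis. ((v /\<^sub>R norm z - ((z \<bullet> v) / norm z ^ 3) *\<^sub>R z) \<bullet> b) *\<^sub>R frechet_derivative h (at (?N z)) b"
    have "C1_on V ?g"
      by (intro C1_on_sum V(2) C1_on_scaleR C1_on_inner C1_on_subset[OF dN V(2,3)] C1_on_const
          C1_on_compose[OF smooth_open_C1(2)[OF V(4)] C1_on_subset[OF C1_on_direction V(2,3)] V(5)])
    moreover have "frechet_derivative (ray_ext r) (at z) v = ?g z" if z: "z \<in> V" for z
    proof -
      have Nz: "?N z \<in> U" and z0: "z \<noteq> 0" using V(3,5) z by auto
      have "((\<lambda>x. h (?N x)) has_derivative (\<lambda>v. frechet_derivative h (at (?N z))
          (v /\<^sub>R norm z - ((z \<bullet> v) / norm z ^ 3) *\<^sub>R z))) (at z)"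
        by (rule has_derivative_compose[OF direction_has_derivative[OF z0]
              C1_on_has_derivative[OF smooth_open_C1(1)[OF V(4)] Nz]])
      then have "(ray_ext r has_derivative (\<lambda>v. frechet_derivative h (at (?N z))
          (v /\<^sub>R norm z - ((z \<bullet> v) / norm z ^ 3) *\<^sub>R z))) (at z)"
        by (rule has_derivative_transform_within_open[OF _ V(2) z]) (use V(6) in auto)
      then have fd: "frechet_derivative (ray_ext r) (at z) = (\<lambda>v. frechet_derivative h (at (?N z))
          (v /\<^sub>R norm z - ((z \<bullet> v) / norm z ^ 3) *\<^sub>R z))" by (rule frechet_derivative_at[symmetric])
      have l: "linear (frechet_derivative h (at (?N z)))"
        by (rule C1_on_linear_derivative[OF smooth_open_C1(1)[OF V(4)] Nz])
      have ex: "frechet_derivative h (at (?N z)) w = (\<Sum>b\<in>Basis. (w \<bullet> b) *\<^sub>R frechet_derivative h (at (?N z)) b)" for w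
        by (subst euclidean_representation[of w, symmetric]) (simp only: linear_sum[OF l] linear_scale[OF l])
      show ?thesis unfolding fd by (rule ex)
    qed
    ultimately show "\<exists>V g. x \<in> V \<and> C1_on V g \<and>
        (\<forall>z\<in>V \<inter> -{0}. frechet_derivative (ray_ext r) (at z) v = g z)"
      by (intro exI[of _ V] exI[of _ ?g]) (use V(1) in auto)
  qed auto
qed

section \<open>Star-shaped hypersurfaces\<close>

text \<open>The derivative of the warping function is a parameter, so that what is proved here depends on its
  continuity only.\<close>

locale star_shaped_graph =
  fixes a b :: real and lam lam' :: "real \<Rightarrow> real" and r :: "'a::euclidean_space \<Rightarrow> real"
  assumes lam_deriv: "\<And>s. s \<in> {a<..<b} \<Longrightarrow> (lam has_real_derivative lam' s) (at s)"
    and lam'_cont: "continuous_on {a<..<b} lam'"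
    and lam_pos: "\<And>s. s \<in> {a<..<b} \<Longrightarrow> lam s > 0"
    and r_smooth: "smooth_map_on (sphere 0 1) r"
    and r_range: "\<And>y. y \<in> sphere 0 1 \<Longrightarrow> r y \<in> {a<..<b}"
begin

text \<open>On the unit sphere \<open>q\<close> is the gradient of \<open>r\<close>, \<open>p\<close> is the gradient of \<open>\<phi> \<circ> r\<close> where \<open>\<phi>' = 1 / lam\<close>,
  \<open>c\<close> is the radial component of the unit normal, and \<open>- W / lam\<close> is its spherical component. All
  functions live on the punctured space, where \<open>q\<close>, \<open>p\<close> and \<open>W\<close> are tangent to the spheres.\<close>

definition R :: "'a \<Rightarrow> real" where "R = ray_ext r"
definition q :: "'a \<Rightarrow> 'a" where "q = gradient R"
definition p :: "'a \<Rightarrow> 'a" where "p x = inverse (lam (R x)) *\<^sub>R q x"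
definition c :: "'a \<Rightarrow> real" where "c x = inverse (sqrt (1 + p x \<bullet> p x))"
definition W :: "'a \<Rightarrow> 'a" where "W x = c x *\<^sub>R p x"

lemma R_sphere: "norm y = 1 \<Longrightarrow> R y = r y"
  by (simp add: R_def ray_ext_def)

lemma R_range: "x \<noteq> 0 \<Longrightarrow> R x \<in> {a<..<b}"
  using r_range[of "x /\<^sub>R norm x"] by (simp add: R_def ray_ext_def)

lemma R_C1: "C1_on (-{0}) R" and dR_C1: "C1_on (-{0}) (\<lambda>x. frechet_derivative R (at x) v)"
  unfolding R_def by (intro smooth_on_sphere_C1 r_smooth)+

lemma q_inner: "x \<noteq> 0 \<Longrightarrow> q x \<bullet> v = frechet_derivative R (at x) v"
  using gradient_inner[OF R_C1] by (simp add: q_def)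

lemma q_C1: "C1_on (-{0}) q"
  unfolding q_def gradient_def by (intro C1_on_sum C1_on_scaleR dR_C1 C1_on_const) auto

lemma lam_C1: "C1_on {a<..<b} lam"
  using lam_deriv lam'_cont by (intro C1_on_real) auto

lemma lamR_C1: "C1_on (-{0}) (\<lambda>x. lam (R x))"
  by (rule C1_on_compose[OF lam_C1 R_C1 image_subsetI]) (rule R_range, simp)

lemma lamR_pos: "x \<noteq> 0 \<Longrightarrow> lam (R x) > 0"
  using R_range lam_pos by blast

lemma p_C1: "C1_on (-{0}) p"
  unfolding p_def[abs_def]
  by (intro C1_on_scaleR C1_on_inverse lamR_C1 q_C1) (use lamR_pos in force)

lemma c_arg_pos: "1 + p x \<bullet> p x > 0" by (simp add: add_pos_nonneg)

lemma c_C1: "C1_on (-{0}) c"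
  unfolding c_def[abs_def]
  by (intro C1_on_inverse C1_on_sqrt C1_on_add C1_on_inner C1_on_const p_C1)
    (use c_arg_pos in \<open>auto simp: less_imp_neq[symmetric]\<close>)

lemma W_C1: "C1_on (-{0}) W"
  unfolding W_def[abs_def] by (intro C1_on_scaleR c_C1 p_C1)

lemma c_pos: "c x > 0" and c_sq: "(c x)\<^sup>2 * (1 + p x \<bullet> p x) = 1"
  using c_arg_pos[of x] by (auto simp: c_def power_inverse)

lemma q_eq: "x \<noteq> 0 \<Longrightarrow> q x = lam (R x) *\<^sub>R p x"
  using lamR_pos[of x] by (simp add: p_def)

lemma q_tangent:
  assumes x: "x \<noteq> 0" shows "q x \<bullet> x = 0"
proof -
  have "((\<lambda>z. R (z /\<^sub>R norm z)) has_derivative (\<lambda>v. frechet_derivative R (at (x /\<^sub>R norm x))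
      (v /\<^sub>R norm x - ((x \<bullet> v) / norm x ^ 3) *\<^sub>R x))) (at x)"
    by (rule has_derivative_compose[OF direction_has_derivative[OF x] C1_on_has_derivative[OF R_C1]])
      (use x in auto)
  then have "(R has_derivative (\<lambda>v. frechet_derivative R (at (x /\<^sub>R norm x))
      (v /\<^sub>R norm x - ((x \<bullet> v) / norm x ^ 3) *\<^sub>R x))) (at x)"
    by (rule has_derivative_transform_within_open[where s = "-{0}"])
      (use x in \<open>auto simp: R_def ray_ext_def\<close>)
  then have "frechet_derivative R (at x) = (\<lambda>v. frechet_derivative R (at (x /\<^sub>R norm x))
      (v /\<^sub>R norm x - ((x \<bullet> v) / norm x ^ 3) *\<^sub>R x))" by (rule frechet_derivative_at[symmetric])
  moreover have "x /\<^sub>R norm x - ((x \<bullet> x) / norm x ^ 3) *\<^sub>R x = 0"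
  proof -
    have "(x \<bullet> x) / norm x ^ 3 = inverse (norm x)"
      using x by (simp add: dot_square_norm power2_eq_square power3_eq_cube field_simps)
    then show ?thesis by simp
  qed
  moreover have "linear (frechet_derivative R (at (x /\<^sub>R norm x)))"
    using x by (intro C1_on_linear_derivative[OF R_C1]) auto
  ultimately show ?thesis by (simp only: q_inner[OF x] linear_0)
qed

lemma p_tangent: "x \<noteq> 0 \<Longrightarrow> p x \<bullet> x = 0" and W_tangent: "x \<noteq> 0 \<Longrightarrow> W x \<bullet> x = 0"
  using q_tangent by (auto simp: p_def W_def)

context
  fixes y :: 'a assumes y0: "y \<noteq> 0"
begin

abbreviation "Dq \<equiv> frechet_derivative q (at y)"
abbreviation "Dp \<equiv> frechet_derivative p (at y)"
abbreviation "DW \<equiv> frechet_derivative W (at y)"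
abbreviation "\<Lambda> \<equiv> lam (R y)"
abbreviation "\<Lambda>' \<equiv> lam' (R y)"

lemma Dq_has: "(q has_derivative Dq) (at y)" and Dp_has: "(p has_derivative Dp) (at y)"
  and DW_has: "(W has_derivative DW) (at y)"
  using y0 by (auto intro!: C1_on_has_derivative q_C1 p_C1 W_C1)

lemma R_has: "(R has_derivative (\<lambda>u. q y \<bullet> u)) (at y)"
  using C1_on_has_derivative[OF R_C1, of y] y0 by (simp add: q_inner)

lemma lamR_has: "((\<lambda>x. lam (R x)) has_derivative (\<lambda>u. \<Lambda>' * (q y \<bullet> u))) (at y)"
  using has_derivative_compose[OF R_has lam_deriv[OF R_range[OF y0], unfolded has_field_derivative_def]] by simp

lemma inverse_lamR_has:
  "((\<lambda>x. inverse (lam (R x))) has_derivative (\<lambda>u. - (inverse \<Lambda> * (\<Lambda>' * (q y \<bullet> u)) * inverse \<Lambda>))) (at y)"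
  using lamR_pos[OF y0] by (intro Deriv.has_derivative_inverse lamR_has) auto

lemma Dq_symmetric: "Dq u \<bullet> w = Dq w \<bullet> u"
proof -
  have *: "frechet_derivative (\<lambda>x. frechet_derivative R (at x) w) (at y) u = Dq u \<bullet> w" for u w
  proof -
    have "((\<lambda>x. q x \<bullet> w) has_derivative (\<lambda>u. Dq u \<bullet> w)) (at y)"
      by (auto intro!: derivative_eq_intros Dq_has)
    then have "((\<lambda>x. frechet_derivative R (at x) w) has_derivative (\<lambda>u. Dq u \<bullet> w)) (at y)"
      by (rule has_derivative_transform_within_open[where s = "-{0}"]) (use y0 q_inner in auto)
    from frechet_derivative_at[OF this] show ?thesis by (rule fun_cong[symmetric])
  qed
  show ?thesis
    using second_derivative_symmetric[OF R_C1 dR_C1, of y w u] y0 by (simp add: *)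
qed

lemma Dp_eq: "Dp u = inverse \<Lambda> *\<^sub>R Dq u - (\<Lambda>' * (q y \<bullet> u) / \<Lambda>\<^sup>2) *\<^sub>R q y"
proof -
  have "(p has_derivative (\<lambda>u. inverse \<Lambda> *\<^sub>R Dq u +
      (- (inverse \<Lambda> * (\<Lambda>' * (q y \<bullet> u)) * inverse \<Lambda>)) *\<^sub>R q y)) (at y)"
    unfolding p_def[abs_def] by (rule has_derivative_scaleR[OF inverse_lamR_has Dq_has])
  from frechet_derivative_at[OF this, THEN fun_cong, symmetric, of u] show ?thesis
    by (simp add: power2_eq_square divide_inverse mult_ac)
qed

text \<open>Both parts of \<open>Dp\<close> are symmetric, as they must be since \<open>p\<close> is a gradient.\<close>

lemma Dp_symmetric: "Dp u \<bullet> w = Dp w \<bullet> u"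
  unfolding Dp_eq using Dq_symmetric[of u w] by (simp add: inner_diff_left)

lemma c_has: "(c has_derivative (\<lambda>u. - (c y ^ 3) * (p y \<bullet> Dp u))) (at y)"
proof -
  have "((\<lambda>x. 1 + p x \<bullet> p x) has_derivative (\<lambda>u. 2 * (p y \<bullet> Dp u))) (at y)"
    by (auto intro!: derivative_eq_intros Dp_has simp: inner_commute)
  from has_derivative_compose[OF this DERIV_real_sqrt[OF c_arg_pos[of y], unfolded has_field_derivative_def]]
  have "((\<lambda>x. sqrt (1 + p x \<bullet> p x)) has_derivative (\<lambda>u. c y * (p y \<bullet> Dp u))) (at y)"
    by (rule has_derivative_eq_rhs) (simp add: c_def fun_eq_iff)
  then have "((\<lambda>x. inverse (sqrt (1 + p x \<bullet> p x))) has_derivative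
      (\<lambda>u. - (inverse (sqrt (1 + p y \<bullet> p y)) * (c y * (p y \<bullet> Dp u)) * inverse (sqrt (1 + p y \<bullet> p y))))) (at y)"
    using c_arg_pos[of y] by (intro Deriv.has_derivative_inverse) auto
  then show ?thesis unfolding c_def[symmetric]
    by (rule has_derivative_eq_rhs) (simp add: power3_eq_cube mult_ac)
qed

lemma DW_eq: "DW u = c y *\<^sub>R Dp u - (c y ^ 3 * (p y \<bullet> Dp u)) *\<^sub>R p y"
proof -
  have "(W has_derivative (\<lambda>u. c y *\<^sub>R Dp u + (- (c y ^ 3) * (p y \<bullet> Dp u)) *\<^sub>R p y)) (at y)"
    unfolding W_def[abs_def] by (rule has_derivative_scaleR[OF c_has Dp_has])
  from frechet_derivative_at[OF this, THEN fun_cong, symmetric, of u] show ?thesis by simp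
qed

lemma p_DW: "p y \<bullet> DW u = c y ^ 3 * (p y \<bullet> Dp u)"
proof -
  have "p y \<bullet> DW u = c y * (p y \<bullet> Dp u) * (1 - (c y)\<^sup>2 * (p y \<bullet> p y))"
    unfolding DW_eq by (simp add: inner_diff_right power2_eq_square power3_eq_cube algebra_simps)
  also have "1 - (c y)\<^sup>2 * (p y \<bullet> p y) = (c y)\<^sup>2" using c_sq[of y] by (simp add: algebra_simps)
  finally show ?thesis by (simp add: power2_eq_square power3_eq_cube)
qed

text \<open>On tangent vectors the left-hand side is, up to the factor \<open>lam\<^sup>2\<close>, the induced metric applied to
  the tangential part of \<open>DW u\<close> and to \<open>w\<close>. Its symmetry in \<open>u\<close> and \<open>w\<close> is the self-adjointness of the shape operator.\<close>

lemma form_DW: "DW u \<bullet> w + (p y \<bullet> DW u) * (p y \<bullet> w) = c y * (Dp u \<bullet> w)"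
proof -
  have "DW u \<bullet> w = c y * (Dp u \<bullet> w) - (c y ^ 3 * (p y \<bullet> Dp u)) * (p y \<bullet> w)"
    by (simp add: DW_eq inner_diff_left)
  then show ?thesis by (simp add: p_DW)
qed

lemma DW_radial: "DW u \<bullet> y = - (W y \<bullet> u)"
proof -
  have "((\<lambda>x. W x \<bullet> x) has_derivative (\<lambda>u. W y \<bullet> u + DW u \<bullet> y)) (at y)"
    by (intro has_derivative_inner DW_has has_derivative_ident)
  moreover have "((\<lambda>x. W x \<bullet> x) has_derivative (\<lambda>u. 0)) (at y)"
    by (rule has_derivative_transform_within_open[OF has_derivative_const[of 0], where s = "-{0}"])
      (use y0 W_tangent in auto)
  ultimately have "(\<lambda>u. W y \<bullet> u + DW u \<bullet> y) = (\<lambda>u. 0)" by (rule has_derivative_unique)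
  from fun_cong[OF this, of u] show ?thesis by simp
qed

end

end

section \<open>The mean curvature of a radial graph\<close>

definition divergence :: "('a::euclidean_space \<Rightarrow> 'a) \<Rightarrow> 'a \<Rightarrow> real" where
  "divergence V x = (\<Sum>b\<in>Basis. frechet_derivative V (at x) b \<bullet> b)"

definition tproj :: "'a::euclidean_space \<Rightarrow> 'a \<Rightarrow> 'a" where
  "tproj y u = u - (u \<bullet> y) *\<^sub>R y"

lemma tproj_linear: "linear (tproj y)"
  by (auto intro!: linearI simp: tproj_def inner_add_left algebra_simps)

lemma tproj_tangent: "norm y = 1 \<Longrightarrow> tproj y u \<bullet> y = 0"
  by (simp add: tproj_def inner_diff_left dot_square_norm)

lemma tproj_id: "u \<bullet> y = 0 \<Longrightarrow> tproj y u = u"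
  by (simp add: tproj_def)

lemma tproj_radial: "norm y = 1 \<Longrightarrow> tproj y y = 0"
  by (simp add: tproj_def dot_square_norm)

lemma tproj_adjoint: "tproj y u \<bullet> w = u \<bullet> tproj y w"
  by (simp add: tproj_def inner_diff_left inner_diff_right inner_commute)

lemma tproj_inner: "norm y = 1 \<Longrightarrow> tproj y u \<bullet> w = tproj y u \<bullet> tproj y w"
  by (metis tproj_adjoint tproj_id tproj_tangent)

text \<open>Compressing an operator to the tangent space of the sphere removes its radial diagonal entry from
  the trace.\<close>

lemma trace_tproj:
  fixes A :: "'a::euclidean_space \<Rightarrow> 'a"
  assumes A: "linear A" and y: "norm y = 1"
  shows "(\<Sum>b\<in>Basis. tproj y (A (tproj y b)) \<bullet> b) = (\<Sum>b\<in>Basis. A b \<bullet> b) - A y \<bullet> y"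
proof -
  have "tproj y (A (tproj y b)) \<bullet> b = A b \<bullet> b - (y \<bullet> b) * (A y \<bullet> b) - A ((y \<bullet> b) *\<^sub>R b) \<bullet> y
      + (A y \<bullet> y) * ((y \<bullet> b) * (y \<bullet> b))" for b
    by (simp add: tproj_adjoint) (simp add: tproj_def linear_diff[OF A] linear_scale[OF A] inner_diff_left
        inner_diff_right inner_commute[of b y] algebra_simps)
  moreover have "(\<Sum>b\<in>Basis. A ((y \<bullet> b) *\<^sub>R b) \<bullet> y) = A y \<bullet> y"
    by (simp add: inner_sum_left[symmetric] linear_sum[OF A, symmetric] euclidean_representation)
  moreover have "(\<Sum>b\<in>Basis. (y \<bullet> b) * (A y \<bullet> b)) = A y \<bullet> y"
    by (simp add: euclidean_inner[of "A y" y] mult.commute)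
  moreover have "(\<Sum>b\<in>Basis. (y \<bullet> b) * (y \<bullet> b)) = 1"
    using y by (simp add: euclidean_inner[of y y, symmetric] dot_square_norm)
  ultimately show ?thesis
    by (simp add: sum.distrib sum_subtractf sum_distrib_left[symmetric])
qed

context star_shaped_graph
begin

text \<open>The shape operator, pulled back to the sphere and extended by zero to the radial direction. On the
  cylinder it would be the tangential part of \<open>- DW\<close>; the conformal factor \<open>lam\<^sup>2\<close> adds the multiple
  \<open>lam' c / lam\<close> of the identity and the factor \<open>1 / lam\<close>.\<close>

definition shape_op :: "'a \<Rightarrow> 'a \<Rightarrow> 'a" where
  "shape_op y u = (lam' (R y) * c y / lam (R y)) *\<^sub>R tproj y u
     - inverse (lam (R y)) *\<^sub>R tproj y (frechet_derivative W (at y) (tproj y u))"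

lemma radial_graph_diff:
  assumes y: "norm y = 1" and u: "u \<bullet> y = 0"
  shows "sphere_diff (radial_graph r) y u = exp (R y) *\<^sub>R ((q y \<bullet> u) *\<^sub>R y + u)"
proof -
  have y0: "y \<noteq> 0" using y by auto
  have "((\<lambda>x. exp (R x) *\<^sub>R x) has_derivative (\<lambda>u. exp (R y) *\<^sub>R u + (exp (R y) * (q y \<bullet> u)) *\<^sub>R y)) (at y)"
    by (rule derivative_eq_intros R_has[OF y0] refl)+ (simp add: mult.commute)
  from sphere_diff_eq[OF y u this] show ?thesis
    by (simp add: radial_graph_def R_sphere algebra_simps)
qed

text \<open>Uniqueness: orthogonality to the graph determines the spherical part from the radial part \<open>\<alpha>\<close>, and
  \<open>\<alpha>\<close> is then determined by its sign and the unit length.\<close>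

lemma outward_normal_eq:
  assumes y: "norm y = 1"
  shows "outward_normal (warped_metric lam) (radial_graph r) y =
    exp (R y) *\<^sub>R (c y *\<^sub>R y + (- inverse (lam (R y))) *\<^sub>R W y)" (is "_ = ?nu")
  unfolding outward_normal_def
proof (rule the_equality)
  let ?\<rho> = "exp (R y)" and ?l = "lam (R y)"
  have y0: "y \<noteq> 0" and yy: "y \<bullet> y = 1" using y by (auto simp: dot_square_norm)
  have F: "radial_graph r y = ?\<rho> *\<^sub>R y" using y by (simp add: radial_graph_def R_sphere)
  have F': "radial_graph r y = ?\<rho> *\<^sub>R (1 *\<^sub>R y + 0)" by (simp add: F)
  have l: "?l > 0" by (rule lamR_pos[OF y0])
  note split = warped_metric_tangent_split[OF y exp_gt_zero[of "R y"], where lam = lam, unfolded ln_exp]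
  have Wy: "(- inverse ?l *\<^sub>R W y) \<bullet> y = 0" using W_tangent[OF y0] by simp
  have "warped_metric lam (?\<rho> *\<^sub>R y) ?nu ?nu = (c y)\<^sup>2 * (1 + p y \<bullet> p y)"
    unfolding split[OF Wy Wy] using l by (simp add: W_def power2_eq_square field_simps)
  moreover have "warped_metric lam (?\<rho> *\<^sub>R y) ?nu (?\<rho> *\<^sub>R ((q y \<bullet> u) *\<^sub>R y + u)) = 0" if "u \<bullet> y = 0" for u
    unfolding split[OF Wy that] using l by (simp add: W_def q_eq[OF y0] power2_eq_square)
  moreover have "warped_metric lam (?\<rho> *\<^sub>R y) ?nu (radial_graph r y) > 0"
    unfolding F' split[OF Wy inner_zero_left] using c_pos by simp
  ultimately show "warped_metric lam (radial_graph r y) ?nu ?nu = 1 \<and>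
     (\<forall>u. u \<bullet> y = 0 \<longrightarrow> warped_metric lam (radial_graph r y) ?nu (sphere_diff (radial_graph r) y u) = 0) \<and>
     warped_metric lam (radial_graph r y) ?nu (radial_graph r y) > 0"
    by (simp add: c_sq F[symmetric] radial_graph_diff[OF y])
  fix \<nu> assume \<nu>: "warped_metric lam (radial_graph r y) \<nu> \<nu> = 1 \<and>
     (\<forall>u. u \<bullet> y = 0 \<longrightarrow> warped_metric lam (radial_graph r y) \<nu> (sphere_diff (radial_graph r) y u) = 0) \<and>
     warped_metric lam (radial_graph r y) \<nu> (radial_graph r y) > 0"
  define \<alpha> where "\<alpha> = (\<nu> /\<^sub>R ?\<rho>) \<bullet> y"
  define z where "z = tproj y (\<nu> /\<^sub>R ?\<rho>)"
  have zy: "z \<bullet> y = 0" unfolding z_def by (rule tproj_tangent[OF y])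
  have \<nu>_eq: "\<nu> = ?\<rho> *\<^sub>R (\<alpha> *\<^sub>R y + z)" by (simp add: z_def \<alpha>_def tproj_def)
  have \<alpha>: "\<alpha> > 0" using \<nu> unfolding F' unfolding F[unfolded F', symmetric] \<nu>_eq
    by (simp add: F split[OF zy inner_zero_left, of \<alpha> 1, simplified])
  \<comment> \<open>Testing orthogonality against this tangent vector gives its squared length, so it is zero.\<close>
  define u where "u = \<alpha> *\<^sub>R q y + ?l\<^sup>2 *\<^sub>R z"
  have uy: "u \<bullet> y = 0" using zy q_tangent[OF y0] by (simp add: u_def inner_add_left)
  have "warped_metric lam (?\<rho> *\<^sub>R y) \<nu> (?\<rho> *\<^sub>R ((q y \<bullet> u) *\<^sub>R y + u)) = 0"
  proof -
    have "warped_metric lam (radial_graph r y) \<nu> (sphere_diff (radial_graph r) y u) = 0"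
      using \<nu> uy by blast
    then show ?thesis by (simp only: F radial_graph_diff[OF y uy])
  qed
  then have "u \<bullet> u = 0" unfolding \<nu>_eq split[OF zy uy] by (simp add: u_def inner_add_left)
  then have "?l\<^sup>2 *\<^sub>R z = - (\<alpha> *\<^sub>R q y)" by (simp add: u_def eq_neg_iff_add_eq_0 add.commute)
  then have "(?l * ?l) *\<^sub>R z = (?l * ?l) *\<^sub>R (- (\<alpha> * inverse ?l) *\<^sub>R p y)"
    using l by (simp add: q_eq[OF y0] power2_eq_square)
  then have z: "z = - (\<alpha> * inverse ?l) *\<^sub>R p y" using l by (simp only: scaleR_cancel_left) auto
  have "warped_metric lam (?\<rho> *\<^sub>R y) \<nu> \<nu> = 1" using \<nu> by (simp add: F)
  then have "\<alpha> * \<alpha> + ?l\<^sup>2 * (z \<bullet> z) = 1" unfolding \<nu>_eq split[OF zy zy] .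
  then have "\<alpha>\<^sup>2 * (1 + p y \<bullet> p y) = 1" using l by (simp add: z power2_eq_square field_simps)
  with c_sq[of y] have "\<alpha>\<^sup>2 = (c y)\<^sup>2" using c_arg_pos[of y]
    by (metis less_irrefl mult_right_cancel)
  then have "\<alpha> = c y" using \<alpha> c_pos[of y] by (simp add: power2_eq_iff_nonneg)
  then show "\<nu> = ?nu" using \<nu>_eq z by (simp add: W_def mult.commute)
qed

lemma outward_normal_diff:
  assumes y: "norm y = 1" and u: "u \<bullet> y = 0"
  defines "i \<equiv> inverse (lam (R y))"
  shows "sphere_diff (outward_normal (warped_metric lam) (radial_graph r)) y u =
    exp (R y) *\<^sub>R (((q y \<bullet> u) * c y - c y ^ 3 * (p y \<bullet> frechet_derivative p (at y) u)) *\<^sub>R y + c y *\<^sub>R u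
      + (i\<^sup>2 * lam' (R y) * (q y \<bullet> u) - i * (q y \<bullet> u)) *\<^sub>R W y - i *\<^sub>R frechet_derivative W (at y) u)"
proof -
  have y0: "y \<noteq> 0" using y by auto
  have 1: "((\<lambda>x. exp (R x)) has_derivative (\<lambda>u. exp (R y) * (q y \<bullet> u))) (at y)"
    by (rule derivative_eq_intros R_has[OF y0] refl)+ (simp add: fun_eq_iff)
  have 2: "((\<lambda>x. c x *\<^sub>R x - inverse (lam (R x)) *\<^sub>R W x) has_derivative
     (\<lambda>u. (c y *\<^sub>R u + (- (c y ^ 3) * (p y \<bullet> frechet_derivative p (at y) u)) *\<^sub>R y) -
       (i *\<^sub>R frechet_derivative W (at y) u + (- (i * (lam' (R y) * (q y \<bullet> u)) * i)) *\<^sub>R W y))) (at y)"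
    unfolding i_def
    by (intro has_derivative_diff has_derivative_scaleR c_has[OF y0] DW_has[OF y0] inverse_lamR_has[OF y0]
        has_derivative_ident)
  note d = has_derivative_scaleR[OF 1 2]
  show ?thesis
    by (subst sphere_diff_eq[OF y u d])
      (simp_all add: outward_normal_eq i_def[symmetric] algebra_simps power2_eq_square)
qed

lemma shape_op_tangent: "norm y = 1 \<Longrightarrow> shape_op y u \<bullet> y = 0"
  by (simp add: shape_op_def inner_diff_left tproj_tangent)

text \<open>The right-hand side is the differential of the graph applied to \<open>shape_op y u\<close>. In the spherical
  part the terms along \<open>W\<close> cancel; the radial part then agrees, as it must because the derivative of a
  unit normal is tangential.\<close>

lemma cov_deriv_outward_normal:
  assumes y: "norm y = 1" and u: "u \<bullet> y = 0"
  shows "cov_deriv_along (warped_metric lam) (radial_graph r) (outward_normal (warped_metric lam) (radial_graph r)) y u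
    = exp (R y) *\<^sub>R ((q y \<bullet> shape_op y u) *\<^sub>R y + shape_op y u)"
proof -
  let ?l = "lam (R y)" and ?l' = "lam' (R y)"
  have y0: "y \<noteq> 0" using y by auto
  define i where "i = inverse ?l"
  have l: "?l > 0" by (rule lamR_pos[OF y0])
  have li: "?l * i = 1" using l by (simp add: i_def)
  define D where "D = tproj y (frechet_derivative W (at y) u)"
  have Dy: "D \<bullet> y = 0" unfolding D_def by (rule tproj_tangent[OF y])
  have DW: "frechet_derivative W (at y) u = D - (W y \<bullet> u) *\<^sub>R y"
    by (simp add: D_def tproj_def DW_radial[OF y0])
  define k where "k = c y ^ 3 * (p y \<bullet> frechet_derivative p (at y) u)"
  have pD: "p y \<bullet> D = k"
    using p_DW[OF y0, of u] p_tangent[OF y0] by (simp add: DW inner_diff_right k_def)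
  have S: "shape_op y u = (?l' * c y * i) *\<^sub>R u - i *\<^sub>R D"
    by (simp add: shape_op_def tproj_id[OF u] D_def i_def divide_inverse)
  have qS: "q y \<bullet> shape_op y u = ?l' * (W y \<bullet> u) - k"
  proof -
    have "q y \<bullet> shape_op y u = (?l * i) * (?l' * c y * (p y \<bullet> u) - p y \<bullet> D)"
      by (simp add: S q_eq[OF y0] inner_diff_right algebra_simps)
    then show ?thesis by (simp add: li pD W_def)
  qed
  define x where "x = - i *\<^sub>R W y"
  have xy: "x \<bullet> y = 0" using W_tangent[OF y0] by (simp add: x_def)
  have ux: "u \<bullet> x = - i * (W y \<bullet> u)" by (simp add: x_def inner_commute)
  have F: "radial_graph r y = exp (R y) *\<^sub>R y" using y by (simp add: radial_graph_def R_sphere)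
  have N: "outward_normal (warped_metric lam) (radial_graph r) y = exp (R y) *\<^sub>R (c y *\<^sub>R y + x)"
    by (simp add: outward_normal_eq[OF y] x_def i_def)
  have ch: "christoffel (warped_metric lam) (radial_graph r y) (sphere_diff (radial_graph r) y u)
      (outward_normal (warped_metric lam) (radial_graph r) y) =
    exp (R y) *\<^sub>R ((- (q y \<bullet> u) * c y - (?l * ?l' - 1) * (u \<bullet> x)) *\<^sub>R y
      + (?l' / ?l - 1) *\<^sub>R (c y *\<^sub>R u + (q y \<bullet> u) *\<^sub>R x))"
    unfolding N F radial_graph_diff[OF y u]
    using christoffel_warped_metric[OF y exp_gt_zero[of "R y"], where lam = lam and l' = ?l', unfolded ln_exp,
        OF lam_deriv[OF R_range[OF y0]] l u xy] by simp
  have coef: "(?l * ?l' - 1) * (i * (W y \<bullet> u)) + i * (W y \<bullet> u) = ?l' * (W y \<bullet> u)"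
    using li by (simp add: algebra_simps)
  have "cov_deriv_along (warped_metric lam) (radial_graph r) (outward_normal (warped_metric lam) (radial_graph r)) y u
    = exp (R y) *\<^sub>R (((?l * ?l' - 1) * (i * (W y \<bullet> u)) + i * (W y \<bullet> u) - k) *\<^sub>R y + (?l' * c y * i) *\<^sub>R u - i *\<^sub>R D)"
    unfolding cov_deriv_along_def ch outward_normal_diff[OF y u] DW k_def[symmetric] ux
    unfolding i_def[symmetric] divide_inverse
    by (simp add: x_def algebra_simps power2_eq_square)
  then show ?thesis unfolding coef qS unfolding S by (simp add: algebra_simps)
qed

lemma principal_space_eq:
  assumes y: "norm y = 1"
  shows "principal_space (warped_metric lam) (radial_graph r) y \<kappa> = {u. u \<bullet> y = 0 \<and> shape_op y u = \<kappa> *\<^sub>R u}"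
proof -
  have "exp (R y) *\<^sub>R ((q y \<bullet> v) *\<^sub>R y + v) = \<kappa> *\<^sub>R (exp (R y) *\<^sub>R ((q y \<bullet> u) *\<^sub>R y + u)) \<longleftrightarrow> v = \<kappa> *\<^sub>R u" (is "?A = ?B \<longleftrightarrow> _")
    if "u \<bullet> y = 0" "v \<bullet> y = 0" for u v
  proof
    assume "?A = ?B"
    then have "tproj y ?A = tproj y ?B" by simp
    then have "exp (R y) *\<^sub>R v = exp (R y) *\<^sub>R (\<kappa> *\<^sub>R u)" using that
      by (simp add: linear_scale[OF tproj_linear] linear_add[OF tproj_linear] tproj_id tproj_radial[OF y] mult.commute)
    then show "v = \<kappa> *\<^sub>R u" by (simp only: scaleR_cancel_left exp_not_eq_zero simp_thms)
  qed (simp add: algebra_simps)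
  note main = this
  show ?thesis
    unfolding principal_space_def
  proof (rule Collect_cong, rule conj_cong[OF refl])
    fix u assume u: "u \<bullet> y = 0"
    show "cov_deriv_along (warped_metric lam) (radial_graph r)
        (outward_normal (warped_metric lam) (radial_graph r)) y u = \<kappa> *\<^sub>R sphere_diff (radial_graph r) y u
        \<longleftrightarrow> shape_op y u = \<kappa> *\<^sub>R u"
      unfolding cov_deriv_outward_normal[OF y u] radial_graph_diff[OF y u]
      by (rule main[OF u shape_op_tangent[OF y]])
  qed
qed

text \<open>The trace of the shape operator. The form \<open>h\<close> in the proof is the induced metric divided by \<open>lam\<^sup>2\<close>,
  extended so that the radial direction is orthogonal to the tangent space.\<close>

lemma mean_curvature_eq:
  assumes y: "norm y = 1"
  shows "mean_curvature (warped_metric lam) (radial_graph r) y =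
    (real (DIM('a) - 1) * lam' (R y) * c y - divergence W y) / lam (R y)"
proof -
  have y0: "y \<noteq> 0" and yy: "y \<bullet> y = 1" using y by (auto simp: dot_square_norm)
  let ?S = "shape_op y" and ?DW = "frechet_derivative W (at y)" and ?Dp = "frechet_derivative p (at y)"
  have lDW: "linear ?DW" using DW_has[OF y0] has_derivative_linear by blast
  have lS: "linear ?S"
    by (rule linearI) (simp_all add: shape_op_def linear_add[OF tproj_linear] linear_scale[OF tproj_linear]
        linear_add[OF lDW] linear_scale[OF lDW] algebra_simps)
  define h where "h u w = u \<bullet> w + (p y \<bullet> u) * (p y \<bullet> w)" for u w :: 'a
  have h: "pos_def_form h"
    unfolding pos_def_form_def bilinear_def h_def
    by (auto intro!: linearI add_pos_nonneg simp: inner_add_left inner_add_right algebra_simps inner_commute[of _ "p y"])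
      (simp add: inner_commute)
  have pt: "p y \<bullet> tproj y v = p y \<bullet> v" for v
    using p_tangent[OF y0] by (simp add: tproj_def inner_diff_right)
  have hS: "h (?S u) w = (lam' (R y) * c y / lam (R y)) * (tproj y u \<bullet> tproj y w + (p y \<bullet> u) * (p y \<bullet> w))
      - inverse (lam (R y)) * (c y * (?Dp (tproj y u) \<bullet> tproj y w))" for u w
  proof -
    have DW: "tproj y (?DW (tproj y u)) \<bullet> w + (p y \<bullet> ?DW (tproj y u)) * (p y \<bullet> w)
        = c y * (?Dp (tproj y u) \<bullet> tproj y w)"
      using form_DW[OF y0, of "tproj y u" "tproj y w"] by (simp add: tproj_adjoint pt)
    show ?thesis
      unfolding h_def shape_op_def DW[symmetric]
      by (simp add: inner_diff_left inner_diff_right pt tproj_inner[OF y, of u w] algebra_simps)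
  qed
  have sa: "h (?S u) w = h u (?S w)" for u w
  proof -
    have "h u (?S w) = h (?S w) u" by (simp add: h_def inner_commute mult.commute)
    then show ?thesis unfolding hS using Dp_symmetric[OF y0, of "tproj y u" "tproj y w"]
      by (simp add: inner_commute mult.commute)
  qed
  \<comment> \<open>The extended operator has the radial direction as an additional eigenvector, but with eigenvalue zero, which contributes nothing to either sum.\<close>
  define K where "K = {\<kappa>. \<exists>u. u \<noteq> 0 \<and> ?S u = \<kappa> *\<^sub>R u}"
  define PC where "PC = principal_curvatures (warped_metric lam) (radial_graph r) y"
  have fin: "finite K" and tr: "(\<Sum>b\<in>Basis. ?S b \<bullet> b) = (\<Sum>\<kappa>\<in>K. real (dim {u. ?S u = \<kappa> *\<^sub>R u}) * \<kappa>)"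
    using trace_self_adjoint_eq_sum_eigenvalues[of h ?S, OF h lS sa] unfolding K_def by blast+
  have tang: "u \<bullet> y = 0" if "?S u = \<kappa> *\<^sub>R u" "\<kappa> \<noteq> 0" for u \<kappa>
    using shape_op_tangent[OF y, of u] that by simp
  have ps: "principal_space (warped_metric lam) (radial_graph r) y \<kappa> = {u. ?S u = \<kappa> *\<^sub>R u}" if "\<kappa> \<noteq> 0" for \<kappa>
    unfolding principal_space_eq[OF y] using tang[OF _ that] by blast
  have PCK: "PC \<subseteq> K" by (auto simp: PC_def K_def principal_curvatures_def principal_space_eq[OF y])
  have "mean_curvature (warped_metric lam) (radial_graph r) y =
      (\<Sum>\<kappa>\<in>PC. real (dim {u. ?S u = \<kappa> *\<^sub>R u}) * \<kappa>)"
    unfolding mean_curvature_def PC_def[symmetric]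
  proof (rule sum.cong[OF refl])
    fix \<kappa> show "real (dim (principal_space (warped_metric lam) (radial_graph r) y \<kappa>)) * \<kappa> =
        real (dim {u. ?S u = \<kappa> *\<^sub>R u}) * \<kappa>"
      using ps[of \<kappa>] by (cases "\<kappa> = 0") auto
  qed
  also have "\<dots> = (\<Sum>\<kappa>\<in>K. real (dim {u. ?S u = \<kappa> *\<^sub>R u}) * \<kappa>)"
  proof (rule sum.mono_neutral_left[OF fin PCK], intro ballI)
    fix \<kappa> assume \<kappa>: "\<kappa> \<in> K - PC"
    have "\<kappa> = 0"
    proof (rule ccontr)
      assume "\<kappa> \<noteq> 0"
      with \<kappa> ps[OF this] show False by (auto simp: K_def PC_def principal_curvatures_def)
    qed
    then show "real (dim {u. ?S u = \<kappa> *\<^sub>R u}) * \<kappa> = 0" by simp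
  qed
  also have "\<dots> = (\<Sum>b\<in>Basis. ?S b \<bullet> b)" by (rule tr[symmetric])
  also have "\<dots> = (lam' (R y) * c y / lam (R y)) * (\<Sum>b\<in>Basis. tproj y b \<bullet> b)
      - inverse (lam (R y)) * (\<Sum>b\<in>Basis. tproj y (?DW (tproj y b)) \<bullet> b)"
    by (simp add: shape_op_def inner_diff_left sum_subtractf sum_distrib_left)
  also have "(\<Sum>b\<in>Basis. tproj y b \<bullet> b) = real (DIM('a) - 1)"
  proof -
    have "(\<Sum>b\<in>Basis. tproj y b \<bullet> b) = (\<Sum>b\<in>Basis. tproj y (id (tproj y b)) \<bullet> b)"
      by (simp add: tproj_id tproj_tangent[OF y])
    also have "\<dots> = real DIM('a) - 1" by (subst trace_tproj[OF linear_id y]) (simp add: yy)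
    finally show ?thesis by (simp add: of_nat_diff Suc_leI)
  qed
  also have "(\<Sum>b\<in>Basis. tproj y (?DW (tproj y b)) \<bullet> b) = divergence W y"
    using DW_radial[OF y0, of y] W_tangent[OF y0] by (simp add: trace_tproj[OF lDW y] divergence_def)
  finally show ?thesis by (simp add: divide_inverse algebra_simps)
qed

end

section \<open>Stereographic coordinates\<close>

text \<open>The conformal factor of stereographic coordinates: the round metric is its square times the
  Euclidean metric.\<close>

definition stereo_weight :: "'a::euclidean_space \<Rightarrow> real" where
  "stereo_weight x = 2 / (1 + (norm x)\<^sup>2)"

lemma stereo_weight_pos: "stereo_weight x > 0"
  by (simp add: stereo_weight_def add_pos_nonneg)

lemma stereo_weight_norm: "stereo_weight x * (x \<bullet> x) = 2 - stereo_weight x"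
proof -
  have "1 + (norm x)\<^sup>2 > 0" by (simp add: add_pos_nonneg)
  then show ?thesis by (simp add: stereo_weight_def dot_square_norm field_simps)
qed

text \<open>The sphere has finite area. The weight is dominated by a product of one-dimensional integrable
  functions, since \<open>1 + \<bar>x\<bar>\<^sup>2 \<ge> 1 + x\<^sub>i\<^sup>2\<close> for every coordinate.\<close>

lemma integrable_stereo_weight:
  "integrable lborel (\<lambda>x::'a::euclidean_space. stereo_weight x ^ DIM('a))"
proof -
  interpret product_sigma_finite "\<lambda>_::'a. lborel :: real measure" by standard
  have "set_integrable lborel UNIV (\<lambda>x::real. inverse (1 + x\<^sup>2))"
    using integrable_inverse_1_plus_square by (simp add: einterval_def)
  then have 1: "integrable lborel (\<lambda>x::real. 2 * inverse (1 + x\<^sup>2))"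
    by (simp add: set_integrable_def)
  have "integrable (\<Pi>\<^sub>M b\<in>(Basis::'a set). lborel) (\<lambda>f. \<Prod>b\<in>Basis. 2 * inverse (1 + (f b)\<^sup>2) :: real)"
    by (rule product_integrable_prod[OF finite_Basis 1])
  then have "integrable (\<Pi>\<^sub>M b\<in>(Basis::'a set). lborel)
      (\<lambda>f. \<Prod>b\<in>Basis. 2 * inverse (1 + ((\<Sum>b\<in>Basis. f b *\<^sub>R b) \<bullet> b)\<^sup>2) :: real)"
    by (simp add: inner_sum_left inner_Basis if_distrib[of "\<lambda>x. _ * x"] cong: if_cong)
  then have "integrable lborel (\<lambda>x::'a. \<Prod>b\<in>Basis. 2 * inverse (1 + (x \<bullet> b)\<^sup>2))"
    unfolding lborel_eq[where 'a = 'a] by (subst integrable_distr_eq) auto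
  then show ?thesis
  proof (rule Bochner_Integration.integrable_bound)
    show "(\<lambda>x::'a. stereo_weight x ^ DIM('a)) \<in> borel_measurable lborel"
      unfolding stereo_weight_def by measurable
    show "AE x::'a in lborel. norm (stereo_weight x ^ DIM('a)) \<le> norm (\<Prod>b\<in>Basis. 2 * inverse (1 + (x \<bullet> b)\<^sup>2))"
    proof (rule AE_I2)
      fix x :: 'a
      have "stereo_weight x ^ DIM('a) = (\<Prod>b\<in>(Basis::'a set). stereo_weight x)" by simp
      also have "\<dots> \<le> (\<Prod>b\<in>Basis. 2 * inverse (1 + (x \<bullet> b)\<^sup>2))"
      proof (rule prod_mono)
        fix b :: 'a assume b: "b \<in> Basis"
        have "(x \<bullet> b)\<^sup>2 \<le> (norm x)\<^sup>2" using Basis_le_norm[OF b, of x] by (simp add: abs_le_square_iff[symmetric])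
        then have "2 / (1 + (norm x)\<^sup>2) \<le> 2 / (1 + (x \<bullet> b)\<^sup>2)"
          by (intro divide_left_mono mult_pos_pos) (auto simp: add_pos_nonneg)
        then show "0 \<le> stereo_weight x \<and> stereo_weight x \<le> 2 * inverse (1 + (x \<bullet> b)\<^sup>2)"
          using stereo_weight_pos[of x] by (simp add: stereo_weight_def divide_inverse)
      qed
      finally have "stereo_weight x ^ DIM('a) \<le> (\<Prod>b\<in>Basis. 2 * inverse (1 + (x \<bullet> b)\<^sup>2))" .
      then show "norm (stereo_weight x ^ DIM('a)) \<le> norm (\<Prod>b\<in>Basis. 2 * inverse (1 + (x \<bullet> b)\<^sup>2))"
        using stereo_weight_pos[of x] by auto
    qed
  qed
qed

lemma stereo_weight_has_derivative:
  "(stereo_weight has_derivative (\<lambda>v. - ((stereo_weight x)\<^sup>2 * (x \<bullet> v)))) (at x)"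
proof -
  have "((\<lambda>x. 2 * inverse (1 + x \<bullet> x)) has_derivative
      (\<lambda>v. 2 * (- (inverse (1 + x \<bullet> x) * (2 * (x \<bullet> v)) * inverse (1 + x \<bullet> x))))) (at x)"
  proof (rule has_derivative_mult_right, rule Deriv.has_derivative_inverse)
    show "1 + x \<bullet> x \<noteq> 0" by (metis add_pos_nonneg inner_ge_zero less_irrefl zero_less_one)
    show "((\<lambda>x. 1 + x \<bullet> x) has_derivative (\<lambda>v. 2 * (x \<bullet> v))) (at x)"
      by (auto intro!: derivative_eq_intros simp: inner_commute)
  qed
  then show ?thesis
    unfolding stereo_weight_def[abs_def] dot_square_norm divide_inverse
    by (rule has_derivative_eq_rhs) (simp add: fun_eq_iff power2_eq_square)
qed

lemma stereo_weight_C1: "C1_on UNIV stereo_weight"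
  by (rule C1_onI[OF _ stereo_weight_has_derivative])
    (auto intro!: continuous_intros simp: stereo_weight_def add_nonneg_eq_0_iff)

lemma inv_stereographic_eq: "inv_stereographic x = (stereo_weight x *\<^sub>R x, 1 - stereo_weight x)"
proof -
  have "1 + (norm x)\<^sup>2 > 0" by (simp add: add_pos_nonneg)
  then show ?thesis by (simp add: inv_stereographic_def stereo_weight_def field_simps)
qed

lemma norm_inv_stereographic: "norm (inv_stereographic x) = 1"
proof -
  have "inv_stereographic x \<bullet> inv_stereographic x = stereo_weight x * (stereo_weight x * (x \<bullet> x)) + (1 - stereo_weight x)\<^sup>2"
    by (simp add: inv_stereographic_eq power2_eq_square)
  also have "\<dots> = 1" unfolding stereo_weight_norm by (simp add: power2_eq_square algebra_simps)
  finally show ?thesis by (simp add: norm_eq_1)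
qed

lemma inv_stereographic_pole_distance:
  "(norm (inv_stereographic x - (0, 1)))\<^sup>2 = 2 * stereo_weight x"
proof -
  have "(norm (inv_stereographic x - (0, 1)))\<^sup>2 = stereo_weight x * (stereo_weight x * (x \<bullet> x)) + (stereo_weight x)\<^sup>2"
    unfolding power2_norm_eq_inner by (simp add: inv_stereographic_eq power2_eq_square)
  also have "\<dots> = 2 * stereo_weight x" unfolding stereo_weight_norm by (simp add: power2_eq_square algebra_simps)
  finally show ?thesis .
qed

text \<open>The differential of the inverse stereographic projection divided by the conformal factor; it maps an
  orthonormal basis to an orthonormal basis of the tangent space of the sphere.\<close>

definition stereo_frame :: "real ^ 'n \<Rightarrow> real ^ 'n \<Rightarrow> (real ^ 'n) \<times> real" where
  "stereo_frame x v = (v - (stereo_weight x * (x \<bullet> v)) *\<^sub>R x, stereo_weight x * (x \<bullet> v))"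

lemma inv_stereographic_has_derivative:
  "(inv_stereographic has_derivative (\<lambda>v. stereo_weight x *\<^sub>R stereo_frame x v)) (at x)"
proof -
  have "((\<lambda>x. (stereo_weight x *\<^sub>R x, 1 - stereo_weight x)) has_derivative
    (\<lambda>v. (stereo_weight x *\<^sub>R v + (- ((stereo_weight x)\<^sup>2 * (x \<bullet> v))) *\<^sub>R x, 0 - (- ((stereo_weight x)\<^sup>2 * (x \<bullet> v)))))) (at x)"
    by (intro has_derivative_Pair has_derivative_scaleR has_derivative_diff has_derivative_const
        has_derivative_ident stereo_weight_has_derivative)
  then show ?thesis
    unfolding inv_stereographic_eq[abs_def]
    by (rule has_derivative_eq_rhs) (simp add: fun_eq_iff stereo_frame_def power2_eq_square algebra_simps)
qed

lemma inv_stereographic_C1: "C1_on UNIV inv_stereographic"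
proof (rule C1_onI[OF _ inv_stereographic_has_derivative])
  have "continuous_on UNIV (stereo_weight :: real^'n \<Rightarrow> real)" by (rule C1_on_continuous[OF stereo_weight_C1])
  then show "continuous_on UNIV (\<lambda>x::real^'n. stereo_weight x *\<^sub>R stereo_frame x v)" for v
    unfolding stereo_frame_def by (intro continuous_intros)
qed auto

text \<open>The adjoint of the frame.\<close>

definition stereo_coframe :: "real ^ 'n \<Rightarrow> (real ^ 'n) \<times> real \<Rightarrow> real ^ 'n" where
  "stereo_coframe x c = fst c - (stereo_weight x * (fst c \<bullet> x - snd c)) *\<^sub>R x"

lemma inner_stereo_frame: "c \<bullet> stereo_frame x v = stereo_coframe x c \<bullet> v"
  by (cases c) (simp add: stereo_frame_def stereo_coframe_def inner_diff_left inner_diff_right algebra_simps)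

text \<open>The frame composed with its adjoint is the orthogonal projection onto the tangent space.\<close>

lemma stereo_frame_coframe:
  "stereo_frame x (stereo_coframe x c) = c - (c \<bullet> inv_stereographic x) *\<^sub>R inv_stereographic x"
proof -
  let ?w = "stereo_weight x"
  define m where "m = fst c \<bullet> x - snd c"
  have fx: "fst c \<bullet> x = m + snd c" by (simp add: m_def)
  have d: "stereo_coframe x c = fst c - (?w * m) *\<^sub>R x" by (simp add: stereo_coframe_def m_def)
  have xd: "x \<bullet> stereo_coframe x c = snd c - (1 - ?w) * m"
  proof -
    have "x \<bullet> stereo_coframe x c = m + snd c - (?w * (x \<bullet> x)) * m"
      by (simp add: d inner_diff_right inner_commute[of x "fst c"] fx)
    then show ?thesis unfolding stereo_weight_norm by (simp add: algebra_simps)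
  qed
  have cp: "c \<bullet> inv_stereographic x = ?w * m + snd c"
    by (cases c) (use fx in \<open>simp add: inv_stereographic_eq algebra_simps\<close>)
  show ?thesis
    unfolding cp stereo_frame_def xd unfolding d inv_stereographic_eq
    by (cases c) (simp add: algebra_simps)
qed

lemma sum_stereo_frame_inner:
  "(\<Sum>i\<in>Basis. (c \<bullet> stereo_frame x i) * (d \<bullet> stereo_frame x i)) =
     c \<bullet> d - (c \<bullet> inv_stereographic x) * (d \<bullet> inv_stereographic x)"
proof -
  have "(\<Sum>i\<in>Basis. (c \<bullet> stereo_frame x i) * (d \<bullet> stereo_frame x i)) = stereo_coframe x c \<bullet> stereo_coframe x d"
    unfolding inner_stereo_frame by (rule euclidean_inner[symmetric])
  also have "\<dots> = c \<bullet> stereo_frame x (stereo_coframe x d)" by (simp add: inner_stereo_frame)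
  finally show ?thesis by (simp add: stereo_frame_coframe inner_diff_right mult.commute)
qed

lemma sum_stereo_frame_trace:
  assumes L: "linear L"
  shows "(\<Sum>i\<in>Basis. L (stereo_frame x i) \<bullet> stereo_frame x i) =
     (\<Sum>b\<in>Basis. L b \<bullet> b) - L (inv_stereographic x) \<bullet> inv_stereographic x"
proof -
  let ?T = "stereo_frame x" and ?y = "inv_stereographic x"
  have "L (?T i) = (\<Sum>b\<in>Basis. (b \<bullet> ?T i) *\<^sub>R L b)" for i
  proof -
    have "L (?T i) = L (\<Sum>b\<in>Basis. (b \<bullet> ?T i) *\<^sub>R b)"
      by (simp only: inner_commute[of _ "?T i"] euclidean_representation)
    then show ?thesis by (simp only: linear_sum[OF L] linear_scale[OF L])
  qed
  then have "(\<Sum>i\<in>Basis. L (?T i) \<bullet> ?T i) = (\<Sum>i\<in>Basis. \<Sum>b\<in>Basis. (b \<bullet> ?T i) * (L b \<bullet> ?T i))"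
    by (simp add: inner_sum_left)
  also have "\<dots> = (\<Sum>b\<in>Basis. b \<bullet> L b - (b \<bullet> ?y) * (L b \<bullet> ?y))"
    by (subst sum.swap) (simp add: sum_stereo_frame_inner)
  also have "\<dots> = (\<Sum>b\<in>Basis. L b \<bullet> b) - L (\<Sum>b\<in>Basis. (?y \<bullet> b) *\<^sub>R b) \<bullet> ?y"
    by (simp add: linear_sum[OF L] linear_scale[OF L] inner_sum_left sum_subtractf inner_commute[of _ "L _"]
        inner_commute[of ?y])
  finally show ?thesis by (simp add: euclidean_representation)
qed

section \<open>The divergence theorem on the sphere\<close>

lemma C1_on_power: "C1_on U f \<Longrightarrow> C1_on U (\<lambda>x. (f x :: real) ^ n)"
  by (induction n) (auto intro: C1_on_mult C1_on_const C1_on_open)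

lemma C1_on_linear_compose: "bounded_linear g \<Longrightarrow> C1_on U f \<Longrightarrow> C1_on U (\<lambda>x. g (f x :: 'b::euclidean_space))"
  by (rule C1_on_compose[OF C1_on_bounded_linear[OF _ open_UNIV]]) auto

text \<open>A continuous function on the sphere is bounded, so it is integrable against the finite area.\<close>

lemma integrable_stereo:
  fixes f :: "(real ^ 'n) \<times> real \<Rightarrow> real"
  assumes f: "continuous_on (sphere 0 1) f"
  shows "integrable lborel (\<lambda>x. stereo_weight x ^ CARD('n) * f (inv_stereographic x))"
proof -
  have "compact (f ` sphere 0 1)" by (intro compact_continuous_image f) auto
  then obtain M where "\<forall>z\<in>f ` sphere 0 1. norm z \<le> M" using compact_imp_bounded bounded_iff by blast
  then have M: "\<bar>f y\<bar> \<le> M" if "norm y = 1" for y using that by force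
  have w: "integrable lborel (\<lambda>x::real^'n. M * stereo_weight x ^ CARD('n))"
    using integrable_stereo_weight[where 'a = "real^'n"] by (intro integrable_mult_right) simp
  show ?thesis
  proof (rule Bochner_Integration.integrable_bound[OF w], goal_cases)
    case 1
    have "continuous_on UNIV (\<lambda>x. f (inv_stereographic x))"
      by (rule continuous_on_compose2[OF f C1_on_continuous[OF inv_stereographic_C1]])
        (auto simp: norm_inv_stereographic)
    then have "continuous_on UNIV (\<lambda>x. stereo_weight x ^ CARD('n) * f (inv_stereographic x))"
      by (intro continuous_intros C1_on_continuous[OF stereo_weight_C1])
    then show ?case by (simp add: borel_measurable_continuous_onI)
  next
    case 2
    have "norm (stereo_weight x ^ CARD('n) * f (inv_stereographic x)) \<le> norm (M * stereo_weight x ^ CARD('n))"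
      for x :: "real^'n"
    proof -
      have "stereo_weight x ^ CARD('n) * \<bar>f (inv_stereographic x)\<bar> \<le> stereo_weight x ^ CARD('n) * M"
        using M[OF norm_inv_stereographic] stereo_weight_pos[of x] by (intro mult_left_mono) auto
      also have "\<dots> \<le> \<bar>M * stereo_weight x ^ CARD('n)\<bar>" by (simp add: mult.commute)
      finally show ?thesis using stereo_weight_pos[of x] by (simp add: abs_mult)
    qed
    then show ?case by simp
  qed
qed

text \<open>The coordinate expression of the tangential field \<open>V\<close> multiplied by the area density, so that its
  Euclidean divergence is the spherical divergence times the density. By tangency, \<open>fst V + snd V x\<close>
  is the vector of the inner products of \<open>V\<close> with the frame.\<close>

definition stereo_field :: "((real ^ 'n) \<times> real \<Rightarrow> (real ^ 'n) \<times> real) \<Rightarrow> real ^ 'n \<Rightarrow> real ^ 'n" where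
  "stereo_field V x = stereo_weight x ^ (CARD('n) - 1) *\<^sub>R
     (fst (V (inv_stereographic x)) + snd (V (inv_stereographic x)) *\<^sub>R x)"

lemma inv_stereographic_nonzero: "inv_stereographic x \<noteq> 0"
  using norm_inv_stereographic[of x] by force

lemma tangent_radial_component:
  assumes "c \<bullet> inv_stereographic x = 0"
  shows "stereo_weight x * (x \<bullet> (fst c + snd c *\<^sub>R x)) = snd c"
proof -
  have "stereo_weight x * (fst c \<bullet> x) + snd c * (1 - stereo_weight x) = 0"
    using assms by (cases c) (simp add: inv_stereographic_eq algebra_simps)
  moreover have "stereo_weight x * (x \<bullet> (fst c + snd c *\<^sub>R x)) =
      stereo_weight x * (fst c \<bullet> x) + snd c * (stereo_weight x * (x \<bullet> x))"
    by (simp add: inner_add_right inner_commute[of x "fst c"] algebra_simps)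
  ultimately show ?thesis unfolding stereo_weight_norm by (simp add: algebra_simps)
qed

lemma stereo_field_C1:
  assumes V: "C1_on (-{0}) V" shows "C1_on UNIV (stereo_field V)"
proof -
  have VP: "C1_on UNIV (\<lambda>x. V (inv_stereographic x))"
    by (rule C1_on_compose[OF V inv_stereographic_C1]) (auto simp: inv_stereographic_nonzero)
  show ?thesis
    unfolding stereo_field_def[abs_def]
    by (intro C1_on_scaleR C1_on_power stereo_weight_C1 C1_on_add C1_on_ident
        C1_on_linear_compose[OF bounded_linear_fst VP] C1_on_linear_compose[OF bounded_linear_snd VP]) auto
qed

text \<open>The frame yields the trace of the derivative of \<open>V\<close>. The derivatives of the frame and of the density
  contribute multiples of the vertical component of \<open>V\<close> only, and these cancel.\<close>

lemma divergence_stereo_field: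
  fixes V :: "(real ^ 'n) \<times> real \<Rightarrow> (real ^ 'n) \<times> real"
  assumes V: "C1_on (-{0}) V" and tang: "\<And>x. x \<noteq> 0 \<Longrightarrow> V x \<bullet> x = 0"
  shows "divergence (stereo_field V) x = stereo_weight x ^ CARD('n) * divergence V (inv_stereographic x)"
proof -
  define m where "m = CARD('n) - 1"
  have n: "CARD('n) = Suc m" by (simp add: m_def)
  define y where "y = inv_stereographic x"
  define w where "w = stereo_weight x"
  define L where "L = frechet_derivative V (at y)"
  define T where "T = stereo_frame x"
  define e where "e = fst (V y) + snd (V y) *\<^sub>R x"
  have y0: "y \<noteq> 0" unfolding y_def by (rule inv_stereographic_nonzero)
  have L: "(V has_derivative L) (at y)" unfolding L_def using y0 by (intro C1_on_has_derivative[OF V]) auto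
  have lL: "linear L" using L by (rule has_derivative_linear)
  have Lu: "L u \<bullet> y = - (V y \<bullet> u)" for u
  proof -
    have "((\<lambda>x. V x \<bullet> x) has_derivative (\<lambda>u. V y \<bullet> u + L u \<bullet> y)) (at y)"
      by (intro has_derivative_inner L has_derivative_ident)
    moreover have "((\<lambda>x. V x \<bullet> x) has_derivative (\<lambda>u. 0)) (at y)"
      by (rule has_derivative_transform_within_open[OF has_derivative_const[of 0], where s = "-{0}"])
        (use y0 tang in auto)
    ultimately have "(\<lambda>u. V y \<bullet> u + L u \<bullet> y) = (\<lambda>u. 0)" by (rule has_derivative_unique)
    from fun_cong[OF this, of u] show ?thesis by simp
  qed
  have VP: "((\<lambda>x. V (inv_stereographic x)) has_derivative (\<lambda>v. L (w *\<^sub>R T v))) (at x)"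
    unfolding w_def T_def
    by (rule has_derivative_compose[OF inv_stereographic_has_derivative L[unfolded y_def]])
  have "(stereo_field V has_derivative (\<lambda>v. w ^ m *\<^sub>R (fst (L (w *\<^sub>R T v)) + (snd (V y) *\<^sub>R v + snd (L (w *\<^sub>R T v)) *\<^sub>R x))
      + (real m * (- (w\<^sup>2 * (x \<bullet> v))) * w ^ (m - 1)) *\<^sub>R e)) (at x)"
    unfolding stereo_field_def[abs_def] m_def[symmetric] w_def e_def y_def
    by (intro has_derivative_scaleR has_derivative_add has_derivative_power stereo_weight_has_derivative
        has_derivative_fst has_derivative_snd VP[unfolded w_def] has_derivative_ident)
  moreover have coef: "real m * (- (w\<^sup>2 * a)) * w ^ (m - 1) = - (real m * w ^ Suc m * a)" for a
    by (cases m) (simp_all add: power2_eq_square)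
  ultimately have "(stereo_field V has_derivative (\<lambda>v. w ^ m *\<^sub>R (fst (L (w *\<^sub>R T v)) + (snd (V y) *\<^sub>R v + snd (L (w *\<^sub>R T v)) *\<^sub>R x))
      + (- (real m * w ^ Suc m * (x \<bullet> v))) *\<^sub>R e)) (at x)" by (simp only: coef)
  then have Z: "frechet_derivative (stereo_field V) (at x) =
      (\<lambda>v. w ^ m *\<^sub>R (fst (L (w *\<^sub>R T v)) + (snd (V y) *\<^sub>R v + snd (L (w *\<^sub>R T v)) *\<^sub>R x))
      + (- (real m * w ^ Suc m * (x \<bullet> v))) *\<^sub>R e)"
    by (rule frechet_derivative_at[symmetric])
  have split: "(i, x \<bullet> i) = T i + (x \<bullet> i) *\<^sub>R y" for i
    by (simp add: T_def y_def stereo_frame_def inv_stereographic_eq algebra_simps)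
  have "frechet_derivative (stereo_field V) (at x) i \<bullet> i =
      w ^ m * (w * (L (T i) \<bullet> T i) - w * ((x \<bullet> i) * (V y \<bullet> T i)) + snd (V y))
      - real m * w ^ Suc m * ((x \<bullet> i) * (e \<bullet> i))" if i: "i \<in> Basis" for i
  proof -
    have "fst (L (w *\<^sub>R T i)) \<bullet> i + snd (L (w *\<^sub>R T i)) * (x \<bullet> i) = L (w *\<^sub>R T i) \<bullet> (i, x \<bullet> i)"
      by (cases "L (w *\<^sub>R T i)") simp
    also have "\<dots> = w * (L (T i) \<bullet> T i) - w * ((x \<bullet> i) * (V y \<bullet> T i))"
      unfolding split by (simp add: inner_add_right Lu linear_scale[OF lL] algebra_simps)
    finally have tangential: "fst (L (w *\<^sub>R T i)) \<bullet> i + snd (L (w *\<^sub>R T i)) * (x \<bullet> i) =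
      w * (L (T i) \<bullet> T i) - w * ((x \<bullet> i) * (V y \<bullet> T i))" .
    have "frechet_derivative (stereo_field V) (at x) i \<bullet> i =
      w ^ m * ((fst (L (w *\<^sub>R T i)) \<bullet> i + snd (L (w *\<^sub>R T i)) * (x \<bullet> i)) + snd (V y))
      - real m * w ^ Suc m * ((x \<bullet> i) * (e \<bullet> i))"
      unfolding Z using i by (simp add: inner_add_left inner_Basis algebra_simps)
    then show ?thesis unfolding tangential .
  qed
  then have "divergence (stereo_field V) x =
      w ^ m * (w * (\<Sum>i\<in>Basis. L (T i) \<bullet> T i) - w * (\<Sum>i\<in>Basis. (x \<bullet> i) * (V y \<bullet> T i)) + real (Suc m) * snd (V y))
      - real m * w ^ Suc m * (\<Sum>i\<in>Basis. (x \<bullet> i) * (e \<bullet> i))"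
    unfolding divergence_def
    by (simp add: sum.distrib sum_subtractf sum_distrib_left[symmetric] n)
  moreover have "(\<Sum>i\<in>Basis. (x \<bullet> i) * (e \<bullet> i)) = x \<bullet> e" by (rule euclidean_inner[symmetric])
  moreover have "w * (x \<bullet> e) = snd (V y)"
    unfolding w_def e_def by (rule tangent_radial_component) (use tang[OF y0] in \<open>simp add: y_def\<close>)
  moreover have "w * (\<Sum>i\<in>Basis. (x \<bullet> i) * (V y \<bullet> T i)) = snd (V y)"
  proof -
    have co: "stereo_coframe x (V y) = e"
    proof -
      have "V y \<bullet> y = 0" by (rule tang[OF y0])
      then have "w * (fst (V y) \<bullet> x) + snd (V y) * (1 - w) = 0"
        by (cases "V y") (simp add: y_def w_def inv_stereographic_eq algebra_simps)
      then have "w * (fst (V y) \<bullet> x - snd (V y)) = - snd (V y)" by (simp add: algebra_simps)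
      then show ?thesis by (simp add: stereo_coframe_def w_def[symmetric] e_def)
    qed
    have "(\<Sum>i\<in>Basis. (x \<bullet> i) * (V y \<bullet> T i)) = x \<bullet> e"
      unfolding T_def inner_stereo_frame co by (rule euclidean_inner[symmetric])
    then show ?thesis using \<open>w * (x \<bullet> e) = snd (V y)\<close> by simp
  qed
  moreover have "(\<Sum>i\<in>Basis. L (T i) \<bullet> T i) = divergence V y"
    using sum_stereo_frame_trace[OF lL, of x] Lu[of y] tang[OF y0]
    by (simp add: T_def y_def[symmetric] divergence_def L_def)
  moreover have "real m * w ^ Suc m * (x \<bullet> e) = real m * w ^ m * snd (V y)"
    using \<open>w * (x \<bullet> e) = snd (V y)\<close> by (simp add: algebra_simps)
  ultimately have "divergence (stereo_field V) x = w ^ m *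
      (w * divergence V y - snd (V y) + real (Suc m) * snd (V y)) - real m * w ^ m * snd (V y)"
    by simp
  also have "\<dots> = w ^ Suc m * divergence V y" by (simp add: algebra_simps)
  finally show ?thesis by (simp add: n w_def y_def)
qed

lemma positive_part_square_has_derivative: "((\<lambda>t::real. (max 0 t)\<^sup>2) has_field_derivative 2 * max 0 t) (at t)"
proof -
  consider "t > 0" | "t < 0" | "t = 0" by linarith
  then show ?thesis
  proof cases
    case 1
    have "((\<lambda>t::real. t\<^sup>2) has_field_derivative 2 * max 0 t) (at t)"
      using 1 by (auto intro!: derivative_eq_intros)
    then show ?thesis by (rule has_field_derivative_transform_within_open[where S = "{0<..}"]) (use 1 in auto)
  next
    case 2
    have "((\<lambda>t::real. 0) has_field_derivative 2 * max 0 t) (at t)" using 2 by simp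
    then show ?thesis by (rule has_field_derivative_transform_within_open[where S = "{..<0}"]) (use 2 in auto)
  next
    case 3
    have "((\<lambda>h::real. (max 0 h)\<^sup>2 / h) \<longlongrightarrow> 0) (at 0)"
    proof (rule Lim_null_comparison)
      show "\<forall>\<^sub>F h::real in at 0. norm ((max 0 h)\<^sup>2 / h) \<le> \<bar>h\<bar>"
        by (rule always_eventually) (auto simp: max_def power2_eq_square)
      show "((\<lambda>h::real. \<bar>h\<bar>) \<longlongrightarrow> 0) (at 0)" by (rule tendsto_rabs_zero) (rule tendsto_ident_at)
    qed
    then show ?thesis using 3 by (simp add: DERIV_def)
  qed
qed

text \<open>The difference quotients in direction \<open>v\<close> have integral zero by translation invariance and converge
  dominatedly, being uniformly bounded with uniformly bounded support.\<close>

lemma integral_derivative_compact_support: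
  fixes f :: "'a::euclidean_space \<Rightarrow> real"
  assumes f: "C1_on UNIV f" and supp: "\<And>x. norm x \<ge> K \<Longrightarrow> f x = 0"
  shows "integrable lborel (\<lambda>x. frechet_derivative f (at x) v)"
    and "(LINT x|lborel. frechet_derivative f (at x) v) = 0"
proof -
  let ?D = "\<lambda>x. frechet_derivative f (at x) v"
  define r where "r = K + norm v"
  have D0: "?D x = 0" if "norm x > K" for x
  proof -
    have "open {x::'a. norm x > K}" by (intro open_Collect_less continuous_intros)
    then have "(f has_derivative (\<lambda>_. 0)) (at x)"
      using that supp by (intro has_derivative_transform_within_open[OF has_derivative_const[of 0]]) auto
    then show ?thesis by (simp add: frechet_derivative_at[symmetric])
  qed
  have contD: "continuous_on UNIV ?D" and contf: "continuous_on UNIV f"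
    using C1_on_continuous_derivative[OF f] C1_on_continuous[OF f] by auto
  have "bounded (?D ` cball 0 K)"
    by (intro compact_imp_bounded compact_continuous_image continuous_on_subset[OF contD]) auto
  then obtain M0 where "\<forall>z\<in>?D ` cball 0 K. norm z \<le> M0" unfolding bounded_iff by blast
  then have M0: "\<bar>?D x\<bar> \<le> M0" if "x \<in> cball 0 K" for x using that by force
  define M where "M = max M0 0"
  have M: "\<bar>?D x\<bar> \<le> M" for x
    using M0[of x] D0[of x] by (cases "norm x > K") (auto simp: M_def)
  have w: "integrable lborel (\<lambda>x::'a. M * indicat_real (cball 0 r) x)"
    by (intro integrable_mult_right integrable_real_indicator) (use emeasure_lborel_cball_finite in auto)
  define g where "g n x = real (Suc n) * (f (x + (1 / real (Suc n)) *\<^sub>R v) - f x)" for n x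
  have mf: "f \<in> borel_measurable lborel" and mD: "?D \<in> borel_measurable lborel"
    using contf contD by (auto intro: borel_measurable_continuous_onI)
  have mft: "(\<lambda>x. f (x + t)) \<in> borel_measurable lborel" for t
    using contf by (auto intro!: borel_measurable_continuous_onI continuous_on_compose2[OF contf] continuous_intros)
  have mg: "g n \<in> borel_measurable lborel" for n
    unfolding g_def using mf mft by measurable
  have bound: "AE x in lborel. norm (g n x) \<le> M * indicat_real (cball 0 r) x" for n
  proof (rule AE_I2)
    fix x :: 'a
    let ?t = "1 / real (Suc n)"
    have t: "0 < ?t" "?t \<le> 1" by auto
    show "norm (g n x) \<le> M * indicat_real (cball 0 r) x"
    proof (cases "x \<in> cball 0 r")
      case True
      from MVT2[OF t(1) C1_on_line_derivative[OF f]] obtain s where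
        "f (x + ?t *\<^sub>R v) - f (x + 0 *\<^sub>R v) = (?t - 0) * ?D (x + s *\<^sub>R v)" by auto
      then have "g n x = ?D (x + s *\<^sub>R v)" by (simp add: g_def)
      then show ?thesis using M True by simp
    next
      case False
      have "norm (?t *\<^sub>R v) \<le> norm v"
        using mult_right_mono[OF t(2) norm_ge_zero[of v]] by simp
      moreover have "norm x > K + norm v" using False by (simp add: r_def)
      ultimately have "norm (x + ?t *\<^sub>R v) \<ge> K" "norm x \<ge> K"
        using norm_diff_ineq[of x "?t *\<^sub>R v"] norm_ge_zero[of v] by linarith+
      then show ?thesis using False supp by (simp add: g_def)
    qed
  qed
  have lim: "AE x in lborel. (\<lambda>n. g n x) \<longlonglongrightarrow> ?D x"
  proof (rule AE_I2)
    fix x :: 'a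
    have "((\<lambda>s. f (x + s *\<^sub>R v)) has_real_derivative ?D x) (at 0)"
      using C1_on_line_derivative[OF f, of x 0 v] by simp
    then have "((\<lambda>h. (f (x + h *\<^sub>R v) - f x) / h) \<longlongrightarrow> ?D x) (at 0)"
      by (simp add: DERIV_def)
    moreover have "filterlim (\<lambda>n. 1 / real (Suc n)) (at 0) sequentially"
      by (rule filterlim_atI[OF lim_inverse_n'[THEN LIMSEQ_Suc]]) auto
    ultimately have "(\<lambda>n. (f (x + (1 / real (Suc n)) *\<^sub>R v) - f x) / (1 / real (Suc n))) \<longlonglongrightarrow> ?D x"
      by (rule filterlim_compose)
    then show "(\<lambda>n. g n x) \<longlonglongrightarrow> ?D x" by (simp add: g_def mult.commute)
  qed
  show "integrable lborel ?D"
    by (rule integrable_dominated_convergence[OF mD mg w lim bound])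
  have intf: "integrable lborel f"
  proof -
    have "bounded (f ` cball 0 K)"
      by (intro compact_imp_bounded compact_continuous_image continuous_on_subset[OF contf]) auto
    then obtain B where "\<forall>z\<in>f ` cball 0 K. norm z \<le> B" unfolding bounded_iff by blast
    then have B: "\<bar>f x\<bar> \<le> B" if "x \<in> cball 0 K" for x using that by force
    have "integrable lborel (\<lambda>x::'a. B * indicat_real (cball 0 K) x)"
      by (intro integrable_mult_right integrable_real_indicator) (use emeasure_lborel_cball_finite in auto)
    then show ?thesis
    proof (rule Bochner_Integration.integrable_bound[OF _ mf], intro AE_I2)
      fix x show "norm (f x) \<le> norm (B * indicat_real (cball 0 K) x)"
        using B[of x] supp[of x] by (cases "norm x \<le> K") auto
    qed
  qed
  have trans: "integrable lborel (\<lambda>x. f (x + t))" "(LINT x|lborel. f (x + t)) = (LINT x|lborel. f x)" for t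
  proof -
    have mt: "(+) t \<in> measurable lborel borel" by simp
    have fb: "f \<in> borel_measurable borel" using mf by simp
    show "integrable lborel (\<lambda>x. f (x + t))"
      using intf integrable_distr_eq[OF mt fb] by (simp add: lborel_distr_plus add.commute)
    show "(LINT x|lborel. f (x + t)) = (LINT x|lborel. f x)"
      using integral_distr[OF mt fb] by (simp add: lborel_distr_plus add.commute)
  qed
  have "(LINT x|lborel. g n x) = 0" for n
    unfolding g_def using trans intf by simp
  moreover have "(\<lambda>n. LINT x|lborel. g n x) \<longlonglongrightarrow> (LINT x|lborel. ?D x)"
    by (rule integral_dominated_convergence[OF mD mg w lim bound])
  ultimately show "(LINT x|lborel. ?D x) = 0"
    using LIMSEQ_unique[OF _ tendsto_const[of 0]] by auto
qed

text \<open>Near \<open>N\<close> this is differentiability, and away from \<open>N\<close> boundedness on the compact sphere.\<close>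

lemma sphere_field_pole_bound:
  fixes V :: "'a::euclidean_space \<Rightarrow> 'a"
  assumes V: "C1_on (-{0}) V" and pole: "V N = 0" and N: "norm N = 1"
  obtains C where "C > 0" "\<And>y. norm y = 1 \<Longrightarrow> norm (V y) \<le> C * norm (y - N)"
proof -
  have "compact (V ` sphere 0 1)"
    by (intro compact_continuous_image continuous_on_subset[OF C1_on_continuous[OF V]]) auto
  then obtain M where "\<forall>z\<in>V ` sphere 0 1. norm z \<le> M" using compact_imp_bounded bounded_iff by blast
  then have M: "norm (V y) \<le> M" if "norm y = 1" for y using that by auto
  define L where "L = frechet_derivative V (at N)"
  have L: "(V has_derivative L) (at N)" unfolding L_def using N by (intro C1_on_has_derivative[OF V]) auto
  then have "\<exists>d>0. \<forall>y. norm (y - N) < d \<longrightarrow> norm (V y - V N - L (y - N)) \<le> 1 * norm (y - N)"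
    unfolding has_derivative_at_alt by (metis zero_less_one)
  then obtain d where d: "d > 0" "\<And>y. norm (y - N) < d \<Longrightarrow> norm (V y - L (y - N)) \<le> norm (y - N)"
    using pole by auto
  have bL: "bounded_linear L" using L by (rule has_derivative_bounded_linear)
  obtain K where K: "\<And>u. norm (L u) \<le> norm u * K" using bounded_linear.bounded[OF bL] by blast
  define C where "C = 1 + \<bar>K\<bar> + \<bar>M\<bar> / d"
  have "norm (V y) \<le> C * norm (y - N)" if y: "norm y = 1" for y
  proof (cases "norm (y - N) < d")
    case True
    have "norm (V y) \<le> norm (V y - L (y - N)) + norm (L (y - N))"
      using norm_triangle_ineq[of "V y - L (y - N)" "L (y - N)"] by simp
    also have "\<dots> \<le> norm (y - N) + norm (y - N) * \<bar>K\<bar>"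
      using d(2)[OF True] K[of "y - N"] mult_left_mono[OF abs_ge_self[of K] norm_ge_zero[of "y - N"]] by linarith
    also have "\<dots> \<le> C * norm (y - N)" using d(1) by (simp add: C_def algebra_simps)
    finally show ?thesis .
  next
    case False
    have "norm (V y) \<le> \<bar>M\<bar>" using M[OF y] by linarith
    also have "\<dots> = \<bar>M\<bar> / d * d" using d(1) by simp
    also have "\<dots> \<le> \<bar>M\<bar> / d * norm (y - N)" using False d(1) by (intro mult_left_mono) auto
    also have "\<dots> \<le> C * norm (y - N)" by (intro mult_right_mono) (auto simp: C_def)
    finally show ?thesis .
  qed
  moreover have "C > 0" using d(1) by (simp add: C_def add_pos_nonneg)
  ultimately show ?thesis using that by blast
qed

lemma continuous_on_divergence: "C1_on U V \<Longrightarrow> continuous_on U (divergence V)"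
  unfolding divergence_def[abs_def] by (intro continuous_intros C1_on_continuous_derivative)

text \<open>Cut off near the missing pole. The gradient of a cutoff function integrates to something bounded away
  from zero when \<open>n = 1\<close>, so the field has to become small there. If it vanishes at the pole \<open>N\<close> then
  its vertical component is even of second order: it equals \<open>V y \<bullet> (N - y)\<close> by tangency, hence is
  bounded by \<open>\<bar>y - N\<bar>\<^sup>2\<close>, a multiple of the conformal factor. This dominates the error by a multiple of
  the area density in every dimension, and dominated convergence applies.\<close>

lemma sphere_divergence_vanishing_at_pole:
  fixes V :: "(real ^ 'n) \<times> real \<Rightarrow> (real ^ 'n) \<times> real"
  assumes V: "C1_on (-{0}) V" and tang: "\<And>x. x \<noteq> 0 \<Longrightarrow> V x \<bullet> x = 0" and pole: "V (0, 1) = 0"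
  shows "(LINT x|lborel. stereo_weight x ^ CARD('n) * divergence V (inv_stereographic x)) = 0"
proof -
  define m where "m = CARD('n) - 1"
  have n: "CARD('n) = Suc m" by (simp add: m_def)
  define u where "u x = snd (V (inv_stereographic x))" for x
  define Z where "Z = stereo_field V"
  let ?w = "stereo_weight :: real^'n \<Rightarrow> real"
  let ?g = "\<lambda>x. ?w x ^ CARD('n) * divergence V (inv_stereographic x)"
  \<comment> \<open>The square of \<open>s\<close> is a continuously differentiable cutoff with compact support that tends to one as \<open>\<delta>\<close> tends to zero; \<open>h\<close> is the divergence of the cut-off field.\<close>
  define s where "s \<delta> x = max 0 (1 - \<delta> * (1 + x \<bullet> x))" for \<delta> and x :: "real^'n"
  define h where "h \<delta> x = (s \<delta> x)\<^sup>2 * ?g x - 4 * \<delta> * s \<delta> x * (?w x ^ m * (u x / ?w x))" for \<delta> x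
  have wpos: "?w x > 0" for x by (rule stereo_weight_pos)
  have contdiv: "continuous_on (sphere 0 1) (divergence V)"
    by (rule continuous_on_subset[OF continuous_on_divergence[OF V]]) auto
  have int_g: "integrable lborel ?g" by (rule integrable_stereo[OF contdiv])
  have ZC1: "C1_on UNIV Z" unfolding Z_def by (rule stereo_field_C1[OF V])
  have xZ: "x \<bullet> Z x = ?w x ^ m * (u x / ?w x)" for x
  proof -
    have "?w x * (x \<bullet> (fst (V (inv_stereographic x)) + snd (V (inv_stereographic x)) *\<^sub>R x)) = u x"
      unfolding u_def by (rule tangent_radial_component) (rule tang[OF inv_stereographic_nonzero])
    then have "x \<bullet> (fst (V (inv_stereographic x)) + snd (V (inv_stereographic x)) *\<^sub>R x) = u x / ?w x"
      using wpos[of x] by (simp add: field_simps)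
    then show ?thesis by (simp only: Z_def stereo_field_def m_def inner_scaleR_right)
  qed
  have h_int: "integrable lborel (h \<delta>) \<and> (LINT x|lborel. h \<delta> x) = 0" if \<delta>: "\<delta> > 0" for \<delta>
  proof -
    have dpoly: "((\<lambda>x::real^'n. 1 - \<delta> * (1 + x \<bullet> x)) has_derivative (\<lambda>v. - (\<delta> * (2 * (x \<bullet> v))))) (at x)" for x
      by (auto intro!: derivative_eq_intros simp: inner_commute)
    have ds: "((\<lambda>x. (s \<delta> x)\<^sup>2) has_derivative (\<lambda>v. (2 * s \<delta> x) * (- (\<delta> * (2 * (x \<bullet> v)))))) (at x)" for x
      unfolding s_def
      by (rule has_derivative_compose[OF dpoly positive_part_square_has_derivative[unfolded has_field_derivative_def]])
    have s_cont: "continuous_on UNIV (s \<delta>)" unfolding s_def[abs_def] by (intro continuous_intros)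
    have s_C1: "C1_on UNIV (\<lambda>x. (s \<delta> x)\<^sup>2)"
      by (rule C1_onI[OF _ ds]) (auto intro!: continuous_intros s_cont)
    define f where "f i x = (s \<delta> x)\<^sup>2 * (Z x \<bullet> i)" for i x
    have fC1: "C1_on UNIV (f i)" for i
      unfolding f_def[abs_def] by (intro C1_on_mult s_C1 C1_on_inner ZC1 C1_on_const) auto
    have supp: "f i x = 0" if x: "norm x \<ge> 1 + 1 / \<delta>" for i x
    proof -
      have "1 / \<delta> \<le> norm x" "1 \<le> norm x" using x \<delta> by (auto intro: order_trans[rotated])
      then have "1 / \<delta> \<le> norm x * norm x" using mult_mono[of 1 "norm x" "1 / \<delta>" "norm x"] \<delta> by simp
      then have "1 \<le> \<delta> * (x \<bullet> x)" using \<delta> by (simp add: dot_square_norm power2_eq_square field_simps)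
      then have "s \<delta> x = 0" using \<delta> by (simp add: s_def algebra_simps)
      then show ?thesis by (simp add: f_def)
    qed
    have df: "frechet_derivative (f i) (at x) i =
        (s \<delta> x)\<^sup>2 * (frechet_derivative Z (at x) i \<bullet> i) - 4 * \<delta> * s \<delta> x * ((x \<bullet> i) * (Z x \<bullet> i))" for i x
    proof -
      have "(Z has_derivative frechet_derivative Z (at x)) (at x)" by (rule C1_on_has_derivative[OF ZC1]) auto
      then have "((\<lambda>x. Z x \<bullet> i) has_derivative (\<lambda>v. frechet_derivative Z (at x) v \<bullet> i)) (at x)"
        by (rule has_derivative_inner_left)
      from frechet_derivative_at[OF has_derivative_mult[OF ds this], THEN fun_cong, symmetric, of i]
      show ?thesis by (simp add: f_def[abs_def])
    qed
    have h: "h \<delta> x = (\<Sum>i\<in>Basis. frechet_derivative (f i) (at x) i)" for x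
    proof -
      have "(\<Sum>i\<in>Basis. frechet_derivative (f i) (at x) i) =
          (s \<delta> x)\<^sup>2 * divergence Z x - 4 * \<delta> * s \<delta> x * (x \<bullet> Z x)"
        unfolding df divergence_def sum_subtractf sum_distrib_left[symmetric]
        by (simp only: euclidean_inner[of x "Z x"])
      then show ?thesis
        unfolding h_def xZ by (simp add: Z_def divergence_stereo_field[OF V tang])
    qed
    have "integrable lborel (\<lambda>x. frechet_derivative (f i) (at x) i)"
      "(LINT x|lborel. frechet_derivative (f i) (at x) i) = 0" for i
      using integral_derivative_compact_support[OF fC1, of "1 + 1 / \<delta>"] supp by blast+
    then show ?thesis unfolding h by simp
  qed
  obtain C where C: "C > 0" "\<And>y. norm y = 1 \<Longrightarrow> norm (V y) \<le> C * norm (y - (0, 1))"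
    using sphere_field_pole_bound[OF V pole] by (auto simp: norm_Pair)
  have u_bound: "\<bar>u x\<bar> \<le> 2 * C * ?w x" for x
  proof -
    let ?y = "inv_stereographic x"
    have "u x = V ?y \<bullet> ((0, 1) - ?y)"
      using tang[OF inv_stereographic_nonzero, of x] by (cases "V ?y") (simp add: u_def inner_diff_right)
    then have "\<bar>u x\<bar> \<le> norm (V ?y) * norm ((0, 1) - ?y)" by (simp add: Cauchy_Schwarz_ineq2)
    also have "\<dots> \<le> (C * norm (?y - (0, 1))) * norm (?y - (0, 1))"
      using C(2)[OF norm_inv_stereographic] by (intro mult_mono) (auto simp: norm_minus_commute C(1) less_imp_le)
    also have "\<dots> = C * (norm (?y - (0, 1)))\<^sup>2" by (simp add: power2_eq_square)
    finally show ?thesis unfolding inv_stereographic_pole_distance by simp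
  qed
  have "compact (divergence V ` sphere 0 1)" by (intro compact_continuous_image contdiv) auto
  then obtain M where "\<forall>z\<in>divergence V ` sphere 0 1. norm z \<le> M" using compact_imp_bounded bounded_iff by blast
  then have M: "\<bar>divergence V (inv_stereographic x)\<bar> \<le> M" for x
    using norm_inv_stereographic[of x] by force
  have s01: "0 \<le> s \<delta> x" "s \<delta> x \<le> 1" if "\<delta> > 0" for \<delta> x using that by (auto simp: s_def)
  have ds: "\<delta> * s \<delta> x \<le> ?w x / 2" if \<delta>: "\<delta> > 0" for \<delta> x
  proof (cases "1 - \<delta> * (1 + x \<bullet> x) > 0")
    case True
    have t: "1 + x \<bullet> x > 0" by (simp add: add_pos_nonneg)
    have "\<delta> * s \<delta> x \<le> \<delta> * 1" using s01[OF \<delta>] \<delta> by (intro mult_left_mono) auto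
    also have "\<dots> \<le> 1 / (1 + x \<bullet> x)" using True t by (simp add: field_simps)
    also have "\<dots> = ?w x / 2"
    proof -
      have "1 / t = 2 / t / 2" for t :: real by simp
      then show ?thesis unfolding stereo_weight_def dot_square_norm by blast
    qed
    finally show ?thesis .
  next
    case False
    then have "s \<delta> x = 0" by (simp add: s_def)
    then show ?thesis using wpos[of x] by simp
  qed
  have bound: "\<bar>h \<delta> x\<bar> \<le> (M + 4 * C) * ?w x ^ CARD('n)" if \<delta>: "\<delta> > 0" for \<delta> x
  proof -
    have "\<bar>(s \<delta> x)\<^sup>2 * ?g x\<bar> \<le> 1 * (?w x ^ CARD('n) * M)"
      unfolding abs_mult using s01[OF \<delta>, of x] M[of x] wpos[of x] abs_ge_zero order_trans
      by (intro mult_mono) (auto simp: power_le_one)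
    moreover have "\<bar>4 * \<delta> * s \<delta> x * (?w x ^ m * (u x / ?w x))\<bar> \<le> 4 * C * ?w x ^ CARD('n)"
    proof -
      have "\<bar>u x / ?w x\<bar> \<le> 2 * C" using u_bound[of x] wpos[of x] by (simp add: abs_divide field_simps)
      then have le: "4 * (\<delta> * s \<delta> x) * (?w x ^ m * \<bar>u x / ?w x\<bar>) \<le> 4 * (?w x / 2) * (?w x ^ m * (2 * C))"
        using ds[OF \<delta>, of x] s01[OF \<delta>, of x] \<delta> wpos[of x] by (intro mult_mono) auto
      have eq: "\<bar>4 * \<delta> * s \<delta> x * (?w x ^ m * (u x / ?w x))\<bar> = 4 * (\<delta> * s \<delta> x) * (?w x ^ m * \<bar>u x / ?w x\<bar>)"
        using s01[OF \<delta>, of x] \<delta> wpos[of x] by (simp add: abs_mult)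
      have "4 * (?w x / 2) * (?w x ^ m * (2 * C)) = 4 * C * ?w x ^ CARD('n)" by (simp add: n)
      with le show ?thesis unfolding eq by linarith
    qed
    ultimately have "\<bar>h \<delta> x\<bar> \<le> 1 * (?w x ^ CARD('n) * M) + 4 * C * ?w x ^ CARD('n)"
      unfolding h_def by (intro order_trans[OF abs_triangle_ineq4] add_mono)
    then show ?thesis by (simp add: algebra_simps)
  qed
  define d where "d k = 1 / real (Suc k)" for k
  have d: "d k > 0" for k by (simp add: d_def)
  have d0: "d \<longlonglongrightarrow> 0" unfolding d_def[abs_def] by (rule lim_inverse_n'[THEN LIMSEQ_Suc])
  have lim: "(\<lambda>k. h (d k) x) \<longlonglongrightarrow> ?g x" for x
  proof -
    have "(\<lambda>k. s (d k) x) \<longlonglongrightarrow> max 0 (1 - 0 * (1 + x \<bullet> x))"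
      unfolding s_def by (intro tendsto_intros d0)
    then have s1: "(\<lambda>k. s (d k) x) \<longlonglongrightarrow> 1" by simp
    have "(\<lambda>k. h (d k) x) \<longlonglongrightarrow> 1\<^sup>2 * ?g x - 4 * 0 * 1 * (?w x ^ m * (u x / ?w x))"
      unfolding h_def by (intro tendsto_intros d0 s1)
    then show ?thesis by simp
  qed
  have "(\<lambda>k. LINT x|lborel. h (d k) x) \<longlonglongrightarrow> (LINT x|lborel. ?g x)"
  proof (rule integral_dominated_convergence)
    show "?g \<in> borel_measurable lborel" using int_g by blast
    show "h (d k) \<in> borel_measurable lborel" for k using h_int[OF d] by blast
    show "integrable lborel (\<lambda>x. (M + 4 * C) * ?w x ^ CARD('n))"
      using integrable_stereo_weight[where 'a = "real^'n"] by (intro integrable_mult_right) simp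
  qed (use lim bound[OF d] in auto)
  then show ?thesis using h_int[OF d] LIMSEQ_unique[OF _ tendsto_const[of 0]] by auto
qed

text \<open>Subtracting an infinitesimal rotation with the same value at the missing pole reduces the claim to
  fields that vanish there; a rotation field is skew-symmetric, so its divergence is zero everywhere.\<close>

theorem sphere_divergence_theorem:
  fixes V :: "(real ^ 'n) \<times> real \<Rightarrow> (real ^ 'n) \<times> real"
  assumes V: "C1_on (-{0}) V" and tang: "\<And>x. x \<noteq> 0 \<Longrightarrow> V x \<bullet> x = 0"
  shows "(LINT x|lborel. stereo_weight x ^ CARD('n) * divergence V (inv_stereographic x)) = 0"
proof -
  define N :: "(real ^ 'n) \<times> real" where "N = (0, 1)"
  have N: "N \<bullet> N = 1" "N \<noteq> 0" by (auto simp: N_def zero_prod_def)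
  \<comment> \<open>The infinitesimal rotation in the plane of \<open>N\<close> and \<open>V N\<close>; tangency of \<open>V\<close> at \<open>N\<close> gives \<open>A N = V N\<close>.\<close>
  define A where "A x = (x \<bullet> N) *\<^sub>R V N - (x \<bullet> V N) *\<^sub>R N" for x
  have linA: "linear A" by (rule linearI) (simp_all add: A_def inner_add_left algebra_simps)
  have bA: "bounded_linear A" using linA by (simp add: linear_conv_bounded_linear)
  have trA: "(\<Sum>b\<in>Basis. A b \<bullet> b) = 0"
    by (simp add: A_def inner_diff_left sum_subtractf inner_commute[of N] inner_commute[of "V N"] mult.commute)
  define U where "U x = V x + - 1 *\<^sub>R A x" for x
  have U: "C1_on (-{0}) U" unfolding U_def[abs_def]
    by (intro C1_on_add V C1_on_scaleR C1_on_const C1_on_bounded_linear[OF bA]) auto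
  have "(LINT x|lborel. stereo_weight x ^ CARD('n) * divergence U (inv_stereographic x)) = 0"
  proof (rule sphere_divergence_vanishing_at_pole[OF U])
    show "U x \<bullet> x = 0" if "x \<noteq> 0" for x
      using tang[OF that] by (simp add: U_def A_def inner_diff_right inner_add_right inner_commute[of _ x] mult.commute)
    show "U (0, 1) = 0"
      using N tang[OF N(2)] unfolding N_def[symmetric] by (simp add: U_def A_def inner_commute)
  qed
  moreover have "divergence U (inv_stereographic x) = divergence V (inv_stereographic x)" for x
  proof -
    let ?y = "inv_stereographic x"
    have "(V has_derivative frechet_derivative V (at ?y)) (at ?y)"
      by (rule C1_on_has_derivative[OF V]) (simp add: inv_stereographic_nonzero)
    then have "(U has_derivative (\<lambda>v. frechet_derivative V (at ?y) v + - 1 *\<^sub>R A v)) (at ?y)"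
      unfolding U_def[abs_def] by (intro has_derivative_add has_derivative_scaleR_right
          bounded_linear_imp_has_derivative bA)
    then have "frechet_derivative U (at ?y) = (\<lambda>v. frechet_derivative V (at ?y) v + - 1 *\<^sub>R A v)"
      by (rule frechet_derivative_at[symmetric])
    then show ?thesis using trA by (simp add: divergence_def inner_diff_left sum_subtractf)
  qed
  ultimately show ?thesis by simp
qed

section \<open>Area\<close>

text \<open>A rotation that takes a coordinate axis to the direction of \<open>q\<close> makes the matrix diagonal.\<close>

lemma det_scalar_plus_rank_one:
  fixes q :: "real ^ 'n"
  assumes t: "t > 0"
  shows "det (\<chi> i j. (if i = j then t else 0) + q $ i * q $ j) = t ^ CARD('n) * (1 + (q \<bullet> q) / t)"
proof -
  define M where "M u = (\<chi> i j. (if i = j then t else 0) + u $ i * u $ j)" for u :: "real ^ 'n"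
  obtain k :: 'n where True by simp
  define e :: "real ^ 'n" where "e = norm q *\<^sub>R axis k 1"
  have "norm e = norm q" by (simp add: e_def)
  then obtain f where f: "orthogonal_transformation f" "f e = q"
    using orthogonal_transformation_exists[of e q] by blast
  define A where "A = matrix f"
  have A: "orthogonal_matrix A" using f(1) by (simp add: A_def orthogonal_transformation_matrix)
  have lf: "linear f" using f(1) by (rule orthogonal_transformation_linear)
  have Ae: "A *v e = q" unfolding A_def using f(2) by (simp add: matrix_works lf)
  have AA: "A ** transpose A = mat 1" using A by (simp add: orthogonal_matrix_def)
  have Aq: "(\<Sum>h\<in>UNIV. A $ i $ h * e $ h) = q $ i" for i
    using Ae by (simp add: matrix_vector_mult_def vec_eq_iff)
  have "M q = A ** M e ** transpose A"
  proof -
    have "(A ** M e ** transpose A) $ i $ j = M q $ i $ j" for i j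
    proof -
      have expand: "(\<Sum>l\<in>UNIV. (A $ i $ l * t + B * e $ l) * A $ j $ l) =
          t * (\<Sum>l\<in>UNIV. A $ i $ l * A $ j $ l) + B * (\<Sum>l\<in>UNIV. A $ j $ l * e $ l)" for B
        by (simp add: algebra_simps sum.distrib sum_distrib_left)
      have "(A ** M e ** transpose A) $ i $ j = (\<Sum>l\<in>UNIV. (\<Sum>h\<in>UNIV. A $ i $ h * ((if h = l then t else 0) + e $ h * e $ l)) * A $ j $ l)"
        by (simp add: matrix_matrix_mult_def transpose_def M_def)
      also have "\<dots> = (\<Sum>l\<in>UNIV. (A $ i $ l * t + (\<Sum>h\<in>UNIV. A $ i $ h * e $ h) * e $ l) * A $ j $ l)"
        by (intro sum.cong refl arg_cong2[where f = "(*)"])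
          (simp add: distrib_left sum.distrib if_distrib[of "\<lambda>x. _ * x"] sum_distrib_right mult.assoc cong: if_cong)
      also have "\<dots> = t * (\<Sum>l\<in>UNIV. A $ i $ l * A $ j $ l) + (\<Sum>h\<in>UNIV. A $ i $ h * e $ h) * (\<Sum>l\<in>UNIV. A $ j $ l * e $ l)"
        by (rule expand)
      also have "(\<Sum>l\<in>UNIV. A $ i $ l * A $ j $ l) = (A ** transpose A) $ i $ j"
        by (simp add: matrix_matrix_mult_def transpose_def)
      finally show ?thesis by (simp add: AA mat_def M_def Aq)
    qed
    then show ?thesis by (simp add: vec_eq_iff)
  qed
  then have "det (M q) = det A * det A * det (M e)" by (simp add: det_mul)
  also have "det A * det A = 1" using det_orthogonal_matrix[OF A] by auto
  also have "det (M e) = (\<Prod>i\<in>UNIV. M e $ i $ i)"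
    by (rule det_diagonal) (auto simp: M_def e_def axis_def)
  also have "\<dots> = (\<Prod>i\<in>UNIV. if i = k then t + q \<bullet> q else t)"
    by (intro prod.cong refl) (simp add: M_def e_def axis_def dot_square_norm power2_eq_square)
  also have "\<dots> = (t + q \<bullet> q) * t ^ (CARD('n) - 1)"
    by (subst prod.remove[of _ k]) (auto simp: card_Diff_singleton)
  also have "\<dots> = t ^ CARD('n) * (1 + (q \<bullet> q) / t)"
  proof -
    have "t ^ CARD('n) = t * t ^ (CARD('n) - 1)" by (rule power_eq_if[THEN trans]) simp
    then show ?thesis using t by (simp add: field_simps)
  qed
  finally show ?thesis by (simp add: M_def)
qed

lemma stereo_frame_isometry: "stereo_frame x u \<bullet> stereo_frame x v = u \<bullet> v"
proof -
  let ?w = "stereo_weight x"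
  have "stereo_frame x u \<bullet> stereo_frame x v = u \<bullet> v + ?w * (x \<bullet> u) * (x \<bullet> v) * (?w * (x \<bullet> x) + ?w - 2)"
    by (simp add: stereo_frame_def inner_diff_left inner_diff_right inner_commute[of u x] algebra_simps)
  then show ?thesis unfolding stereo_weight_norm by simp
qed

lemma stereo_frame_tangent: "stereo_frame x v \<bullet> inv_stereographic x = 0"
proof -
  let ?w = "stereo_weight x"
  have "stereo_frame x v \<bullet> inv_stereographic x = ?w * (x \<bullet> v) * (2 - ?w - ?w * (x \<bullet> x))"
    by (simp add: stereo_frame_def inv_stereographic_eq inner_diff_left inner_commute[of v x] algebra_simps)
  then show ?thesis unfolding stereo_weight_norm by simp
qed

lemma unit_sphere_area_eq:
  "unit_sphere_area TYPE('n::finite) = (LINT x|lborel. stereo_weight (x :: real ^ 'n) ^ CARD('n))"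
proof -
  have "sqrt (det (\<chi> i j. frechet_derivative inv_stereographic (at x) (axis i 1)
      \<bullet> frechet_derivative inv_stereographic (at x) (axis j 1))) = stereo_weight x ^ CARD('n)"
    for x :: "real ^ 'n"
  proof -
    let ?w = "stereo_weight x"
    have fd: "frechet_derivative inv_stereographic (at x) = (\<lambda>v. ?w *\<^sub>R stereo_frame x v)"
      by (rule frechet_derivative_at[OF inv_stereographic_has_derivative, symmetric])
    have "(\<chi> i j. frechet_derivative inv_stereographic (at x) (axis i 1)
      \<bullet> frechet_derivative inv_stereographic (at x) (axis j 1)) =
      (\<chi> i j. (if i = j then ?w\<^sup>2 else 0) + (0 :: real ^ 'n) $ i * (0 :: real ^ 'n) $ j)"
      by (simp add: fd stereo_frame_isometry vec_eq_iff inner_axis_axis power2_eq_square)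
    then have "det (\<chi> i j. frechet_derivative inv_stereographic (at x) (axis i 1)
      \<bullet> frechet_derivative inv_stereographic (at x) (axis j 1)) = (?w\<^sup>2) ^ CARD('n)"
      using stereo_weight_pos[of x] by (simp only: det_scalar_plus_rank_one zero_less_power) simp
    also have "\<dots> = (?w ^ CARD('n))\<^sup>2" by (simp add: mult.commute flip: power_mult)
    finally show ?thesis using stereo_weight_pos[of x] by simp
  qed
  then show ?thesis by (simp add: unit_sphere_area_def area_def Let_def)
qed

text \<open>In the frame of the stereographic coordinates the induced metric is a multiple of the identity plus
  the rank-one term of \<open>dr\<^sup>2\<close>.\<close>

lemma area_radial_graph:
  fixes r :: "(real ^ 'n) \<times> real \<Rightarrow> real"
  assumes "star_shaped_graph a b lam lam' r"
  defines "R \<equiv> star_shaped_graph.R r" and "p \<equiv> star_shaped_graph.p lam r"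
  shows "area (warped_metric lam) (radial_graph r) = (LINT x|lborel. stereo_weight x ^ CARD('n) *
    (lam (R (inv_stereographic x)) ^ CARD('n) * sqrt (1 + p (inv_stereographic x) \<bullet> p (inv_stereographic x))))"
proof -
  interpret star_shaped_graph a b lam lam' r by fact
  have R_eq: "R = star_shaped_graph.R r" and p_eq: "p = star_shaped_graph.p lam r" by (simp_all add: assms)
  define q where "q = star_shaped_graph.q r"
  have "(let \<psi> = (\<lambda>z. radial_graph r (inv_stereographic z));
          d\<psi> = (\<lambda>i. frechet_derivative \<psi> (at x) (axis i 1))
      in sqrt (det (\<chi> i j. warped_metric lam (\<psi> x) (d\<psi> i) (d\<psi> j)))) =
    stereo_weight x ^ CARD('n) *
    (lam (R (inv_stereographic x)) ^ CARD('n) * sqrt (1 + p (inv_stereographic x) \<bullet> p (inv_stereographic x)))"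
    for x :: "real ^ 'n"
  proof -
    let ?w = "stereo_weight x" and ?T = "stereo_frame x"
    define y where "y = inv_stereographic x"
    have y1: "norm y = 1" unfolding y_def by (rule norm_inv_stereographic)
    then have y0: "y \<noteq> 0" by auto
    let ?l = "lam (R y)" and ?\<rho> = "exp (R y)"
    have l: "?l > 0" using lamR_pos[OF y0] by (simp add: R_eq)
    have w: "?w > 0" by (rule stereo_weight_pos)
    have Ty: "?T v \<bullet> y = 0" for v unfolding y_def by (rule stereo_frame_tangent)
    define dF where "dF v = ?\<rho> *\<^sub>R ((q y \<bullet> (?w *\<^sub>R ?T v)) *\<^sub>R y + ?w *\<^sub>R ?T v)" for v
    have "((\<lambda>x. exp (R x) *\<^sub>R x) has_derivative (\<lambda>u. ?\<rho> *\<^sub>R u + (?\<rho> * (q y \<bullet> u)) *\<^sub>R y)) (at y)"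
      unfolding R_eq q_def by (rule derivative_eq_intros R_has[OF y0] refl)+ (simp add: mult.commute)
    from has_derivative_compose[OF inv_stereographic_has_derivative this[unfolded y_def]]
    have "((\<lambda>z. exp (R (inv_stereographic z)) *\<^sub>R inv_stereographic z) has_derivative dF) (at x)"
      by (rule has_derivative_eq_rhs) (simp add: fun_eq_iff dF_def y_def algebra_simps)
    moreover have \<psi>: "radial_graph r (inv_stereographic z) = exp (R (inv_stereographic z)) *\<^sub>R inv_stereographic z" for z
      by (simp add: radial_graph_def R_eq R_sphere norm_inv_stereographic)
    ultimately have fd: "frechet_derivative (\<lambda>z. radial_graph r (inv_stereographic z)) (at x) = dF"
      by (simp add: frechet_derivative_at[symmetric])
    define Q where "Q = ?w *\<^sub>R stereo_coframe x (q y)"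
    have qT: "q y \<bullet> (?w *\<^sub>R ?T (axis i 1)) = Q $ i" for i
      by (simp add: Q_def inner_stereo_frame inner_axis)
    have "warped_metric lam (radial_graph r (inv_stereographic x)) (dF (axis i 1)) (dF (axis j 1)) =
        (if i = j then (?l * ?w)\<^sup>2 else 0) + Q $ i * Q $ j" for i j
    proof -
      have T: "(?w *\<^sub>R ?T v) \<bullet> y = 0" for v using Ty by simp
      have F: "radial_graph r (inv_stereographic x) = ?\<rho> *\<^sub>R y" unfolding y_def by (rule \<psi>)
      show ?thesis
        unfolding F dF_def
        unfolding warped_metric_tangent_split[OF y1 exp_gt_zero T T] qT
        by (simp add: stereo_frame_isometry inner_axis_axis power2_eq_square)
    qed
    then have "det (\<chi> i j. warped_metric lam (radial_graph r (inv_stereographic x)) (dF (axis i 1)) (dF (axis j 1)))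
        = ((?l * ?w)\<^sup>2) ^ CARD('n) * (1 + (Q \<bullet> Q) / (?l * ?w)\<^sup>2)"
      using l w by (simp add: det_scalar_plus_rank_one)
    also have "(Q \<bullet> Q) / (?l * ?w)\<^sup>2 = p y \<bullet> p y"
    proof -
      have "Q \<bullet> Q = ?w\<^sup>2 * (stereo_coframe x (q y) \<bullet> stereo_coframe x (q y))"
        by (simp add: Q_def power2_eq_square)
      also have "stereo_coframe x (q y) \<bullet> stereo_coframe x (q y) = q y \<bullet> q y"
        using q_tangent[OF y0] by (simp add: inner_stereo_frame[symmetric] stereo_frame_coframe y_def[symmetric] q_def)
      also have "q y \<bullet> q y = ?l\<^sup>2 * (p y \<bullet> p y)"
        using q_eq[OF y0] by (simp add: q_def p_eq R_eq power2_eq_square)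
      finally show ?thesis using l w by (simp add: power_mult_distrib)
    qed
    also have "((?l * ?w)\<^sup>2) ^ CARD('n) = ((?l * ?w) ^ CARD('n))\<^sup>2"
      by (simp add: mult.commute flip: power_mult)
    finally have "sqrt (det (\<chi> i j. warped_metric lam (radial_graph r (inv_stereographic x)) (dF (axis i 1)) (dF (axis j 1))))
        = (?l * ?w) ^ CARD('n) * sqrt (1 + p y \<bullet> p y)"
      using l w by (simp add: real_sqrt_mult)
    then show ?thesis
      unfolding Let_def fd y_def[symmetric] by (simp add: power_mult_distrib mult_ac)
  qed
  then show ?thesis by (simp add: area_def)
qed

section \<open>The area estimate\<close>

lemma smooth_map_on_interval_derivatives:
  fixes lam :: "real \<Rightarrow> real"
  assumes sm: "smooth_map_on {a<..<b} lam" and s: "s \<in> {a<..<b}"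
  shows "(lam has_real_derivative deriv lam s) (at s)"
    and "(deriv lam has_real_derivative deriv (deriv lam) s) (at s)"
proof -
  obtain U h where U: "s \<in> U" "smooth_open U h" "\<forall>z\<in>U \<inter> {a<..<b}. h z = lam z"
    using sm s unfolding smooth_map_on_def by blast
  define V where "V = U \<inter> {a<..<b}"
  have V: "open V" "s \<in> V" using U s by (auto simp: V_def smooth_open_def)
  have h: "(h has_real_derivative frechet_derivative h (at z) 1) (at z)" if "z \<in> V" for z
    using C1_on_line_derivative[OF smooth_open_C1(1)[OF U(2)], of 0 z 1] that by (simp add: V_def)
  have lam: "(lam has_real_derivative frechet_derivative h (at z) 1) (at z)" if "z \<in> V" for z
    by (rule has_field_derivative_transform_within_open[OF h[OF that] V(1) that]) (use U(3) in \<open>auto simp: V_def\<close>)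
  then have d: "deriv lam z = frechet_derivative h (at z) 1" if "z \<in> V" for z using that DERIV_imp_deriv by blast
  show "(lam has_real_derivative deriv lam s) (at s)" using lam[OF V(2)] d[OF V(2)] by simp
  obtain D where "((\<lambda>z. frechet_derivative h (at z) 1) has_real_derivative D) (at s)"
    using C1_on_line_derivative[OF smooth_open_C1(2)[OF U(2)], of 0 s 1 1] U(1) by auto
  then have "(deriv lam has_real_derivative D) (at s)"
    by (rule has_field_derivative_transform_within_open[OF _ V]) (simp add: d)
  then show "(deriv lam has_real_derivative deriv (deriv lam) s) (at s)" using DERIV_imp_deriv by blast
qed

text \<open>Compare derivatives in the upper limit: \<open>(lam\<^sup>m\<^sup>+\<^sup>1)' = (m + 1) lam\<^sup>m lam'\<close>, and \<open>lam'\<close> is at least its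
  value at \<open>s\<close>.\<close>

lemma convex_power_integral_bound:
  fixes lam lam' \<Gamma> :: "real \<Rightarrow> real"
  assumes deriv: "\<And>\<tau>. s \<le> \<tau> \<Longrightarrow> \<tau> \<le> S \<Longrightarrow> (lam has_real_derivative lam' \<tau>) (at \<tau>)"
    and \<Gamma>: "\<And>\<tau>. s \<le> \<tau> \<Longrightarrow> \<tau> \<le> S \<Longrightarrow> (\<Gamma> has_real_derivative lam \<tau> ^ m) (at \<tau>)"
    and nonneg: "\<And>\<tau>. s \<le> \<tau> \<Longrightarrow> \<tau> \<le> S \<Longrightarrow> lam \<tau> \<ge> 0"
    and mono: "\<And>\<tau>. s \<le> \<tau> \<Longrightarrow> \<tau> \<le> S \<Longrightarrow> lam' s \<le> lam' \<tau>"
    and sS: "s \<le> S"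
  shows "real (Suc m) * lam' s * (\<Gamma> S - \<Gamma> s) \<le> lam S ^ Suc m - lam s ^ Suc m" and "\<Gamma> s \<le> \<Gamma> S"
proof -
  have "lam s ^ Suc m - real (Suc m) * lam' s * \<Gamma> s \<le> lam S ^ Suc m - real (Suc m) * lam' s * \<Gamma> S"
  proof (rule DERIV_nonneg_imp_nondecreasing[OF sS])
    fix \<tau> assume \<tau>: "s \<le> \<tau>" "\<tau> \<le> S"
    have "((\<lambda>\<tau>. lam \<tau> ^ Suc m - real (Suc m) * lam' s * \<Gamma> \<tau>) has_real_derivative
        real (Suc m) * lam \<tau> ^ m * (lam' \<tau> - lam' s)) (at \<tau>)"
      by (rule derivative_eq_intros deriv[OF \<tau>] \<Gamma>[OF \<tau>] refl)+ (simp add: algebra_simps)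
    moreover have "real (Suc m) * lam \<tau> ^ m * (lam' \<tau> - lam' s) \<ge> 0"
      using nonneg[OF \<tau>] mono[OF \<tau>] by simp
    ultimately show "\<exists>y. ((\<lambda>\<tau>. lam \<tau> ^ Suc m - real (Suc m) * lam' s * \<Gamma> \<tau>) has_real_derivative y) (at \<tau>) \<and> 0 \<le> y"
      by blast
  qed
  then show "real (Suc m) * lam' s * (\<Gamma> S - \<Gamma> s) \<le> lam S ^ Suc m - lam s ^ Suc m"
    by (simp only: right_diff_distrib)
  show "\<Gamma> s \<le> \<Gamma> S"
    by (rule DERIV_nonneg_imp_nondecreasing[OF sS]) (use \<Gamma> nonneg in \<open>blast intro: zero_le_power\<close>)
qed

theorem corollary1p9:
  fixes a b :: real and lam :: "real \<Rightarrow> real" and r :: "(real ^ 'n) \<times> real \<Rightarrow> real"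
  assumes lam_smooth: "smooth_map_on {a<..<b} lam"
    and lam_pos: "\<And>s. s \<in> {a<..<b} \<Longrightarrow> lam s > 0"
    and lam'_pos: "\<And>s. s \<in> {a<..<b} \<Longrightarrow> deriv lam s > 0"
    and lam''_nonneg: "\<And>s. s \<in> {a<..<b} \<Longrightarrow> deriv (deriv lam) s \<ge> 0"
    and r_smooth: "smooth_map_on (sphere 0 1) r"
    and r_range: "\<And>y. y \<in> sphere 0 1 \<Longrightarrow> r y \<in> {a<..<b}"
    and mean_convex:
      "\<And>y. y \<in> sphere 0 1 \<Longrightarrow> mean_curvature (warped_metric lam) (radial_graph r) y > 0"
  shows "area (warped_metric lam) (radial_graph r)
           \<le> unit_sphere_area TYPE('n) * lam (SUP y\<in>sphere 0 1. r y) ^ CARD('n)"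
proof -
  define lam' where "lam' = deriv lam"
  note lam_derivs = smooth_map_on_interval_derivatives[OF lam_smooth, folded lam'_def]
  have lam'_cont: "continuous_on {a<..<b} lam'"
    by (intro continuous_at_imp_continuous_on ballI DERIV_isCont[OF lam_derivs(2)])
  have sg: "star_shaped_graph a b lam lam' r"
    by unfold_locales (use lam_derivs(1) lam'_cont lam_pos r_smooth r_range in auto)
  interpret star_shaped_graph a b lam lam' r by (rule sg)
  define m where "m = CARD('n) - 1"
  have n: "CARD('n) = Suc m" by (simp add: m_def)
  have r_cont: "continuous_on (sphere 0 1) r"
    by (rule continuous_on_eq[OF continuous_on_subset[OF C1_on_continuous[OF R_C1]]]) (auto simp: R_sphere)
  have ne: "sphere (0 :: (real^'n) \<times> real) 1 \<noteq> {}"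
    using norm_inv_stereographic[of "0 :: real^'n"] by (metis dist_0_norm empty_iff mem_sphere)
  obtain y1 where y1: "y1 \<in> sphere 0 1" "\<And>y. y \<in> sphere 0 1 \<Longrightarrow> r y \<le> r y1"
    using continuous_attains_sup[OF _ ne r_cont] by auto
  obtain y2 where y2: "y2 \<in> sphere 0 1" "\<And>y. y \<in> sphere 0 1 \<Longrightarrow> r y2 \<le> r y"
    using continuous_attains_inf[OF _ ne r_cont] by auto
  define S where "S = r y1"
  have S: "(SUP y\<in>sphere 0 1. r y) = S"
    unfolding S_def by (rule cSup_eq_maximum) (use y1 in auto)
  have R_le: "R y \<in> {r y2..S}" if "y \<noteq> 0" for y
    using y1(2)[of "y /\<^sub>R norm y"] y2(2)[of "y /\<^sub>R norm y"] that by (simp add: R_def ray_ext_def S_def)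
  \<comment> \<open>The primitive of \<open>lam\<^sup>m\<close> must be differentiable on an open interval that contains all values of \<open>r\<close>, including the extreme ones.\<close>
  obtain a' where a': "a < a'" "a' < r y2" using r_range[OF y2(1)] dense by auto
  obtain b' where b': "S < b'" "b' < b" using r_range[OF y1(1)] dense unfolding S_def by auto
  have sub: "{a'..b'} \<subseteq> {a<..<b}" using a' b' by auto
  have lam_m_cont: "continuous_on {a'..b'} (\<lambda>s. lam s ^ m)"
    by (intro continuous_intros continuous_on_subset[OF C1_on_continuous[OF lam_C1] sub])
  obtain \<Gamma> where \<Gamma>_within: "\<And>s. s \<in> {a'..b'} \<Longrightarrow> (\<Gamma> has_vector_derivative lam s ^ m) (at s within {a'..b'})"
    using antiderivative_continuous[OF lam_m_cont] by blast
  have \<Gamma>: "(\<Gamma> has_real_derivative lam s ^ m) (at s)" if "s \<in> {a'<..<b'}" for s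
  proof -
    have "at s within {a'..b'} = at s" by (rule at_within_Icc_at) (use that in auto)
    with \<Gamma>_within[of s] that show ?thesis
      by (simp add: has_real_derivative_iff_has_vector_derivative)
  qed
  have \<Gamma>_C1: "C1_on {a'<..<b'} \<Gamma>"
    by (rule C1_on_real[OF _ \<Gamma>]) (auto intro: continuous_on_subset[OF lam_m_cont])
  define G where "G x = \<Gamma> S + - 1 * \<Gamma> (R x)" for x
  have G_C1: "C1_on (-{0}) G"
    unfolding G_def[abs_def]
    by (intro C1_on_add C1_on_mult C1_on_const C1_on_compose[OF \<Gamma>_C1 R_C1]) (use R_le a' b' in force)+
  define V where "V x = G x *\<^sub>R W x" for x
  have V_C1: "C1_on (-{0}) V" unfolding V_def[abs_def] by (intro C1_on_scaleR G_C1 W_C1)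
  have V_tang: "V x \<bullet> x = 0" if "x \<noteq> 0" for x using W_tangent[OF that] by (simp add: V_def)
  have div_V: "divergence V y = G y * divergence W y - lam (R y) ^ Suc m * (c y * (p y \<bullet> p y))" if y: "y \<noteq> 0" for y
  proof -
    have "R y \<in> {a'<..<b'}" using R_le[OF y] a' b' by auto
    from has_derivative_compose[OF R_has[OF y] \<Gamma>[OF this, unfolded has_field_derivative_def]]
    have "(G has_derivative (\<lambda>u. - (lam (R y) ^ m * (q y \<bullet> u)))) (at y)"
      unfolding G_def[abs_def] by (auto intro!: derivative_eq_intros)
    from frechet_derivative_at[OF has_derivative_scaleR[OF this DW_has[OF y]], symmetric]
    have "divergence V y = G y * divergence W y - lam (R y) ^ m * (\<Sum>b\<in>Basis. (q y \<bullet> b) * (W y \<bullet> b))"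
      by (simp add: V_def[abs_def] divergence_def inner_diff_left sum_subtractf sum_distrib_left mult.assoc)
    also have "(\<Sum>b\<in>Basis. (q y \<bullet> b) * (W y \<bullet> b)) = lam (R y) * (c y * (p y \<bullet> p y))"
      by (subst euclidean_inner[symmetric]) (simp add: q_eq[OF y] W_def)
    finally show ?thesis by (simp add: mult_ac)
  qed
  have lam'_mono: "lam' s \<le> lam' t" if "s \<le> t" "s \<in> {a<..<b}" "t \<in> {a<..<b}" for s t
    by (rule DERIV_nonneg_imp_nondecreasing[OF that(1)])
      (use that lam_derivs(2) lam''_nonneg in \<open>force simp: lam'_def\<close>)
  \<comment> \<open>Mean-convexity bounds \<open>div W\<close> and the convexity of \<open>lam\<close> bounds the resulting multiple of \<open>G\<close>.\<close>
  have key: "lam (R y) ^ Suc m * sqrt (1 + p y \<bullet> p y) \<le> lam S ^ Suc m - divergence V y" if y: "norm y = 1" for y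
  proof -
    have y0: "y \<noteq> 0" using y by auto
    let ?s = "R y"
    have s: "?s \<le> S" "a' < ?s" using R_le[OF y0] a' by auto
    have in1: "\<tau> \<in> {a<..<b}" "\<tau> \<in> {a'<..<b'}" if "?s \<le> \<tau>" "\<tau> \<le> S" for \<tau> using that s a' b' by auto
    have 1: "real (Suc m) * lam' ?s * (\<Gamma> S - \<Gamma> ?s) \<le> lam S ^ Suc m - lam ?s ^ Suc m" and 2: "\<Gamma> ?s \<le> \<Gamma> S"
      using convex_power_integral_bound[of ?s S lam lam' \<Gamma> m, OF lam_derivs(1)[OF in1(1)] \<Gamma>[OF in1(2)]
          less_imp_le[OF lam_pos[OF in1(1)]] lam'_mono[OF _ R_range[OF y0] in1(1)] s(1)] by blast+
    have "(real (Suc m) * lam' ?s * c y - divergence W y) / lam ?s > 0"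
      using mean_convex[of y] y by (simp add: mean_curvature_eq[OF y] n)
    then have 3: "divergence W y \<le> real (Suc m) * lam' ?s * c y"
      using lamR_pos[OF y0] by (simp add: zero_less_divide_iff)
    have G: "G y = \<Gamma> S - \<Gamma> ?s" by (simp add: G_def)
    have "G y * divergence W y \<le> G y * (real (Suc m) * lam' ?s * c y)"
      using 2 3 by (intro mult_left_mono) (auto simp: G)
    also have "\<dots> = (real (Suc m) * lam' ?s * (\<Gamma> S - \<Gamma> ?s)) * c y" by (simp add: G)
    also have "\<dots> \<le> (lam S ^ Suc m - lam ?s ^ Suc m) * c y"
      using 1 c_pos[of y] by (intro mult_right_mono) auto
    finally have "divergence V y + lam ?s ^ Suc m * (c y * (1 + p y \<bullet> p y)) \<le> lam S ^ Suc m * c y"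
      unfolding div_V[OF y0] by (simp add: algebra_simps)
    moreover have "c y * (1 + p y \<bullet> p y) = sqrt (1 + p y \<bullet> p y)"
      using c_arg_pos[of y] by (simp add: c_def divide_inverse[symmetric] mult.commute real_div_sqrt)
    moreover have "lam S ^ Suc m * c y \<le> lam S ^ Suc m * 1"
    proof (rule mult_left_mono)
      have "1 \<le> sqrt (1 + p y \<bullet> p y)" by simp
      then show "c y \<le> 1" unfolding c_def by (simp add: inverse_le_1_iff)
      show "0 \<le> lam S ^ Suc m" using lam_pos[OF r_range[OF y1(1)]] by (simp add: S_def)
    qed
    ultimately show ?thesis by simp
  qed
  let ?w = "\<lambda>x::real^'n. stereo_weight x ^ CARD('n)" and ?P = "inv_stereographic :: real^'n \<Rightarrow> _"
  let ?f = "\<lambda>y. lam (R y) ^ CARD('n) * sqrt (1 + p y \<bullet> p y)"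
  have f_cont: "continuous_on (sphere 0 1) ?f"
    by (intro continuous_intros continuous_on_subset[OF C1_on_continuous[OF lamR_C1]]
        continuous_on_subset[OF C1_on_continuous[OF p_C1]]) auto
  have d_cont: "continuous_on (sphere 0 1) (divergence V)"
    by (rule continuous_on_subset[OF continuous_on_divergence[OF V_C1]]) auto
  have w_int: "integrable lborel ?w" using integrable_stereo_weight[where 'a = "real^'n"] by simp
  have "area (warped_metric lam) (radial_graph r) = (LINT x|lborel. ?w x * ?f (?P x))"
    by (rule area_radial_graph[OF sg])
  also have "\<dots> \<le> (LINT x|lborel. ?w x * lam S ^ CARD('n) - ?w x * divergence V (?P x))"
  proof (rule integral_mono)
    show "integrable lborel (\<lambda>x. ?w x * ?f (?P x))" by (rule integrable_stereo[OF f_cont])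
    show "integrable lborel (\<lambda>x. ?w x * lam S ^ CARD('n) - ?w x * divergence V (?P x))"
      by (intro Bochner_Integration.integrable_diff integrable_mult_left w_int integrable_stereo[OF d_cont])
    fix x :: "real^'n"
    have "?w x * ?f (?P x) \<le> ?w x * (lam S ^ CARD('n) - divergence V (?P x))"
      using key[OF norm_inv_stereographic[of x]] stereo_weight_pos[of x]
      unfolding n by (intro mult_left_mono) auto
    then show "?w x * ?f (?P x) \<le> ?w x * lam S ^ CARD('n) - ?w x * divergence V (?P x)"
      by (simp only: right_diff_distrib)
  qed
  also have "\<dots> = (LINT x|lborel. ?w x) * lam S ^ CARD('n) - (LINT x|lborel. ?w x * divergence V (?P x))"
    using w_int integrable_stereo[OF d_cont] by simp
  also have "\<dots> = unit_sphere_area TYPE('n) * lam (SUP y\<in>sphere 0 1. r y) ^ CARD('n)"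
    by (simp add: sphere_divergence_theorem[OF V_C1 V_tang] unit_sphere_area_eq S)
  finally show ?thesis .
qed

end
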